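(* Let $F$ be a fixed graph with no isolated vertices. If $F$ contains an isolated edge, then $rsat(n,F)=O(1)$ for all sufficiently large $n$ (that is, there is a constant $c=c(F)$ with $rsat(n,F)\le c$ for all sufficiently large $n$). Otherwise, $rsat(n,F)=\Theta(n)$ (that is, there are constants $c_1,c_2>0$ depending only on $F$ with $c_1 n\le rsat(n,F)\le c_2 n$ for all sufficiently large $n$).
   Context: All graphs are finite, simple, undirected and have nonempty vertex set. $|G|$ and $e(G)$ denote the number of vertices and edges of $G$. An isolated edge of $F$ is a connected component of $F$ isomorphic to $K_2$. An edge-colored graph is a pair $(G,\mathcal C)$ with $\mathcal C:E(G)\to\mathbb N$ an arbitrary map (not necessarily a proper coloring). A subgraph is rainbow if its edges have pairwise distinct colors. For a nonedge $e$ of $G$ (a pair of distinct nonadjacent vertices) and $\alpha\in\mathbb N$, $(G,\mathcal C)+_\alpha e$ is the edge-colored graph obtained by adding $e$ with color $\alpha$. $(G,\mathcal C)$ is $F$-rainbow saturated if it contains no rainbow copy of $F$ (a copy is a not necessarily induced subgraph isomorphic to $F$) and, for every nonedge $e$ and every $\alpha\in\mathbb N$, $(G,\mathcal C)+_\alpha e$ contains a rainbow copy of $F$ containing $e$. $rsat(n,F)$ is the minimum of $e(G)$ over all graphs $G$ with $|G|=n$ such that $(G,\mathcal C)$ is $F$-rainbow saturated for some $\mathcal C$. *)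

theory Defs
  imports Complex_Main "HOL-Library.Landau_Symbols"
begin

datatype 'a graph = Graph (verts: "'a set") (edges: "'a set set")

definition simple_graph :: "'a graph \<Rightarrow> bool" where
  "simple_graph G \<longleftrightarrow> finite (verts G) \<and> verts G \<noteq> {} \<and>
     (\<forall>e\<in>edges G. e \<subseteq> verts G \<and> card e = 2)"

definition subgraph :: "'a graph \<Rightarrow> 'a graph \<Rightarrow> bool" where
  "subgraph H G \<longleftrightarrow> simple_graph H \<and> verts H \<subseteq> verts G \<and> edges H \<subseteq> edges G"

definition isomorphic :: "'a graph \<Rightarrow> 'b graph \<Rightarrow> bool" where
  "isomorphic G H \<longleftrightarrow>
     (\<exists>f. bij_betw f (verts G) (verts H) \<and> edges H = (\<lambda>e. f ` e) ` edges G)"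

definition complete_graph :: "nat \<Rightarrow> nat graph" where
  "complete_graph n = Graph {..<n} {e. e \<subseteq> {..<n} \<and> card e = 2}"

definition no_isolated_vertices :: "'a graph \<Rightarrow> bool" where
  "no_isolated_vertices G \<longleftrightarrow> (\<forall>v\<in>verts G. \<exists>e\<in>edges G. v \<in> e)"

definition induced_subgraph :: "'a graph \<Rightarrow> 'a set \<Rightarrow> 'a graph" where
  "induced_subgraph G X = Graph X {e \<in> edges G. e \<subseteq> X}"

definition adjacency :: "'a graph \<Rightarrow> 'a rel" where
  "adjacency G = {(u, v). {u, v} \<in> edges G}"

definition components :: "'a graph \<Rightarrow> 'a graph set" where
  "components G = {induced_subgraph G ((adjacency G)\<^sup>* `` {v}) | v. v \<in> verts G}"

definition has_isolated_edge :: "'a graph \<Rightarrow> bool" where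
  "has_isolated_edge F \<longleftrightarrow> (\<exists>H\<in>components F. isomorphic H (complete_graph 2))"

text \<open>An edge-colored graph is a pair of a graph and a color function; only the values of the
  color function on the edges of the graph are relevant.\<close>

type_synonym 'a colored_graph = "'a graph \<times> ('a set \<Rightarrow> nat)"

definition rainbow :: "('a set \<Rightarrow> nat) \<Rightarrow> 'a graph \<Rightarrow> bool" where
  "rainbow C H \<longleftrightarrow> inj_on C (edges H)"

definition rainbow_copy :: "'b graph \<Rightarrow> 'a colored_graph \<Rightarrow> 'a graph \<Rightarrow> bool" where
  "rainbow_copy F GC H \<longleftrightarrow>
     subgraph H (fst GC) \<and> isomorphic F H \<and> rainbow (snd GC) H"

definition nonedges :: "'a graph \<Rightarrow> 'a set set" where
  "nonedges G = {e. e \<subseteq> verts G \<and> card e = 2 \<and> e \<notin> edges G}"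

definition add_edge :: "'a colored_graph \<Rightarrow> nat \<Rightarrow> 'a set \<Rightarrow> 'a colored_graph" where
  "add_edge GC \<alpha> e = (Graph (verts (fst GC)) (insert e (edges (fst GC))), (snd GC)(e := \<alpha>))"

definition rainbow_saturated :: "'b graph \<Rightarrow> 'a colored_graph \<Rightarrow> bool" where
  "rainbow_saturated F GC \<longleftrightarrow>
     (\<nexists>H. rainbow_copy F GC H) \<and>
     (\<forall>e\<in>nonedges (fst GC). \<forall>\<alpha>. \<exists>H. rainbow_copy F (add_edge GC \<alpha> e) H \<and> e \<in> edges H)"

text \<open>Up to isomorphism every finite graph has its vertices in \<open>nat\<close>, so it suffices to let the
  host graphs range over graphs on natural numbers.\<close>

definition saturated_sizes :: "nat \<Rightarrow> 'b graph \<Rightarrow> nat set" where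
  "saturated_sizes n F =
     {card (edges G) | (G :: nat graph) C.
        simple_graph G \<and> card (verts G) = n \<and> rainbow_saturated F (G, C)}"

definition rsat :: "nat \<Rightarrow> 'b graph \<Rightarrow> nat" where
  "rsat n F = Inf (saturated_sizes n F)"

text \<open>On \<open>nat\<close>, \<open>Inf\<close> of a nonempty set is its minimum. For \<open>n \<ge> 1\<close> and \<open>F\<close>
  without isolated vertices the set of sizes is nonempty, so the value of \<open>Inf {}\<close> plays no role.\<close>

lemma saturated_sizes_nonempty:
  assumes F: "simple_graph F" "no_isolated_vertices F" and n: "n \<ge> 1"
  shows "saturated_sizes n F \<noteq> {}"
proof (cases "\<exists>e1\<in>edges F. \<exists>e2\<in>edges F. e1 \<noteq> e2")
  case True
  then obtain e1 e2 where e: "e1 \<in> edges F" "e2 \<in> edges F" "e1 \<noteq> e2" by blast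
  let ?G = "complete_graph n" and ?C = "\<lambda>_ :: nat set. 0 :: nat"
  have "\<not> rainbow_copy F (?G, ?C) H" for H
  proof
    assume "rainbow_copy F (?G, ?C) H"
    then obtain f where f: "bij_betw f (verts F) (verts H)" "edges H = (\<lambda>e. f ` e) ` edges F"
      and r: "inj_on ?C (edges H)"
      by (auto simp: rainbow_copy_def isomorphic_def rainbow_def)
    have "f ` e1 \<in> edges H" "f ` e2 \<in> edges H" using e(1,2) unfolding f(2) by blast+
    then have "f ` e1 = f ` e2" using inj_onD[OF r] by blast
    moreover have "e1 \<subseteq> verts F" "e2 \<subseteq> verts F" using F(1) e by (auto simp: simple_graph_def)
    ultimately show False using f(1) e(3) by (metis bij_betw_def inj_on_image_eq_iff)
  qed
  moreover have "nonedges ?G = {}" by (auto simp: nonedges_def complete_graph_def)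
  ultimately have "rainbow_saturated F (?G, ?C)" by (simp add: rainbow_saturated_def)
  moreover have "simple_graph ?G" "card (verts ?G) = n"
    using n by (auto simp: simple_graph_def complete_graph_def lessThan_empty_iff)
  ultimately show ?thesis unfolding saturated_sizes_def by blast
next
  case False
  obtain e0 where e0: "e0 \<in> edges F"
    using F unfolding simple_graph_def no_isolated_vertices_def by blast
  have E: "edges F = {e0}" using False e0 by blast
  have c0: "card e0 = 2" and "e0 \<subseteq> verts F"
    using F(1) e0 unfolding simple_graph_def by blast+
  moreover have "verts F \<subseteq> e0" using F(2) unfolding no_isolated_vertices_def E by blast
  ultimately have V: "verts F = e0" by blast
  let ?G = "Graph {..<n} {}" and ?C = "\<lambda>_ :: nat set. 0 :: nat"
  have "\<not> rainbow_copy F (?G, ?C) H" for H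
    using e0 by (auto simp: rainbow_copy_def isomorphic_def subgraph_def)
  moreover have "\<exists>H. rainbow_copy F (add_edge (?G, ?C) \<alpha> e) H \<and> e \<in> edges H"
    if "e \<in> nonedges ?G" for \<alpha> e
  proof -
    have e: "card e = 2" "e \<subseteq> {..<n}" using that by (auto simp: nonedges_def)
    have fin: "finite e" "finite e0" "e \<noteq> {}"
      using e(1) c0 by (metis card.infinite zero_neq_numeral, metis card.infinite zero_neq_numeral, force)
    then obtain f where f: "bij_betw f e0 e"
      using c0 e finite_same_card_bij by metis
    have "isomorphic F (Graph e {e})"
      unfolding isomorphic_def
      by (rule exI[of _ f]) (simp add: V E f bij_betw_imp_surj_on[OF f])
    then have "rainbow_copy F (add_edge (?G, ?C) \<alpha> e) (Graph e {e})"
      using e fin by (simp add: rainbow_copy_def subgraph_def simple_graph_def rainbow_def add_edge_def)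
    then show ?thesis by force
  qed
  ultimately have "rainbow_saturated F (?G, ?C)" by (simp add: rainbow_saturated_def)
  moreover have "simple_graph ?G" "card (verts ?G) = n"
    using n by (auto simp: simple_graph_def lessThan_empty_iff)
  ultimately show ?thesis unfolding saturated_sizes_def by blast
qed

end

theory Submission
  imports Defs "HOL-Library.FuncSet"
begin


text \<open>
  It suffices to exhibit a colored graph without rainbow copy of \<open>F\<close> in which all but few
  pairs are nonedges that complete a copy in every color: adding edges greedily only uses the few
  exceptional pairs. If \<open>F\<close> has an isolated edge, a bounded graph (a rainbow clique, or a
  cocktail-party graph) has only boundedly many exceptional pairs. Otherwise two isolated vertices
  of a saturated graph could not be joined, which gives the linear lower bound.

  For the linear upper bound, suppose first that a largest component of \<open>F\<close> has a leaf. Disjoint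
  rainbow cliques, one vertex smaller than that component, then work, together with copies of the
  other largest components that draw on too few colors. Otherwise a bounded core is joined
  completely to the remaining vertices, so that only the part \<open>V - W\<close> of \<open>F\<close> outside an
  embedded \<open>W\<close> matters. If some \<open>V - W\<close> is a matching, the remaining vertices may be
  independent. If not, they carry an arc-maximal sparse digraph without forbidden components: by
  maximality a new arc at almost every vertex creates such a component, with its new vertex a leaf,
  and the missing components are supplied by a finite universal graph \<open>\<Gamma>\<close>. The core is itself
  edgeless when \<open>F\<close> is bipartite, and of the form \<open>\<Gamma>\<close> otherwise.
\<close>

section \<open>Partially colored hosts\<close>

text \<open>The obstacle is that the color of the added edge is chosen last and may occur anywhere
  in the host, so every copy must be reroutable around one arbitrary color. Three devices provide
  the slack. A palette of \<open>e + 1\<close> colors serves a piece with \<open>e\<close> edges: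
  for each color some copy omits it, yet two disjoint copies have \<open>2 * e\<close> edges, too
  many as soon as \<open>e\<close> is at least 2. Next, colors are local: one tied to the
  surroundings of one end of the added edge is not tied to those of the other, so exchanging the two
  ends escapes it. Finally, coloring an arc by its tail makes in-stars rainbow and lets a rainbow
  subgraph use at most one of the arcs leaving a vertex; a vertex without incoming arcs is then a
  leaf of whatever it helps to create, and any other distant vertex can take over its role.
  Linearity comes from bounded degrees: exceptional pairs have their ends at bounded distance, in a
  common block, or one end in a bounded set.\<close>

text \<open>A host assigns to two vertices the color of their edge, or \<open>None\<close> for a nonedge;
  \<open>emb A adj U h f\<close> says that \<open>f\<close> embeds the graph induced on \<open>A\<close> as a rainbow subgraph.\<close>

definition emb :: "'a set \<Rightarrow> ('a \<Rightarrow> 'a \<Rightarrow> bool) \<Rightarrow> 'v set \<Rightarrow> ('v \<Rightarrow> 'v \<Rightarrow> 'c option) \<Rightarrow> ('a \<Rightarrow> 'v) \<Rightarrow> bool" where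
  "emb A adj U h f \<longleftrightarrow> inj_on f A \<and> f ` A \<subseteq> U \<and>
     (\<forall>x\<in>A. \<forall>y\<in>A. adj x y \<longrightarrow> h (f x) (f y) \<noteq> None) \<and>
     (\<forall>x\<in>A. \<forall>y\<in>A. \<forall>x'\<in>A. \<forall>y'\<in>A. adj x y \<longrightarrow> adj x' y' \<longrightarrow>
        h (f x) (f y) = h (f x') (f y') \<longrightarrow> {x, y} = {x', y'})"

definition sym_host :: "('v \<Rightarrow> 'v \<Rightarrow> 'c option) \<Rightarrow> bool" where
  "sym_host h \<longleftrightarrow> (\<forall>x y. h x y = h y x)"

definition recolor :: "('v \<Rightarrow> 'v \<Rightarrow> 'c option) \<Rightarrow> 'v \<Rightarrow> 'v \<Rightarrow> 'c \<Rightarrow> 'v \<Rightarrow> 'v \<Rightarrow> 'c option" where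
  "recolor h u v c = (\<lambda>x y. if {x, y} = {u, v} then Some c else h x y)"

text \<open>Nothing forces the embedding to use the pair \<open>u\<close>, \<open>v\<close>; in a
  host without copies it has to.\<close>

definition good :: "'a set \<Rightarrow> ('a \<Rightarrow> 'a \<Rightarrow> bool) \<Rightarrow> 'v set \<Rightarrow> ('v \<Rightarrow> 'v \<Rightarrow> 'c option) \<Rightarrow> 'v \<Rightarrow> 'v \<Rightarrow> bool" where
  "good A adj U h u v \<longleftrightarrow> (\<forall>c. \<exists>f. emb A adj U (recolor h u v c) f)"

definition adj_of :: "'a graph \<Rightarrow> 'a \<Rightarrow> 'a \<Rightarrow> bool" where
  "adj_of F x y \<longleftrightarrow> {x, y} \<in> edges F"

lemma simple_edgeE:
  assumes "simple_graph F" "e \<in> edges F"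
  obtains x y where "e = {x, y}" "x \<noteq> y" "x \<in> verts F" "y \<in> verts F" "adj_of F x y"
  using assms unfolding simple_graph_def adj_of_def
  by (metis card_2_iff insert_subset)

lemma adj_ofD:
  assumes "simple_graph F" "adj_of F x y"
  shows "x \<noteq> y" "x \<in> verts F" "y \<in> verts F" "adj_of F y x"
  using assms by (auto simp: simple_graph_def adj_of_def insert_commute)

lemma recolor_commute: "recolor h u v c = recolor h v u c"
  by (auto simp: recolor_def fun_eq_iff insert_commute)

lemma rainbow_copyI:
  assumes F: "simple_graph F" and f: "inj_on f (verts F)" "f ` verts F \<subseteq> verts G"
    and E: "\<And>e. e \<in> edges F \<Longrightarrow> f ` e \<in> edges G"
    and C: "\<And>e e'. e \<in> edges F \<Longrightarrow> e' \<in> edges F \<Longrightarrow> C (f ` e) = C (f ` e') \<Longrightarrow> e = e'"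
  shows "rainbow_copy F (G, C) (Graph (f ` verts F) ((`) f ` edges F))"
proof -
  have "card (f ` e) = 2" if "e \<in> edges F" for e
    using that F f(1) by (metis card_image inj_on_subset simple_graph_def)
  moreover have "f ` e \<subseteq> f ` verts F" if "e \<in> edges F" for e
    using that F by (auto simp: simple_graph_def)
  ultimately have "subgraph (Graph (f ` verts F) ((`) f ` edges F)) G"
    using F f E by (auto simp: subgraph_def simple_graph_def)
  moreover have "isomorphic F (Graph (f ` verts F) ((`) f ` edges F))"
    unfolding isomorphic_def using f(1) by (auto intro!: exI[of _ f] simp: bij_betw_def)
  moreover have "inj_on C ((`) f ` edges F)"
    using C by (auto simp: inj_on_def)
  ultimately show ?thesis by (simp add: rainbow_copy_def rainbow_def)
qed

lemma rainbow_copyE: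
  assumes "rainbow_copy F (G, C) H" and F: "simple_graph F"
  obtains f where "inj_on f (verts F)" "f ` verts F \<subseteq> verts G" "edges H = (`) f ` edges F"
    "\<And>e. e \<in> edges F \<Longrightarrow> f ` e \<in> edges G"
    "\<And>e e'. e \<in> edges F \<Longrightarrow> e' \<in> edges F \<Longrightarrow> C (f ` e) = C (f ` e') \<Longrightarrow> e = e'"
proof -
  from assms(1) obtain f where f: "bij_betw f (verts F) (verts H)" "edges H = (`) f ` edges F"
    and sub: "subgraph H G" and inj: "inj_on C (edges H)"
    by (auto simp: rainbow_copy_def isomorphic_def rainbow_def)
  show thesis
  proof
    show "inj_on f (verts F)" "f ` verts F \<subseteq> verts G" "edges H = (`) f ` edges F"
      using f sub by (auto simp: bij_betw_def subgraph_def)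
    show "f ` e \<in> edges G" if "e \<in> edges F" for e
      using that f sub by (auto simp: subgraph_def)
    show "e = e'" if "e \<in> edges F" "e' \<in> edges F" "C (f ` e) = C (f ` e')" for e e'
    proof -
      have "f ` e = f ` e'" using that inj f(2) by (auto simp: inj_on_def)
      moreover have "e \<subseteq> verts F" "e' \<subseteq> verts F" using that F by (auto simp: simple_graph_def)
      ultimately show ?thesis using f(1) by (metis bij_betw_def inj_on_image_eq_iff)
    qed
  qed
qed

text \<open>Greedy completion: an edge-maximal colored graph that extends the host without a rainbow
  copy is saturated, and it contains no edge at a pair that completes a copy in every color.\<close>

theorem host_saturated:
  fixes F :: "'a graph" and h :: "'v \<Rightarrow> 'v \<Rightarrow> 'c option"
  assumes F: "simple_graph F" and U: "finite U" "U \<noteq> {}" and h: "sym_host h"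
    and free: "\<And>f. \<not> emb (verts F) (adj_of F) U h f"
    and P: "finite P"
      "\<And>u v. u \<in> U \<Longrightarrow> v \<in> U \<Longrightarrow> u \<noteq> v \<Longrightarrow> {u, v} \<notin> P \<Longrightarrow>
         h u v = None \<and> good (verts F) (adj_of F) U h u v"
  shows "rsat (card U) F \<le> card P"
proof -
  obtain b where b: "bij_betw b U {..<card U}"
    using U(1) by (metis ex_bij_betw_finite_nat atLeast0LessThan)
  define a where "a = inv_into U b"
  have ab: "a (b x) = x" if "x \<in> U" for x
    using that b by (simp add: a_def bij_betw_def)
  have ba: "b (a i) = i" "a i \<in> U" if "i < card U" for i
    using that b by (auto simp: a_def bij_betw_def f_inv_into_f inv_into_into)
  have bU: "b x < card U" if "x \<in> U" for x using that b by (auto simp: bij_betw_def)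
  define used where "used = {c. \<exists>x\<in>U. \<exists>y\<in>U. h x y = Some c}"
  have "used \<subseteq> (\<lambda>(x, y). the (h x y)) ` (U \<times> U)"
    by (force simp: used_def)
  then have "finite used" using U(1) by (meson finite_SigmaI finite_imageI finite_subset)
  then obtain \<kappa> :: "'c \<Rightarrow> nat" where \<kappa>: "inj_on \<kappa> used"
    using finite_imp_inj_to_nat_seg by blast
  \<comment> \<open>A coloring acts on sets, a host on ordered pairs: \<open>Min\<close> and
    \<open>Max\<close> order the ends of an edge, and symmetry of \<open>h\<close> makes the order
    immaterial.\<close>
  define C0 where "C0 e = \<kappa> (the (h (a (Min e)) (a (Max e))))" for e
  have C0: "C0 {b x, b y} = \<kappa> (the (h x y))" if "x \<in> U" "y \<in> U" for x y
  proof (cases "b x \<le> b y")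
    case True
    then have "Min {b x, b y} = b x" "Max {b x, b y} = b y" by auto
    then show ?thesis using that by (simp add: C0_def ab)
  next
    case False
    then have "Min {b x, b y} = b y" "Max {b x, b y} = b x" by auto
    then show ?thesis using that h by (simp add: C0_def ab sym_host_def)
  qed
  define E0 where "E0 = {{b x, b y} |x y. x \<in> U \<and> y \<in> U \<and> x \<noteq> y \<and> h x y \<noteq> None}"
  have E0D: "h x y \<noteq> None" if "{b x, b y} \<in> E0" "x \<in> U" "y \<in> U" for x y
  proof -
    from that(1) obtain x' y' where xy: "{b x, b y} = {b x', b y'}" "x' \<in> U" "y' \<in> U" "h x' y' \<noteq> None"
      unfolding E0_def by blast
    have "(x = x' \<and> y = y') \<or> (x = y' \<and> y = x')"
      using xy that(2,3) ab by (metis doubleton_eq_iff)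
    then show ?thesis using xy h by (auto simp: sym_host_def)
  qed
  \<comment> \<open>The coloring is prescribed on host edges only, so the maximum below is taken
    over all colorings of the further edges as well.\<close>
  define Q where "Q G C \<longleftrightarrow> simple_graph G \<and> verts G = {..<card U} \<and> E0 \<subseteq> edges G \<and>
     (\<forall>e\<in>E0. C e = C0 e) \<and> (\<nexists>H. rainbow_copy F (G, C) H)" for G :: "nat graph" and C
  define G0 where "G0 = Graph {..<card U} E0"
  have bne: "b x \<noteq> b y" if "x \<in> U" "y \<in> U" "x \<noteq> y" for x y using that ab by metis
  have simG0: "simple_graph G0"
    using U bU bne by (auto simp: G0_def simple_graph_def E0_def card_gt_0_iff)
  have "Q G0 C0"
    unfolding Q_def
  proof (intro conjI notI)
    show "simple_graph G0" "verts G0 = {..<card U}" "E0 \<subseteq> edges G0" "\<forall>e\<in>E0. C0 e = C0 e"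
      using simG0 by (auto simp: G0_def)
    assume "\<exists>H. rainbow_copy F (G0, C0) H"
    then obtain H where H: "rainbow_copy F (G0, C0) H" by blast
    obtain f where f: "inj_on f (verts F)" "f ` verts F \<subseteq> verts G0"
      "\<And>e. e \<in> edges F \<Longrightarrow> f ` e \<in> edges G0"
      "\<And>e e'. e \<in> edges F \<Longrightarrow> e' \<in> edges F \<Longrightarrow> C0 (f ` e) = C0 (f ` e') \<Longrightarrow> e = e'"
      using rainbow_copyE[OF H F] by metis
    have fl: "f x < card U" if "x \<in> verts F" for x using that f(2) by (auto simp: G0_def)
    define g where "g = a \<circ> f"
    have gU: "g x \<in> U" "b (g x) = f x" if "x \<in> verts F" for x
      using fl[OF that] ba by (auto simp: g_def)
    have E: "{b (g x), b (g y)} \<in> E0" if "x \<in> verts F" "y \<in> verts F" "adj_of F x y" for x y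
      using f(3)[of "{x, y}"] that gU by (simp add: adj_of_def G0_def)
    have "emb (verts F) (adj_of F) U h g"
      unfolding emb_def
    proof (intro conjI ballI impI)
      show "inj_on g (verts F)" using f(1) gU(2) by (metis inj_onD inj_onI)
      show "g ` verts F \<subseteq> U" using gU by blast
      fix x y assume xy: "x \<in> verts F" "y \<in> verts F" "adj_of F x y"
      show "h (g x) (g y) \<noteq> None" using E0D E[OF xy] gU xy by blast
      fix x' y' assume xy': "x' \<in> verts F" "y' \<in> verts F" "adj_of F x' y'"
        and eq: "h (g x) (g y) = h (g x') (g y')"
      have "C0 (f ` {x, y}) = C0 (f ` {x', y'})"
        using C0[of "g x" "g y"] C0[of "g x'" "g y'"] gU xy xy' eq by simp
      then show "{x, y} = {x', y'}" using f(4) xy xy' by (simp add: adj_of_def)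
    qed
    then show False using free by blast
  qed
  moreover have bound: "card (edges G) < Suc (card (Pow {..<card U}))" if "Q G C" for G C
  proof -
    have "edges G \<subseteq> Pow {..<card U}" using that by (auto simp: Q_def simple_graph_def)
    then show ?thesis by (meson card_mono finite_Pow_iff finite_lessThan le_imp_less_Suc)
  qed
  ultimately obtain G C where GC: "Q G C" and max: "\<And>G' C'. Q G' C' \<Longrightarrow> card (edges G') \<le> card (edges G)"
    using ex_has_greatest_nat[of "\<lambda>p. Q (fst p) (snd p)" "(G0, C0)" "\<lambda>p. card (edges (fst p))" "Suc (card (Pow {..<card U}))"]
    by (metis fst_conv snd_conv prod.collapse less_imp_le)
  have simG: "simple_graph G" and VG: "verts G = {..<card U}" using GC by (auto simp: Q_def)
  have finE: "finite (edges G)"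
    using simG by (meson finite_Pow_iff finite_subset Pow_iff simple_graph_def subsetI)
  have sat: "rainbow_saturated F (G, C)"
    unfolding rainbow_saturated_def
  proof (intro conjI ballI allI)
    show "\<nexists>H. rainbow_copy F (G, C) H" using GC by (simp add: Q_def)
    fix e \<alpha> assume e: "e \<in> nonedges (fst (G, C))"
    then have e': "e \<subseteq> verts G" "card e = 2" "e \<notin> edges G" by (auto simp: nonedges_def)
    define G1 where "G1 = Graph (verts G) (insert e (edges G))"
    have ae: "add_edge (G, C) \<alpha> e = (G1, C(e := \<alpha>))" by (simp add: add_edge_def G1_def)
    have "card (edges G1) > card (edges G)" using finE e' by (simp add: G1_def)
    then have "\<not> Q G1 (C(e := \<alpha>))" using max by force
    moreover have "simple_graph G1" using simG e' by (auto simp: G1_def simple_graph_def)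
    moreover have "(C(e := \<alpha>)) e0 = C0 e0" if "e0 \<in> E0" for e0
      using that GC e'(3) by (auto simp: Q_def)
    moreover have "verts G1 = {..<card U}" "E0 \<subseteq> edges G1"
      using GC by (auto simp: Q_def G1_def)
    ultimately obtain H where H: "rainbow_copy F (G1, C(e := \<alpha>)) H"
      unfolding Q_def by blast
    \<comment> \<open>A copy avoiding \<open>e\<close> would already be a copy in
      \<open>G\<close>.\<close>
    have "e \<in> edges H"
    proof (rule ccontr)
      assume "e \<notin> edges H"
      then have "inj_on (C(e := \<alpha>)) (edges H) = inj_on C (edges H)"
        by (intro inj_on_cong) auto
      with \<open>e \<notin> edges H\<close> have "rainbow_copy F (G, C) H"
        using H by (auto simp: rainbow_copy_def subgraph_def G1_def rainbow_def)
      then show False using GC by (auto simp: Q_def)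
    qed
    then show "\<exists>H. rainbow_copy F (add_edge (G, C) \<alpha> e) H \<and> e \<in> edges H" using H ae by auto
  qed
  have EP: "edges G \<subseteq> (`) b ` P"
  proof
    fix e assume e: "e \<in> edges G"
    then obtain i j where ij: "e = {i, j}" "i \<noteq> j" "i < card U" "j < card U"
      using simple_edgeE[OF simG e] VG by (metis lessThan_iff)
    define u v where "u = a i" and "v = a j"
    have uv: "u \<in> U" "v \<in> U" "b u = i" "b v = j" using ij ba by (auto simp: u_def v_def)
    then have "u \<noteq> v" using ij by auto
    show "e \<in> (`) b ` P"
    proof (rule ccontr)
      assume "e \<notin> (`) b ` P"
      moreover have "b ` {u, v} = e" using ij uv by simp
      ultimately have "{u, v} \<notin> P" by blast
      then have hn: "h u v = None" and gd: "good (verts F) (adj_of F) U h u v"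
        using P(2) uv \<open>u \<noteq> v\<close> by auto
      \<comment> \<open>If \<open>C e\<close> is the code of a host color, \<open>c\<close> is that
        color; otherwise \<open>c\<close> is arbitrary. In the second case the host edges of the
        copy cannot have the color \<open>C e\<close>, so an embedding that is rainbow for
        \<open>c\<close> stays rainbow for \<open>C e\<close>, and the color type \<open>'c\<close>
        does not have to contain a spare color.\<close>
      have "\<exists>c. C e \<in> \<kappa> ` used \<longrightarrow> \<kappa> c = C e \<and> c \<in> used" by force
      then obtain c where c: "C e \<in> \<kappa> ` used \<Longrightarrow> \<kappa> c = C e \<and> c \<in> used" by blast
      obtain f where f: "emb (verts F) (adj_of F) U (recolor h u v c) f" using gd by (auto simp: good_def)
      define g where "g = b \<circ> f"
      have fU: "f x \<in> U" if "x \<in> verts F" for x using f that by (auto simp: emb_def)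
      have fne: "f x \<noteq> f y" if "x \<in> verts F" "y \<in> verts F" "x \<noteq> y" for x y
        using f that by (auto simp: emb_def inj_on_def)
      have col: "g ` {x, y} \<in> edges G \<and> (C (g ` {x, y}) = (if {f x, f y} = {u, v} then C e else \<kappa> (the (h (f x) (f y)))))
          \<and> ({f x, f y} \<noteq> {u, v} \<longrightarrow> (\<exists>d\<in>used. h (f x) (f y) = Some d))"
        if xy: "x \<in> verts F" "y \<in> verts F" "adj_of F x y" for x y
      proof (cases "{f x, f y} = {u, v}")
        case True
        then have "g ` {x, y} = e" unfolding g_def ij(1) uv(3,4)[symmetric]
          by (metis image_comp image_empty image_insert)
        then show ?thesis using e True by simp
      next
        case False
        have "recolor h u v c (f x) (f y) \<noteq> None" using f xy unfolding emb_def by blast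
        then have "h (f x) (f y) \<noteq> None" using False by (simp add: recolor_def)
        moreover have "f x \<noteq> f y" using fne xy adj_ofD(1)[OF F] by blast
        ultimately have "{b (f x), b (f y)} \<in> E0" unfolding E0_def using fU xy by blast
        then have "g ` {x, y} \<in> E0" by (simp add: g_def)
        moreover have "C0 (g ` {x, y}) = \<kappa> (the (h (f x) (f y)))" using C0 fU xy by (simp add: g_def)
        ultimately show ?thesis using GC False fU xy \<open>h (f x) (f y) \<noteq> None\<close>
          by (auto simp: Q_def used_def)
      qed
      have "rainbow_copy F (G, C) (Graph (g ` verts F) ((`) g ` edges F))"
      proof (rule rainbow_copyI[OF F])
        show "inj_on g (verts F)" unfolding g_def
          using f b fU by (intro comp_inj_on) (auto simp: emb_def bij_betw_def inj_on_def)
        show "g ` verts F \<subseteq> verts G" using fU bU VG by (auto simp: g_def)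
        show "g ` e1 \<in> edges G" if "e1 \<in> edges F" for e1
          using simple_edgeE[OF F that] col by metis
        show "e1 = e2" if e12: "e1 \<in> edges F" "e2 \<in> edges F" "C (g ` e1) = C (g ` e2)" for e1 e2
        proof -
          obtain x y where xy: "e1 = {x, y}" "x \<in> verts F" "y \<in> verts F" "adj_of F x y"
            using simple_edgeE[OF F e12(1)] by metis
          obtain x' y' where xy': "e2 = {x', y'}" "x' \<in> verts F" "y' \<in> verts F" "adj_of F x' y'"
            using simple_edgeE[OF F e12(2)] by metis
          have val: "\<exists>d. recolor h u v c (f s) (f t) = Some d \<and>
              (d \<in> used \<and> C (g ` {s, t}) = \<kappa> d \<or> d = c \<and> C (g ` {s, t}) = C e)"
            if "s \<in> verts F" "t \<in> verts F" "adj_of F s t" for s t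
            using col[OF that] by (auto simp: recolor_def split: if_splits)
          obtain d where d: "recolor h u v c (f x) (f y) = Some d"
            "d \<in> used \<and> C (g ` e1) = \<kappa> d \<or> d = c \<and> C (g ` e1) = C e"
            using val[OF xy(2-4)] xy(1) by blast
          obtain d' where d': "recolor h u v c (f x') (f y') = Some d'"
            "d' \<in> used \<and> C (g ` e2) = \<kappa> d' \<or> d' = c \<and> C (g ` e2) = C e"
            using val[OF xy'(2-4)] xy'(1) by blast
          have "d = d'" using d(2) d'(2) e12(3) c \<kappa> by (metis image_eqI inj_onD)
          then have "recolor h u v c (f x) (f y) = recolor h u v c (f x') (f y')" using d(1) d'(1) by simp
          then show ?thesis using f xy xy' unfolding emb_def by blast
        qed
      qed
      then show False using GC by (auto simp: Q_def)
    qed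
  qed
  have "card (edges G) \<le> card P"
    using EP P(1) by (meson card_image_le card_mono finite_imageI order_trans)
  moreover have "card (edges G) \<in> saturated_sizes (card U) F"
    unfolding saturated_sizes_def using simG VG sat by force
  ultimately show ?thesis unfolding rsat_def by (meson cInf_lower bdd_below_bot order_trans)
qed

text \<open>Joining two isolated vertices would require a copy in which the new edge is isolated,
  whereas \<open>ne\<close> supplies a further edge at one of its ends. So at most one vertex is
  isolated, and all others are covered by edges.\<close>

lemma no_isolated_pair_lower:
  assumes F: "simple_graph F" "no_isolated_vertices F"
    and ne: "\<And>p q. adj_of F p q \<Longrightarrow> \<exists>z. (z \<noteq> p \<and> z \<noteq> q) \<and> (adj_of F p z \<or> adj_of F q z)"
    and G: "simple_graph G" "rainbow_saturated F (G, C)"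
  shows "card (verts G) \<le> 2 * card (edges G) + 1"
proof -
  define I where "I = {v \<in> verts G. \<forall>e\<in>edges G. v \<notin> e}"
  have finV: "finite (verts G)" using G by (simp add: simple_graph_def)
  have finE: "finite (edges G)"
    using G by (meson finite_Pow_iff finite_subset Pow_iff simple_graph_def subsetI)
  have "card I \<le> 1"
  proof (rule ccontr)
    assume "\<not> card I \<le> 1"
    moreover have "finite I" using finV by (simp add: I_def)
    ultimately obtain u v where uv: "u \<in> I" "v \<in> I" "u \<noteq> v"
      using card_le_Suc0_iff_eq[of I] by auto
    then have "{u, v} \<in> nonedges G" by (auto simp: nonedges_def I_def)
    then obtain H where H: "rainbow_copy F (add_edge (G, C) 0 {u, v}) H" "{u, v} \<in> edges H"
      using G(2) unfolding rainbow_saturated_def by fastforce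
    define G1 where "G1 = Graph (verts G) (insert {u, v} (edges G))"
    obtain f where f: "inj_on f (verts F)" "edges H = (`) f ` edges F"
      "\<And>e. e \<in> edges F \<Longrightarrow> f ` e \<in> edges G1"
      using rainbow_copyE[of F G1 "C({u, v} := 0)" H] H F by (simp add: add_edge_def G1_def) metis
    obtain e where e: "e \<in> edges F" "f ` e = {u, v}" using H(2) f(2) by auto
    obtain p q where pq: "e = {p, q}" "adj_of F p q" "p \<in> verts F" "q \<in> verts F"
      using simple_edgeE[OF F(1) e(1)] by metis
    obtain z where z: "z \<noteq> p" "z \<noteq> q" "adj_of F p z \<or> adj_of F q z" using ne pq by blast
    have zV: "z \<in> verts F" using z(3) adj_ofD[OF F(1)] by blast
    then obtain w where w: "w \<in> {p, q}" "{w, z} \<in> edges F" using z by (auto simp: adj_of_def)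
    have "f w \<in> {u, v}" using e pq w by auto
    moreover have "f z \<notin> {u, v}"
    proof
      assume "f z \<in> {u, v}"
      then have "f z \<in> f ` {p, q}" using e pq by simp
      then show False using f(1) zV pq z by (auto simp: inj_on_def)
    qed
    moreover have "{f w, f z} \<in> edges G1" using f(3)[OF w(2)] by simp
    ultimately have "{f w, f z} \<in> edges G" "f w \<in> {u, v}" by (auto simp: G1_def doubleton_eq_iff)
    then show False using uv by (auto simp: I_def)
  qed
  moreover have "verts G \<subseteq> I \<union> \<Union> (edges G)" by (auto simp: I_def)
  moreover have "card (\<Union> (edges G)) \<le> 2 * card (edges G)"
  proof -
    have "card (\<Union> (edges G)) \<le> (\<Sum>e\<in>edges G. card e)"
      by (rule card_Union_le_sum_card)
    also have "\<dots> = (\<Sum>e\<in>edges G. 2)" using G(1) by (intro sum.cong) (auto simp: simple_graph_def)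
    finally show ?thesis by simp
  qed
  moreover have "finite (\<Union> (edges G))"
    by (rule finite_subset[OF _ finV]) (use G(1) in \<open>auto simp: simple_graph_def\<close>)
  moreover have "finite I" using finV by (simp add: I_def)
  ultimately show ?thesis
    by (smt (verit, best) card_Un_le card_mono finite_UnI add.commute add_le_mono le_trans)
qed


section \<open>Connected pieces and the universal graph\<close>

lemma embI:
  assumes "inj_on f A" "\<And>x. x \<in> A \<Longrightarrow> f x \<in> U"
    "\<And>x y. x \<in> A \<Longrightarrow> y \<in> A \<Longrightarrow> adj x y \<Longrightarrow> h (f x) (f y) \<noteq> None"
    "\<And>x y x' y'. x \<in> A \<Longrightarrow> y \<in> A \<Longrightarrow> adj x y \<Longrightarrow> x' \<in> A \<Longrightarrow> y' \<in> A \<Longrightarrow> adj x' y' \<Longrightarrow>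
       h (f x) (f y) = h (f x') (f y') \<Longrightarrow> {x, y} = {x', y'}"
  shows "emb A adj U h f"
  unfolding emb_def using assms by (intro conjI ballI impI) (blast+)

lemma emb_inj: "emb A adj U h f \<Longrightarrow> inj_on f A"
  and emb_in: "emb A adj U h f \<Longrightarrow> x \<in> A \<Longrightarrow> f x \<in> U"
  and emb_edge: "emb A adj U h f \<Longrightarrow> x \<in> A \<Longrightarrow> y \<in> A \<Longrightarrow> adj x y \<Longrightarrow> h (f x) (f y) \<noteq> None"
  unfolding emb_def by blast+

lemma emb_rb: "emb A adj U h f \<Longrightarrow> x \<in> A \<Longrightarrow> y \<in> A \<Longrightarrow> adj x y \<Longrightarrow> x' \<in> A \<Longrightarrow> y' \<in> A \<Longrightarrow> adj x' y' \<Longrightarrow>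
    h (f x) (f y) = h (f x') (f y') \<Longrightarrow> {x, y} = {x', y'}"
  unfolding emb_def by blast

lemma emb_mono:
  assumes "emb A adj U h f" "B \<subseteq> A"
  shows "emb B adj U h f"
proof (rule embI)
  show "inj_on f B" using emb_inj[OF assms(1)] assms(2) by (rule inj_on_subset)
  show "f x \<in> U" if "x \<in> B" for x using emb_in[OF assms(1)] assms(2) that by blast
  show "h (f x) (f y) \<noteq> None" if "x \<in> B" "y \<in> B" "adj x y" for x y
    using emb_edge[OF assms(1)] assms(2) that by blast
  show "{x, y} = {x', y'}" if "x \<in> B" "y \<in> B" "adj x y" "x' \<in> B" "y' \<in> B" "adj x' y'"
    "h (f x) (f y) = h (f x') (f y')" for x y x' y'
    using emb_rb[OF assms(1) _ _ that(3) _ _ that(6,7)] assms(2) that by blast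
qed

lemma emb_cong: "(\<And>x. x \<in> A \<Longrightarrow> f x = g x) \<Longrightarrow> emb A adj U h f = emb A adj U h g"
  unfolding emb_def by (auto simp: inj_on_def)

section \<open>Components, the embedding order and weights\<close>

locale fgraph =
  fixes V :: "'a set" and adj :: "'a \<Rightarrow> 'a \<Rightarrow> bool"
  assumes fin: "finite V"
    and adj_sym: "adj x y \<Longrightarrow> adj y x"
    and adj_irrefl: "\<not> adj x x"
    and adj_V: "adj x y \<Longrightarrow> x \<in> V \<and> y \<in> V"
begin

definition "step A = {(x, y). x \<in> A \<and> y \<in> A \<and> adj x y}"
definition "comp_of A x = (step A)\<^sup>* `` {x}"
definition "comps A = comp_of A ` A"
definition "conn B \<longleftrightarrow> B \<noteq> {} \<and> B \<subseteq> V \<and> (\<forall>x\<in>B. \<forall>y\<in>B. (x, y) \<in> (step B)\<^sup>*)"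
definition "edges_in A = {{x, y} |x y. x \<in> A \<and> y \<in> A \<and> adj x y}"
definition "le B' B \<longleftrightarrow> (\<exists>g. inj_on g B' \<and> (\<forall>x\<in>B'. g x \<in> B) \<and> (\<forall>x\<in>B'. \<forall>y\<in>B'. adj x y \<longrightarrow> adj (g x) (g y)))"
text \<open>A strict measure for the preorder \<open>le\<close>: between finite sets of equal weight
  every embedding is an isomorphism, because vertices and edges are both exhausted.\<close>

definition "weight B = card B + card (edges_in B)"

lemma adj_comm: "adj x y = adj y x" using adj_sym by blast

lemma step_sym: "(x, y) \<in> (step A)\<^sup>* \<Longrightarrow> (y, x) \<in> (step A)\<^sup>*"
proof -
  have "sym (step A)" by (auto simp: sym_def step_def adj_sym)
  then show "(x, y) \<in> (step A)\<^sup>* \<Longrightarrow> (y, x) \<in> (step A)\<^sup>*" by (meson sym_rtrancl symD)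
qed

lemma step_mono: "A \<subseteq> B \<Longrightarrow> (step A)\<^sup>* \<subseteq> (step B)\<^sup>*"
  by (rule rtrancl_mono) (auto simp: step_def)

lemma comp_of_self: "x \<in> comp_of A x" by (simp add: comp_of_def)

lemma comp_of_sub: "x \<in> A \<Longrightarrow> comp_of A x \<subseteq> A"
proof
  fix y assume "x \<in> A" "y \<in> comp_of A x"
  then have "(x, y) \<in> (step A)\<^sup>*" by (simp add: comp_of_def)
  then show "y \<in> A" using \<open>x \<in> A\<close> by (induction) (auto simp: step_def)
qed

lemma comp_of_eq: "y \<in> comp_of A x \<Longrightarrow> comp_of A y = comp_of A x"
  unfolding comp_of_def using step_sym[of x y A] by (fastforce dest: rtrancl_trans)

lemma comps_sub: "C \<in> comps A \<Longrightarrow> C \<subseteq> A"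
  using comp_of_sub by (auto simp: comps_def)

lemma comps_ne: "C \<in> comps A \<Longrightarrow> C \<noteq> {}"
  using comp_of_self by (auto simp: comps_def)

lemma comps_eqI: "C \<in> comps A \<Longrightarrow> x \<in> C \<Longrightarrow> C = comp_of A x"
  using comp_of_eq by (auto simp: comps_def)

lemma comps_disj: "C \<in> comps A \<Longrightarrow> D \<in> comps A \<Longrightarrow> x \<in> C \<Longrightarrow> x \<in> D \<Longrightarrow> C = D"
  using comps_eqI by metis

lemma comp_of_in: "x \<in> A \<Longrightarrow> comp_of A x \<in> comps A" by (simp add: comps_def)

lemma comps_closed: "C \<in> comps A \<Longrightarrow> x \<in> C \<Longrightarrow> y \<in> A \<Longrightarrow> adj x y \<Longrightarrow> y \<in> C"
proof -
  assume a: "C \<in> comps A" "x \<in> C" "y \<in> A" "adj x y"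
  then have "(x, y) \<in> (step A)\<^sup>*" using comps_sub by (auto simp: step_def)
  then show "y \<in> C" using comps_eqI[OF a(1,2)] by (simp add: comp_of_def)
qed

lemma comps_conn: assumes "A \<subseteq> V" "C \<in> comps A" shows "conn C"
proof -
  obtain x where x: "x \<in> A" "C = comp_of A x" using assms by (auto simp: comps_def)
  have r: "(x, y) \<in> (step C)\<^sup>*" if "(x, y) \<in> (step A)\<^sup>*" for y
    using that
  proof (induction)
    case (step y z)
    have "y \<in> C" "z \<in> C" using step x by (auto simp: comp_of_def)
    then have "(y, z) \<in> step C" using step by (auto simp: step_def)
    then show ?case using step by auto
  qed auto
  show ?thesis unfolding conn_def
  proof (intro conjI ballI)
    show "C \<noteq> {}" using comps_ne assms by blast
    show "C \<subseteq> V" using comps_sub assms by blast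
    fix y z assume "y \<in> C" "z \<in> C"
    then have "(x, y) \<in> (step C)\<^sup>*" "(x, z) \<in> (step C)\<^sup>*" using r x by (auto simp: comp_of_def)
    then show "(y, z) \<in> (step C)\<^sup>*" using step_sym[of x y C] by (meson rtrancl_trans)
  qed
qed

text \<open>Applied mostly to the label of the copy or block in which an image lies: adjacent images
  share the label, so a connected set stays inside one copy.\<close>

lemma conn_const:
  assumes "conn B" "\<And>x y. x \<in> B \<Longrightarrow> y \<in> B \<Longrightarrow> adj x y \<Longrightarrow> \<phi> x = \<phi> y" "x \<in> B" "y \<in> B"
  shows "\<phi> x = \<phi> y"
proof -
  have "(x, y) \<in> (step B)\<^sup>*" using assms by (auto simp: conn_def)
  then show ?thesis by induction (use assms(2) in \<open>auto simp: step_def\<close>)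
qed

lemma conn_comp_ex:
  assumes "conn B" "B \<subseteq> A" obtains C where "C \<in> comps A" "B \<subseteq> C"
proof -
  obtain x where x: "x \<in> B" using assms by (auto simp: conn_def)
  have "B \<subseteq> comp_of A x"
  proof
    fix y assume "y \<in> B"
    then have "(x, y) \<in> (step B)\<^sup>*" using assms x by (auto simp: conn_def)
    then show "y \<in> comp_of A x" using step_mono[OF assms(2)] by (auto simp: comp_of_def)
  qed
  then show ?thesis using that comp_of_in x assms by blast
qed

lemma comps_closed_sub:
  assumes "A' \<subseteq> A" "\<And>x y. x \<in> A' \<Longrightarrow> y \<in> A \<Longrightarrow> adj x y \<Longrightarrow> y \<in> A'"
  shows "comps A' \<subseteq> comps A"
proof -
  have "comp_of A' x = comp_of A x" if x: "x \<in> A'" for x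
  proof
    show "comp_of A' x \<subseteq> comp_of A x" using step_mono[OF assms(1)] by (auto simp: comp_of_def)
    have "y \<in> A' \<and> (x, y) \<in> (step A')\<^sup>*" if "(x, y) \<in> (step A)\<^sup>*" for y
      using that
    proof induction
      case base then show ?case using x by simp
    next
      case (step y z)
      then have "z \<in> A'" using assms(2)[of y z] by (auto simp: step_def)
      then have "(y, z) \<in> step A'" using step by (auto simp: step_def)
      then show ?case using step \<open>z \<in> A'\<close> by auto
    qed
    then show "comp_of A x \<subseteq> comp_of A' x" by (auto simp: comp_of_def)
  qed
  then show ?thesis using assms(1) by (auto simp: comps_def)
qed

text \<open>Deleting \<open>z\<close> can break up only its own component. The fragments are lighter
  than \<open>B\<close>, so where \<open>B\<close> is minimal, deleting one vertex is as effective
  as deleting the whole component.\<close>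

lemma comps_remove:
  assumes "W \<subseteq> V" "B \<in> comps W" "z \<in> B" "D \<in> comps (W - {z})"
  shows "(D \<in> comps W \<and> D \<noteq> B) \<or> D \<subseteq> B - {z}"
proof -
  have cD: "conn D" using comps_conn[of "W - {z}" D] assms by blast
  have DW: "D \<subseteq> W - {z}" using comps_sub assms(4) by blast
  obtain C where C: "C \<in> comps W" "D \<subseteq> C" using conn_comp_ex[OF cD, of W] DW by blast
  show ?thesis
  proof (cases "C = B")
    case True then show ?thesis using C DW by blast
  next
    case False
    obtain x where x: "x \<in> D" using cD by (auto simp: conn_def)
    have "z \<notin> C" using False comps_disj[OF C(1) assms(2)] assms(3) by blast
    have "C \<subseteq> W - {z}" using comps_sub[OF C(1)] \<open>z \<notin> C\<close> by blast
    then obtain D' where D': "D' \<in> comps (W - {z})" "C \<subseteq> D'"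
      using conn_comp_ex[OF comps_conn[OF assms(1) C(1)]] by metis
    have "x \<in> D'" using x C(2) D'(2) by auto
    then have "D' = D" using comps_disj[OF D'(1) assms(4)] x by simp
    then have "C = D" using C(2) D'(2) by simp
    then show ?thesis using C(1) False by simp
  qed
qed

lemma finite_edges_in: "finite A \<Longrightarrow> finite (edges_in A)"
proof -
  assume "finite A"
  moreover have "edges_in A \<subseteq> Pow A" by (auto simp: edges_in_def)
  ultimately show ?thesis by (meson finite_Pow_iff finite_subset)
qed

lemma conn_fin: "conn B \<Longrightarrow> finite B" using fin by (auto simp: conn_def intro: finite_subset)

lemma le_refl: "le B B" unfolding le_def by (rule exI[of _ id]) auto

lemma le_sub: "B' \<subseteq> B \<Longrightarrow> le B' B" unfolding le_def by (rule exI[of _ id]) auto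

lemma le_trans: assumes "le A B" "le B C" shows "le A C"
proof -
  obtain f where f: "inj_on f A" "\<forall>x\<in>A. f x \<in> B" "\<forall>x\<in>A. \<forall>y\<in>A. adj x y \<longrightarrow> adj (f x) (f y)"
    using assms by (auto simp: le_def)
  obtain g where g: "inj_on g B" "\<forall>x\<in>B. g x \<in> C" "\<forall>x\<in>B. \<forall>y\<in>B. adj x y \<longrightarrow> adj (g x) (g y)"
    using assms by (auto simp: le_def)
  show ?thesis unfolding le_def
  proof (intro exI[of _ "g \<circ> f"] conjI ballI impI)
    show "inj_on (g \<circ> f) A" using f g by (auto simp: inj_on_def)
  qed (use f g in auto)
qed

lemma edges_in_image:
  assumes "inj_on g B'" "g ` B' \<subseteq> B" "\<And>x y. x \<in> B' \<Longrightarrow> y \<in> B' \<Longrightarrow> adj x y \<Longrightarrow> adj (g x) (g y)"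
  shows "inj_on ((`) g) (edges_in B')" "(`) g ` edges_in B' \<subseteq> edges_in B"
proof -
  show "inj_on ((`) g) (edges_in B')"
  proof (rule inj_onI)
    fix e e' assume "e \<in> edges_in B'" "e' \<in> edges_in B'" "g ` e = g ` e'"
    moreover have "e \<subseteq> B'" "e' \<subseteq> B'" using calculation by (auto simp: edges_in_def)
    ultimately show "e = e'" using assms(1) by (metis inj_on_image_eq_iff)
  qed
  show "(`) g ` edges_in B' \<subseteq> edges_in B"
  proof
    fix s assume "s \<in> (`) g ` edges_in B'"
    then obtain x y where "x \<in> B'" "y \<in> B'" "adj x y" "s = {g x, g y}" by (auto simp: edges_in_def)
    moreover have "g x \<in> B" "g y \<in> B" "adj (g x) (g y)" using calculation assms(2,3) by auto
    ultimately show "s \<in> edges_in B" unfolding edges_in_def by blast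
  qed
qed

lemma le_card: assumes "le B' B" "finite B" shows "card B' \<le> card B" "card (edges_in B') \<le> card (edges_in B)"
proof -
  obtain g where g: "inj_on g B'" "g ` B' \<subseteq> B" "\<forall>x\<in>B'. \<forall>y\<in>B'. adj x y \<longrightarrow> adj (g x) (g y)"
    using assms unfolding le_def by (metis image_subsetI)
  show "card B' \<le> card B" using g assms by (meson card_inj_on_le)
  show "card (edges_in B') \<le> card (edges_in B)"
    using edges_in_image[OF g(1,2)] g(3) finite_edges_in[OF assms(2)] by (meson card_inj_on_le)
qed

lemma le_weight: "le B' B \<Longrightarrow> finite B \<Longrightarrow> weight B' \<le> weight B"
  using le_card by (simp add: weight_def add_mono)

lemma weight_eq: "le B' B \<Longrightarrow> finite B \<Longrightarrow> weight B' = weight B \<Longrightarrow> card B' = card B \<and> card (edges_in B') = card (edges_in B)"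
  using le_card[of B' B] by (simp add: weight_def)

lemma emb_le:
  assumes "emb B adj U h f" "inj_on g B'" "g ` B' \<subseteq> B"
    "\<And>x y. x \<in> B' \<Longrightarrow> y \<in> B' \<Longrightarrow> adj x y \<Longrightarrow> adj (g x) (g y)"
  shows "emb B' adj U h (f \<circ> g)"
proof (rule embI)
  have gB: "g x \<in> B" if "x \<in> B'" for x using assms(3) that by auto
  show "inj_on (f \<circ> g) B'" using assms(2) emb_inj[OF assms(1)] gB by (auto simp: inj_on_def)
  show "(f \<circ> g) x \<in> U" if "x \<in> B'" for x using emb_in[OF assms(1)] gB that by auto
  show "h ((f \<circ> g) x) ((f \<circ> g) y) \<noteq> None" if "x \<in> B'" "y \<in> B'" "adj x y" for x y
    using emb_edge[OF assms(1) gB gB assms(4)] that by auto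
  show "{x, y} = {x', y'}" if xy: "x \<in> B'" "y \<in> B'" "adj x y" "x' \<in> B'" "y' \<in> B'" "adj x' y'"
    "h ((f \<circ> g) x) ((f \<circ> g) y) = h ((f \<circ> g) x') ((f \<circ> g) y')" for x y x' y'
  proof -
    have "{g x, g y} = {g x', g y'}"
      by (rule emb_rb[OF assms(1) gB gB assms(4) gB gB assms(4)]) (use xy in simp_all)
    then have "g ` {x, y} = g ` {x', y'}" by simp
    then show ?thesis using inj_on_image_eq_iff[OF assms(2), of "{x, y}" "{x', y'}"] xy by simp
  qed
qed

end

text \<open>The graph \<open>\<Gamma>\<close>. A piece \<open>B\<close> in \<open>D\<close> appears in two rainbow copies with private
  colors. A position \<open>(B, j)\<close> in \<open>P\<close> consists of copies of \<open>B\<close> sharing a palette with one color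
  more than \<open>B\<close> has edges, where copy \<open>i\<close> omits color \<open>i\<close>; hence it can hold only one copy of
  \<open>B\<close> at a time, but any given vertex or color can be avoided.\<close>

datatype 'a gamma_vertex = Free "'a set" bool 'a | Pos "'a set" nat nat 'a
datatype 'a gamma_color = FreeC "'a set" bool "'a set" | PosC "'a set" nat nat

definition skip :: "nat \<Rightarrow> nat \<Rightarrow> nat" where "skip i m = (if m < i then m else Suc m)"

lemma skip_neq: "skip i m \<noteq> i" by (simp add: skip_def)
lemma skip_inj: "skip i m = skip i m' \<Longrightarrow> m = m'" by (auto simp: skip_def split: if_splits)
lemma skip_le: "m < e \<Longrightarrow> skip i m \<le> e" by (auto simp: skip_def)
lemma skip_surj: "t \<le> e \<Longrightarrow> t \<noteq> i \<Longrightarrow> i \<le> e \<Longrightarrow> \<exists>m<e. skip i m = t"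
  by (rule exI[of _ "if t < i then t else t - 1"]) (auto simp: skip_def)

section \<open>Embeddings into the universal graph\<close>

context fgraph begin

definition eidx :: "'a set \<Rightarrow> 'a set \<Rightarrow> nat" where
  "eidx B = (SOME f. bij_betw f (edges_in B) {..<card (edges_in B)})"

lemma eidx: "finite B \<Longrightarrow> bij_betw (eidx B) (edges_in B) {..<card (edges_in B)}"
  unfolding eidx_def
  using ex_bij_betw_finite_nat[OF finite_edges_in, of B] by (metis (mono_tags) someI_ex atLeast0LessThan)

fun gamma_host :: "'a gamma_vertex \<Rightarrow> 'a gamma_vertex \<Rightarrow> 'a gamma_color option" where
  "gamma_host (Free B c x) (Free B' c' y) =
     (if B = B' \<and> c = c' \<and> x \<in> B \<and> y \<in> B \<and> adj x y then Some (FreeC B c {x, y}) else None)"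
| "gamma_host (Pos B j i x) (Pos B' j' i' y) =
     (if B = B' \<and> j = j' \<and> i = i' \<and> x \<in> B \<and> y \<in> B \<and> adj x y
      then Some (PosC B j (skip i (eidx B {x, y}))) else None)"
| "gamma_host _ _ = None"

lemma gamma_host_sym: "gamma_host x y = gamma_host y x"
proof (cases x; cases y)
  fix B c v B' c' v' assume "x = Free B c v" "y = Free B' c' v'"
  then show ?thesis using adj_comm[of v v'] by (auto simp: insert_commute)
next
  fix B j i v B' j' i' v' assume "x = Pos B j i v" "y = Pos B' j' i' v'"
  then show ?thesis using adj_comm[of v v'] by (auto simp: insert_commute)
qed auto

definition gamma_verts :: "'a set set \<Rightarrow> ('a set \<times> nat) set \<Rightarrow> 'a gamma_vertex set" where
  "gamma_verts D P = {Free B c x |B c x. B \<in> D \<and> x \<in> B} \<union>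
     {Pos B j i x |B j i x. (B, j) \<in> P \<and> i \<le> card (edges_in B) \<and> x \<in> B}"

lemma gamma_verts_iff [simp]:
  "Free B c x \<in> gamma_verts D P \<longleftrightarrow> B \<in> D \<and> x \<in> B"
  "Pos B j i x \<in> gamma_verts D P \<longleftrightarrow> (B, j) \<in> P \<and> i \<le> card (edges_in B) \<and> x \<in> B"
  by (auto simp: gamma_verts_def)

text \<open>The minimality clause makes a position all or nothing: a connected piece outside
  \<open>D\<close> that embeds into \<open>B\<close> has the weight of \<open>B\<close> and hence
  uses every edge of \<open>B\<close>. With at least two edges, two such pieces exceed the palette
  of the position.\<close>

definition gamma_system :: "'a set set \<Rightarrow> ('a set \<times> nat) set \<Rightarrow> bool" where
  "gamma_system D P \<longleftrightarrow> (\<forall>B\<in>D. conn B) \<and> (\<forall>B\<in>D. \<forall>B'. conn B' \<longrightarrow> le B' B \<longrightarrow> B' \<in> D) \<and> finite P \<and>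
     (\<forall>(B, j)\<in>P. conn B \<and> B \<notin> D \<and> 2 \<le> card (edges_in B) \<and>
        (\<forall>B'. conn B' \<longrightarrow> le B' B \<longrightarrow> weight B' < weight B \<longrightarrow> B' \<in> D))"

lemma gamma_systemD:
  assumes "gamma_system D P"
  shows "B \<in> D \<Longrightarrow> conn B" "B \<in> D \<Longrightarrow> conn B' \<Longrightarrow> le B' B \<Longrightarrow> B' \<in> D" "finite P"
    "(B, j) \<in> P \<Longrightarrow> conn B" "(B, j) \<in> P \<Longrightarrow> B \<notin> D" "(B, j) \<in> P \<Longrightarrow> 2 \<le> card (edges_in B)"
    "(B, j) \<in> P \<Longrightarrow> conn B' \<Longrightarrow> le B' B \<Longrightarrow> weight B' < weight B \<Longrightarrow> B' \<in> D"
  using assms unfolding gamma_system_def by blast+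

text \<open>The combinatorial form of embeddability into the universal graph;
  \<open>gamma_fits\<close> and \<open>fits_gamma\<close> prove the two directions.\<close>

definition fits :: "'a set set \<Rightarrow> ('a set \<times> nat) set \<Rightarrow> 'a set \<Rightarrow> bool" where
  "fits D P A \<longleftrightarrow> (\<exists>pos. inj_on pos (comps A - D) \<and>
     (\<forall>B\<in>comps A - D. pos B \<in> P \<and> le B (fst (pos B))))"

lemma finite_gamma_verts: assumes "gamma_system D P" shows "finite (gamma_verts D P)"
proof -
  have "D \<subseteq> Pow V" using assms by (auto simp: gamma_system_def conn_def)
  then have fD: "finite D" using fin by (meson finite_Pow_iff finite_subset)
  have "gamma_verts D P \<subseteq> (\<lambda>(B, c, x). Free B c x) ` (D \<times> UNIV \<times> V) \<union>
     (\<lambda>((B, j), i, x). Pos B j i x) ` (P \<times> {..Max ((\<lambda>(B, j). card (edges_in B)) ` P)} \<times> V)"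
  proof
    fix w assume w: "w \<in> gamma_verts D P"
    show "w \<in> (\<lambda>(B, c, x). Free B c x) ` (D \<times> UNIV \<times> V) \<union>
     (\<lambda>((B, j), i, x). Pos B j i x) ` (P \<times> {..Max ((\<lambda>(B, j). card (edges_in B)) ` P)} \<times> V)"
    proof (cases w)
      case (Free B c x)
      then have "B \<in> D" "x \<in> V" using w assms by (auto simp: gamma_verts_def gamma_system_def conn_def)
      then show ?thesis using Free by force
    next
      case (Pos B j i x)
      then have *: "(B, j) \<in> P" "i \<le> card (edges_in B)" "x \<in> B" using w by (auto simp: gamma_verts_def)
      have "card (edges_in B) \<le> Max ((\<lambda>(B, j). card (edges_in B)) ` P)"
        using gamma_systemD(3)[OF assms] *(1) by (intro Max_ge) (auto intro: rev_image_eqI)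
      moreover have "x \<in> V" using *(3) gamma_systemD(4)[OF assms *(1)] by (auto simp: conn_def)
      ultimately show ?thesis using * Pos by force
    qed
  qed
  moreover have "finite P" using assms by (simp add: gamma_system_def)
  ultimately show ?thesis by (elim finite_subset) (intro finite_UnI finite_imageI finite_SigmaI finite_atMost fD fin finite_UNIV \<open>finite P\<close>)
qed

text \<open>A connected piece stays within one copy. In a free copy it is below a member of
  \<open>D\<close>, hence in \<open>D\<close> itself; at a position minimality forces it to fill the
  copy, so two pieces at one position would repeat a color.\<close>

lemma gamma_fits:
  assumes g: "gamma_system D P" and A: "A \<subseteq> V" and f: "emb A adj (gamma_verts D P) gamma_host f"
  shows "fits D P A"
proof -
  define gid where "gid w = (case w of Free B c x \<Rightarrow> Inl (B, c) | Pos B j i x \<Rightarrow> Inr (B, j, i))" for w :: "'a gamma_vertex"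
  define prj where "prj w = (case w of Free B c x \<Rightarrow> x | Pos B j i x \<Rightarrow> x)" for w :: "'a gamma_vertex"
  have gid: "gid x = gid y" "adj (prj x) (prj y)" if "gamma_host x y \<noteq> None" for x y
    using that by (cases x; cases y; auto simp: gid_def prj_def split: if_splits)+
  have fG: "f x \<in> gamma_verts D P" if "x \<in> A" for x using f that by (auto simp: emb_def)
  have main: "\<exists>B j i. (B, j) \<in> P \<and> i \<le> card (edges_in B) \<and> (\<forall>x\<in>C. f x = Pos B j i (prj (f x)) \<and> prj (f x) \<in> B) \<and>
      inj_on (prj \<circ> f) C \<and> (\<forall>x\<in>C. \<forall>y\<in>C. adj x y \<longrightarrow> adj (prj (f x)) (prj (f y))) \<and>
      le C B \<and> weight C = weight B"
    if C: "C \<in> comps A - D" for C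
  proof -
    have cC: "conn C" "C \<subseteq> A" using C comps_conn[OF A] comps_sub by auto
    have adjf: "gamma_host (f x) (f y) \<noteq> None" if "x \<in> C" "y \<in> C" "adj x y" for x y
      using that cC f unfolding emb_def by blast
    have const: "gid (f x) = gid (f y)" if "x \<in> C" "y \<in> C" for x y
      by (rule conn_const[of C "\<lambda>z. gid (f z)", OF cC(1) gid(1)[OF adjf] that])
    obtain x0 where x0: "x0 \<in> C" using cC by (auto simp: conn_def)
    have inj: "inj_on (prj \<circ> f) C"
    proof (rule inj_onI)
      fix x y assume xy: "x \<in> C" "y \<in> C" "(prj \<circ> f) x = (prj \<circ> f) y"
      then have "f x = f y" using const[OF xy(1,2)] by (cases "f x"; cases "f y") (auto simp: gid_def prj_def)
      then show "x = y" using f xy cC unfolding emb_def by (meson inj_onD subsetD)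
    qed
    have adjp: "\<forall>x\<in>C. \<forall>y\<in>C. adj x y \<longrightarrow> adj (prj (f x)) (prj (f y))" using adjf gid(2) by blast
    show ?thesis
    proof (cases "f x0")
      case (Free B c x)
      have fy: "f y = Free B c (prj (f y))" if "y \<in> C" for y
        using const[OF that x0] Free by (cases "f y") (auto simp: gid_def prj_def)
      have *: "prj (f y) \<in> B \<and> B \<in> D" if "y \<in> C" for y
        using fG[of y] that cC fy[OF that] by (metis gamma_verts_iff(1) subsetD)
      have "le C B" unfolding le_def
        by (rule exI[of _ "prj \<circ> f"], intro conjI ballI impI inj) (use * adjp in simp_all)
      then have "C \<in> D" using gamma_systemD(2)[OF g _ cC(1)] *[OF x0] by blast
      then show ?thesis using C by simp
    next
      case (Pos B j i x)
      have fy: "f y = Pos B j i (prj (f y))" if "y \<in> C" for y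
        using const[OF that x0] Pos by (cases "f y") (auto simp: gid_def prj_def)
      have *: "prj (f y) \<in> B \<and> (B, j) \<in> P \<and> i \<le> card (edges_in B)" if "y \<in> C" for y
        using fG[of y] that cC fy[OF that] by (metis gamma_verts_iff(2) subsetD)
      have l: "le C B" unfolding le_def
        by (rule exI[of _ "prj \<circ> f"], intro conjI ballI impI inj) (use * adjp in simp_all)
      have B: "(B, j) \<in> P" "conn B" using *[OF x0] gamma_systemD(4)[OF g] by auto
      have "\<not> weight C < weight B" using gamma_systemD(7)[OF g B(1) cC(1) l] C by blast
      then have "weight C = weight B" using le_weight[OF l] conn_fin B by force
      then show ?thesis using * x0 fy inj adjp l by blast
    qed
  qed
  then obtain bb jj ii where bji: "\<And>C. C \<in> comps A - D \<Longrightarrow> (bb C, jj C) \<in> P \<and> ii C \<le> card (edges_in (bb C)) \<and>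
      (\<forall>x\<in>C. f x = Pos (bb C) (jj C) (ii C) (prj (f x)) \<and> prj (f x) \<in> bb C) \<and>
      inj_on (prj \<circ> f) C \<and> (\<forall>x\<in>C. \<forall>y\<in>C. adj x y \<longrightarrow> adj (prj (f x)) (prj (f y))) \<and>
      le C (bb C) \<and> weight C = weight (bb C)"
    by metis
  \<comment> \<open>Equal weights make the edge map onto, so every palette color except the omitted
    one occurs on \<open>C\<close>.\<close>
  have col: "\<exists>x\<in>C. \<exists>y\<in>C. adj x y \<and> gamma_host (f x) (f y) = Some (PosC (bb C) (jj C) t)"
    if C: "C \<in> comps A - D" and t: "t \<le> card (edges_in (bb C))" "t \<noteq> ii C" for C t
  proof -
    note b = bji[OF C]
    have B: "conn (bb C)" using b g by (auto simp: gamma_system_def)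
    have fB: "finite (bb C)" using conn_fin B by blast
    obtain m where m: "m < card (edges_in (bb C))" "skip (ii C) m = t" using skip_surj t b by metis
    obtain e where e: "e \<in> edges_in (bb C)" "eidx (bb C) e = m"
      using eidx[OF fB] m by (metis bij_betw_iff_bijections lessThan_iff)
    have sub: "(prj \<circ> f) ` C \<subseteq> bb C" using b by auto
    note ei = edges_in_image[of "prj \<circ> f" C "bb C", OF _ sub]
    have "card (edges_in C) = card (edges_in (bb C))" using weight_eq b fB by blast
    then have "(`) (prj \<circ> f) ` edges_in C = edges_in (bb C)"
      using ei b finite_edges_in[OF fB] by (intro card_subset_eq) (auto simp only: card_image o_def)
    then obtain e' where "e' \<in> edges_in C" "e = (prj \<circ> f) ` e'" using e by blast
    then obtain x y where xy: "x \<in> C" "y \<in> C" "adj x y" "e = {prj (f x), prj (f y)}" by (auto simp: edges_in_def)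
    have "gamma_host (Pos (bb C) (jj C) (ii C) (prj (f x))) (Pos (bb C) (jj C) (ii C) (prj (f y))) = Some (PosC (bb C) (jj C) t)"
    proof -
      have "prj (f x) \<in> bb C" "prj (f y) \<in> bb C" "adj (prj (f x)) (prj (f y))" using b xy by blast+
      moreover have "skip (ii C) (eidx (bb C) {prj (f x), prj (f y)}) = t" using e(2) m(2) xy(4) by simp
      ultimately show ?thesis by simp
    qed
    moreover have "f x = Pos (bb C) (jj C) (ii C) (prj (f x))" "f y = Pos (bb C) (jj C) (ii C) (prj (f y))"
      using b xy by blast+
    ultimately have "gamma_host (f x) (f y) = Some (PosC (bb C) (jj C) t)" by metis
    then show ?thesis using xy by blast
  qed
  have "inj_on (\<lambda>C. (bb C, jj C)) (comps A - D)"
  proof (rule inj_onI)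
    fix C C' assume C: "C \<in> comps A - D" and C': "C' \<in> comps A - D" and eq: "(bb C, jj C) = (bb C', jj C')"
    have two: "2 \<le> card (edges_in (bb C))" using bji[OF C] gamma_systemD(6)[OF g] by blast
    \<comment> \<open>Each of the two pieces omits one color; the palette contains at least 0, 1 and
      2, and one of these is omitted by neither.\<close>
    define t :: nat where "t = (if 0 \<notin> {ii C, ii C'} then 0 else if 1 \<notin> {ii C, ii C'} then 1 else 2)"
    have t: "t \<le> card (edges_in (bb C))" "t \<noteq> ii C" "t \<noteq> ii C'"
      using two by (auto simp: t_def)
    obtain x y where xy: "x \<in> C" "y \<in> C" "adj x y" "gamma_host (f x) (f y) = Some (PosC (bb C) (jj C) t)"
      using col[OF C t(1,2)] by blast
    obtain x' y' where xy': "x' \<in> C'" "y' \<in> C'" "adj x' y'" "gamma_host (f x') (f y') = Some (PosC (bb C) (jj C) t)"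
      using col[OF C', of t] t eq by auto
    have "C \<subseteq> A" "C' \<subseteq> A" using C C' comps_sub by auto
    then have "{x, y} = {x', y'}"
      by (intro emb_rb[OF f _ _ xy(3) _ _ xy'(3)]) (use xy xy' in auto)
    then have "x \<in> C'" using xy' by (auto simp: doubleton_eq_iff)
    then show "C = C'" using comps_disj[of C A C' x] C C' xy by simp
  qed
  then show ?thesis unfolding fits_def using bji by (intro exI[of _ "\<lambda>C. (bb C, jj C)"]) auto
qed

text \<open>Components in \<open>D\<close> go to their own free copies, which are disjoint because
  distinct components are distinct sets; the others follow the matching to positions. The side
  \<open>b\<close> and the omitted indices \<open>ii\<close> stay arbitrary, and this freedom is
  what the avoidance lemmas exploit.\<close>

lemma fits_gamma:
  assumes g: "gamma_system D P" and A: "A \<subseteq> V" and ft: "fits D P A"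
    and ii: "\<And>B j. (B, j) \<in> P \<Longrightarrow> ii B \<le> card (edges_in B)"
  obtains f where "emb A adj (gamma_verts D P) gamma_host f"
    "\<And>x. x \<in> A \<Longrightarrow> (\<exists>B v. f x = Free B b v) \<or> (\<exists>B j v. (B, j) \<in> P \<and> f x = Pos B j (ii B) v)"
proof -
  obtain pos where pos: "inj_on pos (comps A - D)" "\<And>B. B \<in> comps A - D \<Longrightarrow> pos B \<in> P \<and> le B (fst (pos B))"
    using ft by (auto simp: fits_def)
  have "\<forall>C\<in>comps A - D. \<exists>g. inj_on g C \<and> g ` C \<subseteq> fst (pos C) \<and> (\<forall>x\<in>C. \<forall>y\<in>C. adj x y \<longrightarrow> adj (g x) (g y))"
    using pos(2) unfolding le_def by (metis image_subsetI)
  then obtain gg where gg: "\<And>C. C \<in> comps A - D \<Longrightarrow> inj_on (gg C) C \<and> gg C ` C \<subseteq> fst (pos C) \<and>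
      (\<forall>x\<in>C. \<forall>y\<in>C. adj x y \<longrightarrow> adj (gg C x) (gg C y))" by metis
  define f where "f x = (let C = comp_of A x in if C \<in> D then Free C b x
      else Pos (fst (pos C)) (snd (pos C)) (ii (fst (pos C))) (gg C x))" for x
  have cx: "comp_of A x \<in> comps A" "x \<in> comp_of A x" if "x \<in> A" for x using that comp_of_in comp_of_self by auto
  have fD: "f x = Free (comp_of A x) b x" if "comp_of A x \<in> D" for x using that by (simp add: f_def)
  have fN: "f x = Pos (fst (pos (comp_of A x))) (snd (pos (comp_of A x))) (ii (fst (pos (comp_of A x)))) (gg (comp_of A x) x)"
    if "comp_of A x \<notin> D" for x using that by (simp add: f_def Let_def)
  have same: "comp_of A x = comp_of A y" if "x \<in> A" "y \<in> A" "adj x y" for x y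
    using comps_closed[OF cx(1)[OF that(1)] cx(2)[OF that(1)] that(2,3)] comp_of_eq by blast
  have injf: "inj_on f A"
  proof (rule inj_onI)
    fix x y assume xy: "x \<in> A" "y \<in> A" "f x = f y"
    show "x = y"
    proof (cases "comp_of A x \<in> D")
      case True
      then have "comp_of A y \<in> D" using xy(3) fN[of y] fD[of x] by (metis gamma_vertex.distinct(1))
      then show ?thesis using True xy fD by auto
    next
      case False
      then have y: "comp_of A y \<notin> D" using xy fD[of y] fN[of x] by auto
      have "pos (comp_of A x) = pos (comp_of A y)" using xy fN[OF False] fN[OF y] by (auto simp: prod_eq_iff)
      then have eq: "comp_of A x = comp_of A y" using pos(1) cx xy False y by (auto simp: inj_on_def)
      have "gg (comp_of A x) x = gg (comp_of A x) y" using xy fN[OF False] fN[OF y] eq by auto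
      then show ?thesis using gg[of "comp_of A x"] cx xy False eq by (metis DiffI inj_onD)
    qed
  qed
  have edge: "gamma_host (f x) (f y) = (if comp_of A x \<in> D then Some (FreeC (comp_of A x) b {x, y}) else
      Some (PosC (fst (pos (comp_of A x))) (snd (pos (comp_of A x))) (skip (ii (fst (pos (comp_of A x))))
        (eidx (fst (pos (comp_of A x))) {gg (comp_of A x) x, gg (comp_of A x) y}))))
      \<and> (comp_of A x \<notin> D \<longrightarrow> {gg (comp_of A x) x, gg (comp_of A x) y} \<in> edges_in (fst (pos (comp_of A x))))"
    if "x \<in> A" "y \<in> A" "adj x y" for x y
  proof (cases "comp_of A x \<in> D")
    case True
    then show ?thesis using fD same[OF that] cx that by auto
  next
    case False
    have 1: "comp_of A x \<in> comps A - D" using False cx that by blast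
    have 2: "gg (comp_of A x) x \<in> fst (pos (comp_of A x))" "gg (comp_of A x) y \<in> fst (pos (comp_of A x))"
      "adj (gg (comp_of A x) x) (gg (comp_of A x) y)"
      using gg[OF 1] cx(2)[OF that(1)] cx(2)[OF that(2)] that(3) unfolding same[OF that] by blast+
    then show ?thesis using fN False same[OF that] by (auto simp: edges_in_def)
  qed
  have "emb A adj (gamma_verts D P) gamma_host f"
    unfolding emb_def
  proof (intro conjI ballI impI)
    show "inj_on f A" by (rule injf)
    show "f ` A \<subseteq> gamma_verts D P"
    proof
      fix w assume "w \<in> f ` A"
      then obtain x where x: "x \<in> A" "w = f x" by blast
      show "w \<in> gamma_verts D P"
      proof (cases "comp_of A x \<in> D")
        case True then show ?thesis using fD x cx by (auto simp: gamma_verts_def)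
      next
        case False
        have 1: "comp_of A x \<in> comps A - D" using False cx x by blast
        have "pos (comp_of A x) \<in> P" "gg (comp_of A x) x \<in> fst (pos (comp_of A x))" using gg[OF 1] pos(2)[OF 1] cx x by auto
        moreover obtain B j where "pos (comp_of A x) = (B, j)" by fastforce
        ultimately show ?thesis using fN[OF False] x(2) ii by (auto simp: gamma_verts_def)
      qed
    qed
    fix x y assume xy: "x \<in> A" "y \<in> A" "adj x y"
    show "gamma_host (f x) (f y) \<noteq> None" using edge[OF xy] by (auto split: if_splits)
    fix x' y' assume xy': "x' \<in> A" "y' \<in> A" "adj x' y'" and eq: "gamma_host (f x) (f y) = gamma_host (f x') (f y')"
    show "{x, y} = {x', y'}"
    proof (cases "comp_of A x \<in> D")
      case True
      then show ?thesis using edge[OF xy] edge[OF xy'] eq by (auto split: if_splits)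
    next
      case False
      then have F': "comp_of A x' \<notin> D" using edge[OF xy] edge[OF xy'] eq by (auto split: if_splits)
      let ?p = "pos (comp_of A x)"
      have p: "?p = pos (comp_of A x')" using edge[OF xy] edge[OF xy'] eq False F' by (auto simp: prod_eq_iff)
      have same': "comp_of A x = comp_of A x'" using p pos(1) cx xy xy' False F' by (auto simp: inj_on_def)
      have "eidx (fst ?p) {gg (comp_of A x) x, gg (comp_of A x) y} = eidx (fst ?p) {gg (comp_of A x) x', gg (comp_of A x) y'}"
        by (rule skip_inj[of "ii (fst ?p)"]) (use edge[OF xy] edge[OF xy'] eq False F' same' in simp)
      moreover have "finite (fst ?p)"
        using pos(2)[of "comp_of A x"] cx xy False gamma_systemD(4)[OF g, of "fst ?p" "snd ?p"] conn_fin by simp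
      ultimately have "{gg (comp_of A x) x, gg (comp_of A x) y} = {gg (comp_of A x) x', gg (comp_of A x) y'}"
        using edge[OF xy] edge[OF xy'] False F' same' eidx by (metis bij_betw_imp_inj_on inj_onD)
      moreover have "inj_on (gg (comp_of A x)) (comp_of A x)" using gg[of "comp_of A x"] cx xy False by auto
      moreover have "x \<in> comp_of A x" "y \<in> comp_of A x" "x' \<in> comp_of A x" "y' \<in> comp_of A x"
        using cx xy xy' same[OF xy] same[OF xy'] same' by auto
      ultimately show ?thesis by (auto simp: doubleton_eq_iff inj_on_def)
    qed
  qed
  moreover have "(\<exists>B v. f x = Free B b v) \<or> (\<exists>B j v. (B, j) \<in> P \<and> f x = Pos B j (ii B) v)" if "x \<in> A" for x
    using fD fN pos(2)[of "comp_of A x"] cx[OF that] by (metis DiffI prod.collapse)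
  ultimately show thesis using that by blast
qed

text \<open>A vertex lies on one side of the free copies, or in a copy with one particular index, so
  the opposite side and the other of the indices 0 and 1 miss it.\<close>

lemma fits_avoid_vertex:
  assumes "gamma_system D P" "A \<subseteq> V" "fits D P A"
  shows "\<exists>f. emb A adj (gamma_verts D P) gamma_host f \<and> w \<notin> f ` A"
proof -
  define i where "i = (case w of Free _ _ _ \<Rightarrow> 0 | Pos _ _ i0 _ \<Rightarrow> if i0 = 0 then 1 else (0::nat))"
  define b where "b = (case w of Free _ c _ \<Rightarrow> \<not> c | Pos _ _ _ _ \<Rightarrow> True)"
  have i1: "i \<le> 1" by (simp add: i_def split: gamma_vertex.splits)
  have "i \<le> card (edges_in B)" if "(B, j) \<in> P" for B j
    using gamma_systemD(6)[OF assms(1) that] i1 by simp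
  then obtain f where f: "emb A adj (gamma_verts D P) gamma_host f"
    "\<And>x. x \<in> A \<Longrightarrow> (\<exists>B v. f x = Free B b v) \<or> (\<exists>B j v. (B, j) \<in> P \<and> f x = Pos B j i v)"
    using fits_gamma[OF assms, of "\<lambda>_. i" b] by metis
  have "f x \<noteq> w" if "x \<in> A" for x
    using f(2)[OF that] by (auto simp: i_def b_def split: gamma_vertex.splits if_splits)
  then show ?thesis using f(1) by blast
qed

text \<open>At a position the copy indexed by the forbidden color omits it; the free copies have
  private colors, so changing sides suffices.\<close>

lemma fits_avoid_color:
  assumes "gamma_system D P" "A \<subseteq> V" "fits D P A"
  shows "\<exists>f. emb A adj (gamma_verts D P) gamma_host f \<and> (\<forall>x\<in>A. \<forall>y\<in>A. adj x y \<longrightarrow> gamma_host (f x) (f y) \<noteq> Some c)"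
proof -
  \<comment> \<open>A color beyond the palette occurs on no edge of the position; the default 0
    merely keeps the index in range.\<close>
  define ii where "ii B = (case c of FreeC _ _ _ \<Rightarrow> 0 | PosC _ _ t \<Rightarrow> if t \<le> card (edges_in B) then t else (0::nat))" for B
  define b where "b = (case c of FreeC _ c _ \<Rightarrow> \<not> c | PosC _ _ _ \<Rightarrow> True)"
  have "ii B \<le> card (edges_in B)" for B by (simp add: ii_def split: gamma_color.splits)
  then obtain f where f: "emb A adj (gamma_verts D P) gamma_host f"
    "\<And>x. x \<in> A \<Longrightarrow> (\<exists>B v. f x = Free B b v) \<or> (\<exists>B j v. (B, j) \<in> P \<and> f x = Pos B j (ii B) v)"
    using fits_gamma[OF assms, of ii b] by metis
  have "gamma_host (f x) (f y) \<noteq> Some c" if xy: "x \<in> A" "y \<in> A" "adj x y" for x y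
  proof
    assume eq: "gamma_host (f x) (f y) = Some c"
    show False
    proof (cases c)
      case (FreeC B b' e)
      then obtain v v' where "f x = Free B b' v" "f y = Free B b' v'"
        using eq FreeC by (cases "f x"; cases "f y") (auto split: if_splits)
      then show False using f(2)[OF xy(1)] FreeC by (auto simp: b_def)
    next
      case (PosC B j t)
      then obtain i v v' where fx: "f x = Pos B j i v" "f y = Pos B j i v'" "v \<in> B" "v' \<in> B" "adj v v'"
        "t = skip i (eidx B {v, v'})"
        using eq PosC by (cases "f x"; cases "f y") (auto split: if_splits)
      have i: "i = ii B" "(B, j) \<in> P" using f(2)[OF xy(1)] fx by auto
      have "finite B" using gamma_systemD(4)[OF assms(1) i(2)] conn_fin by simp
      then have "eidx B {v, v'} < card (edges_in B)"
        using eidx[of B] fx by (auto simp: bij_betw_def edges_in_def)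
      then have "t \<le> card (edges_in B)" using fx skip_le by blast
      then have "i = t" using i PosC by (simp add: ii_def)
      then show False using fx skip_neq by metis
    qed
  qed
  then show ?thesis using f(1) by blast
qed

end


text \<open>For exchanging the host when both look alike on the image up to the renaming
  \<open>\<phi>\<close>; injectivity matters only on a set \<open>K\<close> that contains the colors
  occurring there.\<close>

lemma emb_transfer:
  assumes "emb A adj U h f" "inj_on f' A" "\<And>x. x \<in> A \<Longrightarrow> f' x \<in> U'"
    and eq: "\<And>x y. x \<in> A \<Longrightarrow> y \<in> A \<Longrightarrow> adj x y \<Longrightarrow> h' (f' x) (f' y) = map_option \<phi> (h (f x) (f y))"
    and \<phi>: "inj_on \<phi> K" "\<And>x y c. x \<in> A \<Longrightarrow> y \<in> A \<Longrightarrow> adj x y \<Longrightarrow> h (f x) (f y) = Some c \<Longrightarrow> c \<in> K"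
  shows "emb A adj U' h' f'"
proof (rule embI)
  show "h' (f' x) (f' y) \<noteq> None" if "x \<in> A" "y \<in> A" "adj x y" for x y
    using eq[OF that] emb_edge[OF assms(1) that] by simp
  show "{x, y} = {x', y'}" if xy: "x \<in> A" "y \<in> A" "adj x y" and xy': "x' \<in> A" "y' \<in> A" "adj x' y'"
    and e: "h' (f' x) (f' y) = h' (f' x') (f' y')" for x y x' y'
  proof -
    obtain c c' where c: "h (f x) (f y) = Some c" "h (f x') (f y') = Some c'"
      using emb_edge[OF assms(1) xy] emb_edge[OF assms(1) xy'] by auto
    then have "\<phi> c = \<phi> c'" using e eq[OF xy] eq[OF xy'] by simp
    then have "c = c'" using \<phi>(1) \<phi>(2)[OF xy c(1)] \<phi>(2)[OF xy' c(2)] by (simp add: inj_on_def)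
    then show ?thesis using emb_rb[OF assms(1) xy xy'] c by simp
  qed
qed (use assms in auto)

section \<open>Selection of pieces and positions\<close>

context fgraph begin

definition "minimal_outside U D B \<longleftrightarrow> B \<in> U \<and> B \<notin> D \<and> (\<forall>B'. conn B' \<longrightarrow> le B' B \<longrightarrow> weight B' < weight B \<longrightarrow> B' \<in> D)"

lemma finite_V_sub: "A \<subseteq> V \<Longrightarrow> finite A" using fin finite_subset by blast

lemma conn_sub: "conn B \<Longrightarrow> B \<subseteq> V" by (simp add: conn_def)

lemma comps_minus:
  assumes "A \<subseteq> V" "B \<in> comps A" shows "comps (A - B) = comps A - {B}"
proof
  show "comps (A - B) \<subseteq> comps A - {B}"
  proof
    fix C assume C: "C \<in> comps (A - B)"
    have "y \<in> A - B" if "x \<in> A - B" "y \<in> A" "adj x y" for x y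
      using comps_closed[OF assms(2), of y x] that adj_sym by auto
    then have "comps (A - B) \<subseteq> comps A" by (intro comps_closed_sub) auto
    moreover have "C \<noteq> B" using comps_sub[OF C] comps_ne[OF C] by auto
    ultimately show "C \<in> comps A - {B}" using C by auto
  qed
  show "comps A - {B} \<subseteq> comps (A - B)"
  proof
    fix C assume C: "C \<in> comps A - {B}"
    then have "C \<inter> B = {}" using comps_disj[of C A B] assms(2) by auto
    then have "C \<subseteq> A - B" using comps_sub[of C A] C by auto
    then obtain C' where C': "C' \<in> comps (A - B)" "C \<subseteq> C'"
      using conn_comp_ex[OF comps_conn[OF assms(1)]] C by (metis DiffD1)
    have "C' \<in> comps A"
    proof -
      have "y \<in> A - B" if "x \<in> A - B" "y \<in> A" "adj x y" for x y
        using comps_closed[OF assms(2), of y x] that adj_sym by auto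
      then have "comps (A - B) \<subseteq> comps A" by (intro comps_closed_sub) auto
      then show ?thesis using C' by auto
    qed
    moreover obtain x where "x \<in> C" using comps_ne[of C A] C by auto
    ultimately have "C' = C" using comps_disj[of C' A C x] C C'(2) by auto
    then show "C \<in> comps (A - B)" using C' by simp
  qed
qed

lemma conn_nbr:
  assumes "conn B" "x \<in> B" "y \<in> B" "x \<noteq> y" shows "\<exists>z\<in>B. adj x z"
proof -
  have "(x, y) \<in> (step B)\<^sup>*" using assms by (auto simp: conn_def)
  then show ?thesis using assms(4) by (cases rule: converse_rtranclE) (auto simp: step_def)
qed

lemma conn_two_edges:
  assumes "conn B" "3 \<le> card B" shows "2 \<le> card (edges_in B)"
proof -
  have fB: "finite B" using conn_fin assms by blast
  have "B \<subseteq> \<Union> (edges_in B)"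
  proof
    fix x assume x: "x \<in> B"
    have "\<not> B \<subseteq> {x}" using assms(2) card_mono[of "{x}" B] by auto
    then obtain y where "y \<in> B" "y \<noteq> x" by blast
    then obtain z where "z \<in> B" "adj x z" using conn_nbr[OF assms(1) x] by metis
    then show "x \<in> \<Union> (edges_in B)" using x by (auto simp: edges_in_def)
  qed
  moreover have "finite (\<Union> (edges_in B))"
    by (rule finite_subset[OF _ fB]) (auto simp: edges_in_def)
  ultimately have "card B \<le> card (\<Union> (edges_in B))" by (meson card_mono)
  also have "\<dots> \<le> (\<Sum>e\<in>edges_in B. card e)" by (rule card_Union_le_sum_card)
  also have "\<dots> \<le> (\<Sum>e\<in>edges_in B. 2)"
    by (rule sum_mono) (auto simp: edges_in_def card_insert_if)
  finally show ?thesis using assms(2) by simp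
qed

lemma card_comps:
  assumes "A \<subseteq> V" shows "finite (comps A) \<and> card (comps A) \<le> card V"
proof -
  have fA: "finite A" using finite_V_sub[OF assms] .
  have "card (comps A) \<le> card A" unfolding comps_def by (rule card_image_le[OF fA])
  also have "\<dots> \<le> card V" by (rule card_mono[OF fin assms])
  finally show ?thesis using fA by (simp add: comps_def)
qed

text \<open>First \<open>D\<close> and then \<open>P\<close> are chosen maximal such that no target in \<open>VV\<close> fits. If all
  positions of a minimal \<open>B\<close> outside \<open>D\<close> were in \<open>P\<close>, then \<open>B\<close> could be added to \<open>D\<close>.\<close>

lemma select_gamma_system:
  assumes U: "\<And>B. B \<in> U \<Longrightarrow> conn B" "\<And>B B'. B \<in> U \<Longrightarrow> conn B' \<Longrightarrow> le B' B \<Longrightarrow> B' \<in> U"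
    and D1: "D1 \<subseteq> U" "\<And>B B'. B \<in> D1 \<Longrightarrow> conn B' \<Longrightarrow> le B' B \<Longrightarrow> B' \<in> D1"
      "\<And>B. B \<in> U \<Longrightarrow> card B \<le> 2 \<Longrightarrow> B \<in> D1"
    and VV: "\<And>A. A \<in> VV \<Longrightarrow> A \<subseteq> V" "\<And>A. A \<in> VV \<Longrightarrow> \<not> comps A \<subseteq> D1"
  obtains D P where "gamma_system D P" "D1 \<subseteq> D" "D \<subseteq> U" "fst ` P \<subseteq> U" "\<And>A. A \<in> VV \<Longrightarrow> \<not> fits D P A"
    "\<And>B. minimal_outside U D B \<Longrightarrow> \<exists>A\<in>VV. \<exists>B'\<in>comps A. B' \<notin> D \<and> le B' B \<and> weight B' = weight B \<and> fits D P (A - B')"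
proof -
  define Q where "Q D \<longleftrightarrow> D1 \<subseteq> D \<and> D \<subseteq> U \<and> (\<forall>B\<in>D. \<forall>B'. conn B' \<longrightarrow> le B' B \<longrightarrow> B' \<in> D) \<and>
      (\<forall>A\<in>VV. \<not> comps A \<subseteq> D)" for D
  have UV: "U \<subseteq> Pow V" using U(1) conn_sub by auto
  then have finU: "finite U" using fin by (meson finite_Pow_iff finite_subset)
  have "Q D1" using D1 VV by (auto simp: Q_def)
  moreover have "card D < Suc (card U)" if "Q D" for D
    using that finU by (simp add: Q_def card_mono less_Suc_eq_le)
  ultimately obtain D where D: "Q D" and Dmax: "\<And>D'. Q D' \<Longrightarrow> card D' \<le> card D"
    using ex_has_greatest_nat[of Q D1 card "Suc (card U)"] by blast
  have DU: "D \<subseteq> U" "D1 \<subseteq> D" and Dcl: "\<And>B B'. B \<in> D \<Longrightarrow> conn B' \<Longrightarrow> le B' B \<Longrightarrow> B' \<in> D"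
    and Dg: "\<And>A. A \<in> VV \<Longrightarrow> \<not> comps A \<subseteq> D"
    using D by (auto simp: Q_def)
  have finD: "finite D" using DU finU finite_subset by blast
  define M where "M = {B. minimal_outside U D B}"
  have finM: "finite M" using finU by (auto simp: M_def minimal_outside_def intro: finite_subset)
  \<comment> \<open>A target has at most \<open>card V\<close> components, so \<open>k\<close>
    positions of one \<open>B\<close> amount to an unlimited supply.\<close>
  define k where "k = card V"
  define R where "R P \<longleftrightarrow> P \<subseteq> M \<times> {..<k} \<and> (\<forall>A\<in>VV. \<not> fits D P A)" for P
  have "R {}" using Dg by (auto simp: R_def fits_def)
  moreover have "card P < Suc (card (M \<times> {..<k}))" if "R P" for P
  proof -
    have "finite (M \<times> {..<k})" using finM by blast
    then show ?thesis using that by (simp add: R_def card_mono less_Suc_eq_le del: card_cartesian_product)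
  qed
  ultimately obtain P where P: "R P" and Pmax: "\<And>P'. R P' \<Longrightarrow> card P' \<le> card P"
    using ex_has_greatest_nat[of R "{}" card "Suc (card (M \<times> {..<k}))"] by blast
  have finP: "finite P"
    by (rule finite_subset[of _ "M \<times> {..<k}"]) (use P finM in \<open>auto simp: R_def\<close>)
  have MD: "conn B" "B \<notin> D" "2 \<le> card (edges_in B)"
    "\<And>B'. conn B' \<Longrightarrow> le B' B \<Longrightarrow> weight B' < weight B \<Longrightarrow> B' \<in> D" if "B \<in> M" for B
  proof -
    have B: "B \<in> U" "B \<notin> D" using that by (auto simp: M_def minimal_outside_def)
    show "conn B" "B \<notin> D" using B U(1) by auto
    have "\<not> card B \<le> 2" using D1(3) B DU by auto
    then show "2 \<le> card (edges_in B)" using conn_two_edges[OF \<open>conn B\<close>] by simp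
    show "\<And>B'. conn B' \<Longrightarrow> le B' B \<Longrightarrow> weight B' < weight B \<Longrightarrow> B' \<in> D"
      using that by (auto simp: M_def minimal_outside_def)
  qed
  have gs: "gamma_system D P"
    unfolding gamma_system_def
  proof (intro conjI ballI allI impI)
    fix x assume x: "x \<in> P"
    obtain B j where xB: "x = (B, j)" by fastforce
    then have "B \<in> M" using P x by (auto simp: R_def)
    then show "case x of (B, j) \<Rightarrow> conn B \<and> B \<notin> D \<and> 2 \<le> card (edges_in B) \<and>
        (\<forall>B'. conn B' \<longrightarrow> le B' B \<longrightarrow> weight B' < weight B \<longrightarrow> B' \<in> D)"
      using MD xB by auto
  qed (use finP DU U Dcl in auto)
  show thesis
  proof
    show "gamma_system D P" "D1 \<subseteq> D" "D \<subseteq> U" using gs DU by auto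
    show "fst ` P \<subseteq> U" using P by (auto simp: R_def M_def minimal_outside_def)
    show "\<And>A. A \<in> VV \<Longrightarrow> \<not> fits D P A" using P by (auto simp: R_def)
    fix B assume mB: "minimal_outside U D B"
    then have BM: "B \<in> M" by (simp add: M_def)
    have "\<exists>i<k. (B, i) \<notin> P"
    proof (rule ccontr)
      assume "\<not> (\<exists>i<k. (B, i) \<notin> P)"
      then have all: "\<And>i. i < k \<Longrightarrow> (B, i) \<in> P" by blast
      \<comment> \<open>If a target had all its components in \<open>D'\<close>, those outside
        \<open>D\<close> would be below \<open>B\<close> and could be distributed over the
        \<open>k\<close> positions of \<open>B\<close>, so the target would fit already.\<close>
      define D' where "D' = D \<union> {B'. conn B' \<and> le B' B}"
      have "Q D'"
        unfolding Q_def
      proof (intro conjI ballI allI impI)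
        show "D1 \<subseteq> D'" using DU by (auto simp: D'_def)
        show "D' \<subseteq> U" using DU U(2) mB by (auto simp: D'_def minimal_outside_def)
        show "B2 \<in> D'" if "B1 \<in> D'" "conn B2" "le B2 B1" for B1 B2
          using that Dcl le_trans by (auto simp: D'_def)
        fix A assume A: "A \<in> VV"
        show "\<not> comps A \<subseteq> D'"
        proof
          assume sub: "comps A \<subseteq> D'"
          have fc: "finite (comps A)" "card (comps A) \<le> k" using card_comps VV(1)[OF A] by (auto simp: k_def)
          obtain g where g: "bij_betw g (comps A) {0..<card (comps A)}"
            using ex_bij_betw_finite_nat[OF fc(1)] by blast
          have "fits D P A"
            unfolding fits_def
          proof (intro exI[of _ "\<lambda>C. (B, g C)"] conjI ballI)
            show "inj_on (\<lambda>C. (B, g C)) (comps A - D)" using g by (auto simp: bij_betw_def inj_on_def)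
            fix C assume C: "C \<in> comps A - D"
            then have "g C \<in> {0..<card (comps A)}" using bij_betwE[OF g] by blast
            then have "g C < k" using fc(2) by simp
            then show "(B, g C) \<in> P" using all by simp
            show "le C (fst (B, g C))" using sub C by (auto simp: D'_def)
          qed
          then show False using P A by (auto simp: R_def)
        qed
      qed
      moreover have "card D < card D'"
      proof (rule psubset_card_mono)
        show "finite D'" using \<open>Q D'\<close> finU by (auto simp: Q_def intro: finite_subset)
        show "D \<subset> D'" using MD[OF BM] le_refl by (auto simp: D'_def)
      qed
      ultimately show False using Dmax by force
    qed
    then obtain i where i: "i < k" "(B, i) \<notin> P" by blast
    \<comment> \<open>By maximality the additional position makes some target fit. The component
      placed there is outside \<open>D\<close> and below \<open>B\<close>, hence has the weight of
      \<open>B\<close> by minimality, and the remaining components use the old positions.\<close>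
    have "\<not> R (insert (B, i) P)" using Pmax[of "insert (B, i) P"] finP i by auto
    then obtain A where A: "A \<in> VV" "fits D (insert (B, i) P) A"
      using P BM i by (auto simp: R_def)
    obtain pos where pos: "inj_on pos (comps A - D)"
      "\<And>C. C \<in> comps A - D \<Longrightarrow> pos C \<in> insert (B, i) P \<and> le C (fst (pos C))"
      using A(2) by (auto simp: fits_def)
    have "\<exists>C\<in>comps A - D. pos C = (B, i)"
    proof (rule ccontr)
      assume "\<not> ?thesis"
      then have "fits D P A" unfolding fits_def using pos by (intro exI[of _ pos]) auto
      then show False using P A by (auto simp: R_def)
    qed
    then obtain C where C: "C \<in> comps A - D" "pos C = (B, i)" by blast
    have cC: "conn C" using comps_conn VV(1)[OF A(1)] C by blast
    have lC: "le C B" using pos(2)[OF C(1)] C(2) by simp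
    have fB: "finite B" using conn_fin MD(1)[OF BM] by blast
    have "weight C = weight B"
      using MD(4)[OF BM cC lC] C(1) le_weight[OF lC fB] by force
    moreover have "fits D P (A - C)"
      unfolding fits_def comps_minus[OF VV(1)[OF A(1)] DiffD1[OF C(1)]]
    proof (intro exI[of _ pos] conjI ballI)
      show "inj_on pos (comps A - {C} - D)" using pos(1) by (rule inj_on_subset) auto
      fix C' assume C': "C' \<in> comps A - {C} - D"
      then have "pos C' \<noteq> pos C" using pos(1) C(1) by (auto simp: inj_on_def)
      then show "pos C' \<in> P" using pos(2)[of C'] C' C(2) by auto
      show "le C' (fst (pos C'))" using pos(2)[of C'] C' by auto
    qed
    ultimately show "\<exists>A\<in>VV. \<exists>B'\<in>comps A. B' \<notin> D \<and> le B' B \<and> weight B' = weight B \<and> fits D P (A - B')"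
      using A(1) C lC by blast
  qed
qed

end

section \<open>Extremal digraphs\<close>

text \<open>The edge of an arc is colored by its tail.\<close>

definition arc_host :: "(nat \<times> nat) set \<Rightarrow> nat \<Rightarrow> nat \<Rightarrow> nat option" where
  "arc_host L i j = (if (i, j) \<in> L then Some i else if (j, i) \<in> L then Some j else None)"

text \<open>A path of at most \<open>K + 1\<close> steps is empty or ends with one of at most
  \<open>d\<close> last steps, and \<open>1 + d * (d + 1) ^ K\<close> is at most
  \<open>(d + 1) ^ (K + 1)\<close>.\<close>

lemma relpow_ball:
  fixes S :: "('v \<times> 'v) set"
  assumes deg: "\<And>w. finite {y. (y, w) \<in> S} \<and> card {y. (y, w) \<in> S} \<le> d"
  shows "finite {u. \<exists>n\<le>K. (u, w) \<in> S ^^ n} \<and> card {u. \<exists>n\<le>K. (u, w) \<in> S ^^ n} \<le> (d + 1) ^ K"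
proof (induction K arbitrary: w)
  case 0
  have "{u. \<exists>n\<le>(0::nat). (u, w) \<in> S ^^ n} = {w}" by auto
  then show ?case by simp
next
  case (Suc K)
  let ?B = "\<lambda>K w. {u. \<exists>n\<le>K. (u, w) \<in> S ^^ n}"
  have sub: "?B (Suc K) w \<subseteq> {w} \<union> (\<Union>y\<in>{y. (y, w) \<in> S}. ?B K y)"
  proof
    fix u assume "u \<in> ?B (Suc K) w"
    then obtain n where n: "n \<le> Suc K" "(u, w) \<in> S ^^ n" by blast
    show "u \<in> {w} \<union> (\<Union>y\<in>{y. (y, w) \<in> S}. ?B K y)"
    proof (cases n)
      case 0 then show ?thesis using n by simp
    next
      case (Suc m)
      then obtain y where "(u, y) \<in> S ^^ m" "(y, w) \<in> S" using n by auto
      then show ?thesis using Suc n by auto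
    qed
  qed
  have fi: "finite ({w} \<union> (\<Union>y\<in>{y. (y, w) \<in> S}. ?B K y))" using deg Suc by auto
  have "card (?B (Suc K) w) \<le> card ({w} \<union> (\<Union>y\<in>{y. (y, w) \<in> S}. ?B K y))"
    using sub fi by (rule card_mono[rotated])
  also have "\<dots> \<le> 1 + card (\<Union>y\<in>{y. (y, w) \<in> S}. ?B K y)"
    by (rule order_trans[OF card_Un_le]) simp
  also have "card (\<Union>y\<in>{y. (y, w) \<in> S}. ?B K y) \<le> (\<Sum>y\<in>{y. (y, w) \<in> S}. card (?B K y))"
    using deg by (intro card_UN_le) auto
  also have "\<dots> \<le> (\<Sum>y\<in>{y. (y, w) \<in> S}. (d + 1) ^ K)" using Suc by (intro sum_mono) auto
  also have "\<dots> \<le> d * (d + 1) ^ K" using deg by simp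
  finally have "card (?B (Suc K) w) \<le> 1 + d * (d + 1) ^ K" by simp
  also have "\<dots> \<le> (d + 1) ^ Suc K" by simp
  finally show ?case using sub fi finite_subset by blast
qed

section \<open>Digraphs whose rainbow pieces all lie in \<open>D\<close>\<close>

context fgraph begin

text \<open>Excluding opposite arcs makes the tail of an edge well defined and thereby the colored
  host symmetric.\<close>

definition "arcs_ok D N L \<longleftrightarrow> L \<subseteq> {..<N} \<times> {..<N} \<and> (\<forall>i j. (i, j) \<in> L \<longrightarrow> (j, i) \<notin> L) \<and>
   (\<forall>B f. conn B \<longrightarrow> emb B adj UNIV (arc_host L) f \<longrightarrow> B \<in> D)"

text \<open>For a digraph on \<open>{..<N}\<close>, the number \<open>N\<close> is a new vertex
  whose color occurs on no old arc. It is a placeholder for every vertex far from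
  \<open>u\<close>.\<close>

definition "arc_saturated D N L u \<longleftrightarrow> (\<exists>B f. conn B \<and> B \<notin> D \<and> emb B adj UNIV (arc_host (insert (N, u) L)) f)"

lemma arc_host_lt: "L \<subseteq> {..<N} \<times> {..<N} \<Longrightarrow> arc_host L i j = Some c \<Longrightarrow> i < N \<and> j < N \<and> (c = i \<or> c = j)"
  by (auto simp: arc_host_def split: if_splits)

text \<open>The arcs entering \<open>u\<close> have distinct tails and so form a rainbow star; more
  than \<open>card V\<close> of them would contain the star \<open>S\<close>, which is not in
  \<open>D\<close>.\<close>

lemma indeg_bound:
  assumes ok: "arcs_ok D N L" and S: "conn S" "z \<in> S" "S \<notin> D" "\<And>x y. x \<in> S \<Longrightarrow> y \<in> S \<Longrightarrow> adj x y \<Longrightarrow> x = z \<or> y = z"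
  shows "card {v. (v, u) \<in> L} \<le> card V"
proof (rule ccontr)
  assume c: "\<not> card {v. (v, u) \<in> L} \<le> card V"
  have L: "L \<subseteq> {..<N} \<times> {..<N}" "\<And>i j. (i, j) \<in> L \<Longrightarrow> (j, i) \<notin> L" using ok by (auto simp: arcs_ok_def)
  have fS: "finite S" "card S \<le> card V" using S(1) conn_fin conn_sub fin by (auto intro: card_mono)
  have finI: "finite {v. (v, u) \<in> L}"
    by (rule finite_subset[of _ "{..<N}"]) (use L in auto)
  have "card (S - {z}) \<le> card S" by (rule card_Diff1_le)
  then have "card (S - {z}) \<le> card {v. (v, u) \<in> L}" using fS(2) c by linarith
  moreover have "finite (S - {z})" using fS by simp
  ultimately obtain g where g: "inj_on g (S - {z})" "g ` (S - {z}) \<subseteq> {v. (v, u) \<in> L}"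
    using inj_on_iff_card_le[OF _ finI] by blast
  define f where "f x = (if x = z then u else g x)" for x
  have gu: "(g x, u) \<in> L" "g x \<noteq> u" if "x \<in> S" "x \<noteq> z" for x using g(2) that L(2) by auto
  have col: "arc_host L (f x) (f y) = Some (g (if x = z then y else x)) \<and> (if x = z then y else x) \<in> S - {z} \<and> z \<in> {x, y}"
    if "x \<in> S" "y \<in> S" "adj x y" for x y
  proof (cases "x = z")
    case True
    then have "y \<noteq> z" using that adj_irrefl by auto
    then show ?thesis using True that gu[of y] L(2) by (auto simp: f_def arc_host_def)
  next
    case False
    then have "y = z" using S(4) that by blast
    then show ?thesis using False that gu[of x] by (auto simp: f_def arc_host_def)
  qed
  have "emb S adj UNIV (arc_host L) f"
  proof (rule embI)
    show "inj_on f S" using g(1) gu(2) by (auto simp: inj_on_def f_def)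
    show "arc_host L (f x) (f y) \<noteq> None" if "x \<in> S" "y \<in> S" "adj x y" for x y using col[OF that] by simp
    show "{x, y} = {x', y'}" if xy: "x \<in> S" "y \<in> S" "adj x y" and xy': "x' \<in> S" "y' \<in> S" "adj x' y'"
      and e: "arc_host L (f x) (f y) = arc_host L (f x') (f y')" for x y x' y'
    proof -
      have "(if x = z then y else x) = (if x' = z then y' else x')"
        using col[OF xy] col[OF xy'] e g(1) by (simp add: inj_on_def)
      then show ?thesis using col[OF xy] col[OF xy'] by (auto split: if_splits)
    qed
  qed auto
  then show False using ok S(1,3) by (auto simp: arcs_ok_def)
qed

lemma conn_no_edge_single:
  assumes "conn B" "\<And>x y. x \<in> B \<Longrightarrow> y \<in> B \<Longrightarrow> \<not> adj x y" shows "\<exists>x\<in>V. B = {x}"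
proof -
  obtain x where x: "x \<in> B" using assms by (auto simp: conn_def)
  have "B = {x}" using conn_nbr[OF assms(1) x] assms(2) x by blast
  then show ?thesis using x conn_sub[OF assms(1)] by blast
qed

text \<open>Given too many unsaturated vertices, some \<open>v\<close> of small outdegree could trade its incoming
  arcs for more outgoing arcs to unsaturated vertices.\<close>

lemma extremal_arcs:
  assumes D: "\<And>x. x \<in> V \<Longrightarrow> {x} \<in> D"
    and S: "conn S" "z \<in> S" "S \<notin> D" "\<And>x y. x \<in> S \<Longrightarrow> y \<in> S \<Longrightarrow> adj x y \<Longrightarrow> x = z \<or> y = z"
  obtains L where "arcs_ok D N L" "\<And>u. card {v. (v, u) \<in> L} \<le> card V"
    "\<And>v. card {u. (v, u) \<in> L} \<le> 3 * card V + 1"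
    "card {u. u < N \<and> \<not> arc_saturated D N L u} \<le> 2 * card V + 1"
proof -
  define k where "k = card V"
  \<comment> \<open>The bound \<open>3 * k + 1\<close> leaves room for the exchange below, in which
    a vertex of outdegree at most \<open>k\<close> receives \<open>k + 1\<close> further outgoing
    arcs.\<close>
  define Q where "Q L \<longleftrightarrow> arcs_ok D N L \<and> (\<forall>v. card {u. (v, u) \<in> L} \<le> 3 * k + 1)" for L
  have "arcs_ok D N {}"
    unfolding arcs_ok_def
  proof (intro conjI allI impI)
    fix B f assume B: "conn B" "emb B adj UNIV (arc_host {}) f"
    have "\<not> adj x y" if "x \<in> B" "y \<in> B" for x y using emb_edge[OF B(2) that] by (auto simp: arc_host_def)
    then show "B \<in> D" using conn_no_edge_single[OF B(1)] D by blast
  qed auto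
  then have "Q {}" by (simp add: Q_def)
  moreover have "card L < Suc (card ({..<N} \<times> {..<N}))" if "Q L" for L
  proof -
    have "L \<subseteq> {..<N} \<times> {..<N}" using that by (simp add: Q_def arcs_ok_def)
    then show ?thesis using card_mono[of "{..<N} \<times> {..<N}" L] by (simp only: less_Suc_eq_le finite_SigmaI finite_lessThan)
  qed
  ultimately obtain L where L: "Q L" and max: "\<And>L'. Q L' \<Longrightarrow> card L' \<le> card L"
    using ex_has_greatest_nat[of Q "{}" card "Suc (card ({..<N} \<times> {..<N}))"] by blast
  have ok: "arcs_ok D N L" and od: "\<And>v. card {u. (v, u) \<in> L} \<le> 3 * k + 1" using L by (auto simp: Q_def)
  have Ls: "L \<subseteq> {..<N} \<times> {..<N}" "\<And>i j. (i, j) \<in> L \<Longrightarrow> (j, i) \<notin> L"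
    and LD: "\<And>B f. conn B \<Longrightarrow> emb B adj UNIV (arc_host L) f \<Longrightarrow> B \<in> D" using ok unfolding arcs_ok_def by blast+
  have finL: "finite L" using Ls(1) finite_subset by blast
  have id: "card {v. (v, u) \<in> L} \<le> k" for u using indeg_bound[OF ok S] by (simp add: k_def)
  have fin_in: "finite {v. (v, u) \<in> L}" and fin_out: "finite {w. (u, w) \<in> L}" for u
    by (rule finite_subset[of _ "{..<N}"]; use Ls in auto)+
  define T where "T = {u. u < N \<and> \<not> arc_saturated D N L u}"
  have "card T \<le> 2 * k + 1"
  proof (rule ccontr)
    assume "\<not> card T \<le> 2 * k + 1"
    then have cT: "2 * k + 2 \<le> card T" by simp
    have finT: "finite T" by (simp add: T_def)
    have "T \<noteq> {}" using cT by auto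
    then have N0: "0 < N" by (auto simp: T_def)
    have cLin: "card L = (\<Sum>u<N. card {v. (v, u) \<in> L})"
    proof -
      have "L = (\<Union>u\<in>{..<N}. {v. (v, u) \<in> L} \<times> {u})" using Ls by auto
      then have "card L = card (\<Union>u\<in>{..<N}. {v. (v, u) \<in> L} \<times> {u})" by simp
      also have "\<dots> = (\<Sum>u<N. card ({v. (v, u) \<in> L} \<times> {u}))"
        using fin_in by (intro card_UN_disjoint) auto
      finally show ?thesis by (simp add: card_cartesian_product)
    qed
    have cLout: "card L = (\<Sum>v<N. card {u. (v, u) \<in> L})"
    proof -
      have "L = (\<Union>v\<in>{..<N}. {v} \<times> {u. (v, u) \<in> L})" using Ls by auto
      then have "card L = card (\<Union>v\<in>{..<N}. {v} \<times> {u. (v, u) \<in> L})" by simp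
      also have "\<dots> = (\<Sum>v<N. card ({v} \<times> {u. (v, u) \<in> L}))"
        using fin_out by (intro card_UN_disjoint) auto
      finally show ?thesis by (simp add: card_cartesian_product)
    qed
    \<comment> \<open>Outdegrees and indegrees have the same sum, and indegrees are at most
      \<open>k\<close>.\<close>
    have "\<exists>v<N. card {u. (v, u) \<in> L} \<le> k"
    proof (rule ccontr)
      assume "\<not> ?thesis"
      then have "(\<Sum>v<N. k + 1) \<le> (\<Sum>v<N. card {u. (v, u) \<in> L})" by (intro sum_mono) force
      also have "\<dots> \<le> (\<Sum>u<N. k)" using cLin cLout id by (metis (no_types, lifting) sum_mono)
      finally show False using N0 by simp
    qed
    then obtain v where v: "v < N" "card {u. (v, u) \<in> L} \<le> k" by blast
    have "card (T - ({v} \<union> {u. (v, u) \<in> L})) \<ge> card T - card ({v} \<union> {u. (v, u) \<in> L})"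
      using fin_out by (intro diff_card_le_card_Diff) auto
    moreover have "card ({v} \<union> {u. (v, u) \<in> L}) \<le> 1 + k"
      using card_Un_le[of "{v}" "{u. (v, u) \<in> L}"] v(2) by simp
    \<comment> \<open>Of at least \<open>2 * k + 2\<close> unsaturated vertices at most
      \<open>1 + k\<close> are lost. The \<open>k + 1\<close> arcs gained outnumber the at most
      \<open>k\<close> arcs removed.\<close>
    ultimately have "k + 1 \<le> card (T - ({v} \<union> {u. (v, u) \<in> L}))" using cT by linarith
    then obtain T' where T': "T' \<subseteq> T - ({v} \<union> {u. (v, u) \<in> L})" "card T' = k + 1" "finite T'"
      using obtain_subset_with_card_n by metis
    define L0 where "L0 = L - {w. (w, v) \<in> L} \<times> {v}"
    define L' where "L' = L0 \<union> {v} \<times> T'"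
    have L0: "(i, j) \<in> L0 \<longleftrightarrow> (i, j) \<in> L \<and> j \<noteq> v" for i j by (auto simp: L0_def)
    have L': "(i, j) \<in> L' \<longleftrightarrow> ((i, j) \<in> L \<and> j \<noteq> v) \<or> (i = v \<and> j \<in> T')" for i j
      by (auto simp: L'_def L0)
    have T'N: "j < N \<and> j \<noteq> v \<and> (v, j) \<notin> L \<and> \<not> arc_saturated D N L j" if "j \<in> T'" for j
      using T'(1) that by (auto simp: T_def)
    have "card L' = card L0 + card ({v} \<times> T')"
    proof (unfold L'_def, rule card_Un_disjoint)
      show "finite L0" using finL by (simp add: L0_def)
    qed (use T'(3) T'N in \<open>auto simp: L0\<close>)
    also have "card L0 = card L - card ({w. (w, v) \<in> L} \<times> {v})"
      unfolding L0_def using fin_in by (intro card_Diff_subset) auto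
    finally have "card L' = card L - card {w. (w, v) \<in> L} + (k + 1)"
      using T'(2) by (simp add: card_cartesian_product)
    then have bigger: "card L < card L'" using id[of v] by linarith
    have "Q L'"
      unfolding Q_def arcs_ok_def
    proof (intro conjI allI impI)
      show "L' \<subseteq> {..<N} \<times> {..<N}"
      proof
        fix x assume "x \<in> L'"
        then show "x \<in> {..<N} \<times> {..<N}" using Ls(1) T'N v(1) by (cases x) (auto simp: L')
      qed
      show "(j, i) \<notin> L'" if "(i, j) \<in> L'" for i j
        using that Ls(2) T'N by (auto simp: L')
      show "card {u. (w, u) \<in> L'} \<le> 3 * k + 1" for w
      proof (cases "w = v")
        case True
        have "{u. (v, u) \<in> L'} \<subseteq> {u. (v, u) \<in> L} \<union> T'" by (auto simp: L')
        then have "card {u. (v, u) \<in> L'} \<le> card ({u. (v, u) \<in> L} \<union> T')"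
          using fin_out T'(3) by (intro card_mono) auto
        also have "\<dots> \<le> k + (k + 1)"
          using card_Un_le[of "{u. (v, u) \<in> L}" T'] v(2) T'(2) by linarith
        finally show ?thesis using True by simp
      next
        case False
        have "{u. (w, u) \<in> L'} \<subseteq> {u. (w, u) \<in> L}" using False by (auto simp: L')
        then have "card {u. (w, u) \<in> L'} \<le> card {u. (w, u) \<in> L}"
          using fin_out by (intro card_mono) auto
        then show ?thesis using od[of w] by linarith
      qed
      fix B f assume B: "conn B" "emb B adj UNIV (arc_host L') f"
      have same: "arc_host L' i j = arc_host L i j" if "arc_host L' i j \<noteq> None" "\<not> (i = v \<and> j \<in> T')" "\<not> (j = v \<and> i \<in> T')" for i j
      proof -
        have 1: "(i, j) \<in> L' \<longleftrightarrow> (i, j) \<in> L \<and> j \<noteq> v" "(j, i) \<in> L' \<longleftrightarrow> (j, i) \<in> L \<and> i \<noteq> v"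
          using that(2,3) L' by blast+
        then show ?thesis using that(1) Ls(2)[of i j] unfolding arc_host_def by (cases "(i, j) \<in> L"; cases "(j, i) \<in> L"; cases "i = v"; cases "j = v") simp_all
      qed
      show "B \<in> D"
      proof (cases "\<exists>x\<in>B. \<exists>y\<in>B. adj x y \<and> f x = v \<and> f y \<in> T'")
        case False
        have "emb B adj UNIV (arc_host L) f"
        proof (rule emb_transfer[OF B(2), where \<phi> = id and K = UNIV])
          show "inj_on f B" using emb_inj[OF B(2)] .
          fix x y assume xy: "x \<in> B" "y \<in> B" "adj x y"
          show "arc_host L (f x) (f y) = map_option id (arc_host L' (f x) (f y))"
            using same[OF emb_edge[OF B(2) xy]] False xy adj_sym by (auto simp: option.map_id)
        qed auto
        then show ?thesis using LD B(1) by blast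
      next
        case True
        then obtain x0 y0 where x0: "x0 \<in> B" "y0 \<in> B" "adj x0 y0" "f x0 = v" "f y0 \<in> T'" by blast
        define u where "u = f y0"
        have uN: "u < N" "u \<noteq> v" "(v, u) \<notin> L" "\<not> arc_saturated D N L u" using T'N x0 by (auto simp: u_def)
        have injf: "\<And>x y. x \<in> B \<Longrightarrow> y \<in> B \<Longrightarrow> f x = f y \<Longrightarrow> x = y" using emb_inj[OF B(2)] by (auto simp: inj_on_def)
        have c0: "arc_host L' (f x0) (f y0) = Some v" using x0 by (simp add: arc_host_def L')
        \<comment> \<open>No arc of \<open>L'\<close> enters \<open>v\<close>, and all arcs leaving
          \<open>v\<close> have the same color, so a rainbow piece has a single edge at
          \<open>x0\<close>.\<close>
        have leaf: "y = y0" if "y \<in> B" "adj x0 y" for y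
        proof -
          have "arc_host L' (f x0) (f y) = Some v"
            using emb_edge[OF B(2) x0(1) that] T'N by (auto simp: arc_host_def L' x0(4) split: if_splits)
          then show ?thesis using emb_rb[OF B(2) x0(1-3) x0(1) that] c0 by (auto simp: doubleton_eq_iff)
        qed
        have fN: "f y < N" if y: "y \<in> B" for y
        proof -
          obtain y' where "y' \<in> B" "y' \<noteq> y" using x0 adj_irrefl by metis
          then obtain w where w: "w \<in> B" "adj y w" using conn_nbr[OF B(1) y] by metis
          have "arc_host L' (f y) (f w) \<noteq> None" using emb_edge[OF B(2) y w] .
          then show ?thesis using Ls(1) T'N v(1) by (auto simp: arc_host_def L' split: if_splits)
        qed
        \<comment> \<open>Moving \<open>x0\<close> from \<open>v\<close> to the placeholder
          \<open>N\<close> gives a piece in \<open>L\<close> plus the arc from \<open>N\<close> to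
          \<open>u\<close>; if it were outside \<open>D\<close>, then \<open>u\<close> would be
          saturated.\<close>
        define f' where "f' = f(x0 := N)"
        have "emb B adj UNIV (arc_host (insert (N, u) L)) f'"
        proof (rule emb_transfer[OF B(2), where \<phi> = "\<lambda>c. if c = v then N else c" and K = "{..<N}"])
          show "inj_on f' B" using injf fN by (force simp: f'_def inj_on_def)
          show "inj_on (\<lambda>c. if c = v then N else c) {..<N}" by (auto simp: inj_on_def)
          fix x y assume xy: "x \<in> B" "y \<in> B" "adj x y"
          have L'N: "L' \<subseteq> {..<N} \<times> {..<N}" using Ls(1) T'N v(1) by (auto simp: L')
          show "c \<in> {..<N}" if "arc_host L' (f x) (f y) = Some c" for c
            using arc_host_lt[OF L'N that] by auto
          show "arc_host (insert (N, u) L) (f' x) (f' y) = map_option (\<lambda>c. if c = v then N else c) (arc_host L' (f x) (f y))"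
          proof (cases "x = x0 \<or> y = x0")
            case True
            have nN: "(u, N) \<notin> L" "(N, u) \<notin> L" using Ls(1) by auto
            from True show ?thesis
            proof
              assume "x = x0"
              then have "y = y0" using leaf xy by blast
              then have "arc_host (insert (N, u) L) (f' x) (f' y) = Some N"
                using \<open>x = x0\<close> x0 adj_irrefl by (auto simp: f'_def u_def arc_host_def)
              then show ?thesis using c0 \<open>x = x0\<close> \<open>y = y0\<close> by simp
            next
              assume "y = x0"
              then have "x = y0" using leaf xy adj_sym by blast
              moreover have "x0 \<noteq> y0" using x0 adj_irrefl by auto
              ultimately have "arc_host (insert (N, u) L) (f' x) (f' y) = Some N"
                using \<open>y = x0\<close> nN uN(1) by (auto simp: f'_def u_def arc_host_def)
              moreover have "arc_host L' (f x) (f y) = Some v"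
              proof -
                have "(u, v) \<notin> L'" using uN by (auto simp: L')
                then show ?thesis using c0 \<open>x = y0\<close> \<open>y = x0\<close> x0 by (auto simp: arc_host_def u_def L')
              qed
              ultimately show ?thesis by simp
            qed
          next
            case False
            then have nv: "f x \<noteq> v" "f y \<noteq> v" using injf x0 xy by auto
            have e: "arc_host L' (f x) (f y) = arc_host L (f x) (f y)"
              using same[OF emb_edge[OF B(2) xy]] nv by blast
            have "arc_host (insert (N, u) L) (f x) (f y) = arc_host L (f x) (f y)"
              using fN[OF xy(1)] fN[OF xy(2)] by (auto simp: arc_host_def)
            moreover have "arc_host L (f x) (f y) \<noteq> Some v" using arc_host_lt[OF Ls(1)] nv by metis
            ultimately show ?thesis using e False by (cases "arc_host L (f x) (f y)") (auto simp: f'_def)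
          qed
        qed auto
        then show ?thesis using uN(4) B(1) by (auto simp: arc_saturated_def)
      qed
    qed
    then show False using max bigger by force
  qed
  then show thesis using that[OF ok] id od by (simp add: k_def T_def)
qed

section \<open>Local witnesses of saturation\<close>

lemma conn_remove_leaf:
  assumes B: "conn B" "q \<in> B" "p \<in> B" "adj p q" "\<And>y. y \<in> B \<Longrightarrow> adj q y \<Longrightarrow> y = p"
  shows "conn (B - {q})"
proof -
  have pq: "p \<noteq> q" using B(4) adj_irrefl by auto
  have main: "(b \<noteq> q \<longrightarrow> (a, b) \<in> (step (B - {q}))\<^sup>*) \<and> (b = q \<longrightarrow> (a, p) \<in> (step (B - {q}))\<^sup>*)"
    if ab: "(a, b) \<in> (step B)\<^sup>*" and aq: "a \<noteq> q" for a b
    using ab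
  proof induction
    case base then show ?case using aq by simp
  next
    case (step b c)
    have bc: "b \<in> B" "c \<in> B" "adj b c" using step(2) by (auto simp: step_def)
    show ?case
    proof (cases "b = q")
      case True
      then have "c = p" using B(5) bc by blast
      then show ?thesis using step(3) True pq by simp
    next
      case b: False
      show ?thesis
      proof (cases "c = q")
        case True
        then have "b = p" using B(5) bc adj_sym by blast
        then show ?thesis using True step(3) b by simp
      next
        case False
        then have "(b, c) \<in> local.step (B - {q})" using b bc by (auto simp: step_def)
        then show ?thesis using step(3) b False by auto
      qed
    qed
  qed
  show ?thesis
    unfolding conn_def
  proof (intro conjI ballI)
    show "B - {q} \<noteq> {}" using B(3) pq by auto
    show "B - {q} \<subseteq> V" using conn_sub[OF B(1)] by auto
    show "(a, b) \<in> (step (B - {q}))\<^sup>*" if "a \<in> B - {q}" "b \<in> B - {q}" for a b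
      using main[of a b] that B(1) by (auto simp: conn_def)
  qed
qed

text \<open>The leaf \<open>q\<close> sits on the placeholder \<open>N\<close> and can later be
  moved to another vertex. The distance bound keeps the rest near \<open>u\<close>, so that
  witnesses at distant vertices are disjoint.\<close>

definition "leaf_witness D N L u B f p q \<longleftrightarrow> conn B \<and> B \<notin> D \<and>
   (\<forall>B'. conn B' \<longrightarrow> le B' B \<longrightarrow> weight B' < weight B \<longrightarrow> B' \<in> D) \<and>
   emb B adj UNIV (arc_host (insert (N, u) L)) f \<and> q \<in> B \<and> f q = N \<and> p \<in> B \<and> f p = u \<and> adj p q \<and>
   (\<forall>y\<in>B. adj q y \<longrightarrow> y = p) \<and> B - {q} \<in> D \<and> (\<forall>x\<in>B - {q}. f x < N \<and>
      (\<exists>n\<le>card V * card V. (u, f x) \<in> {(i, j). (i, j) \<in> L \<or> (j, i) \<in> L} ^^ n))"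

text \<open>A witness of least weight has all lighter pieces below it in \<open>D\<close>. It must
  use \<open>N\<close>, since \<open>L\<close> alone hosts only members of \<open>D\<close>, and the
  only neighbor of \<open>N\<close> is \<open>u\<close>; so the vertex on \<open>N\<close> is a leaf
  and deleting it leaves a connected set.\<close>

lemma leaf_witness_exists:
  assumes D: "\<And>x. x \<in> V \<Longrightarrow> {x} \<in> D" and ok: "arcs_ok D N L" and u: "u < N" "arc_saturated D N L u"
  shows "\<exists>B f p q. leaf_witness D N L u B f p q"
proof -
  define S where "S = {(i, j). (i, j) \<in> L \<or> (j, i) \<in> L}"
  have Ls: "L \<subseteq> {..<N} \<times> {..<N}" "\<And>i j. (i, j) \<in> L \<Longrightarrow> (j, i) \<notin> L"
    and LD: "\<And>B f. conn B \<Longrightarrow> emb B adj UNIV (arc_host L) f \<Longrightarrow> B \<in> D" using ok unfolding arcs_ok_def by blast+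
  define Q where "Q B \<longleftrightarrow> conn B \<and> B \<notin> D \<and> (\<exists>f. emb B adj UNIV (arc_host (insert (N, u) L)) f)" for B
  obtain B1 where "Q B1" using u(2) by (auto simp: arc_saturated_def Q_def)
  then obtain B where B: "Q B" and Bmin: "\<And>B'. Q B' \<Longrightarrow> weight B \<le> weight B'"
    using ex_has_least_nat[of Q B1 weight] by blast
  obtain f where cB: "conn B" "B \<notin> D" and f: "emb B adj UNIV (arc_host (insert (N, u) L)) f" using B by (auto simp: Q_def)
  have min: "B' \<in> D" if cB': "conn B'" and leB': "le B' B" and rB': "weight B' < weight B" for B'
  proof (rule ccontr)
    assume "B' \<notin> D"
    obtain g where g: "inj_on g B'" "\<forall>x\<in>B'. g x \<in> B" "\<forall>x\<in>B'. \<forall>y\<in>B'. adj x y \<longrightarrow> adj (g x) (g y)"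
      using leB' by (auto simp: le_def)
    have "emb B' adj UNIV (arc_host (insert (N, u) L)) (f \<circ> g)" using g by (intro emb_le[OF f]) auto
    then have "Q B'" using cB' \<open>B' \<notin> D\<close> by (auto simp: Q_def)
    then show False using Bmin rB' by force
  qed
  have injf: "\<And>x y. x \<in> B \<Longrightarrow> y \<in> B \<Longrightarrow> f x = f y \<Longrightarrow> x = y" using emb_inj[OF f] by (auto simp: inj_on_def)
  have hN: "arc_host (insert (N, u) L) i j = arc_host L i j" if "i \<noteq> N" "j \<noteq> N" for i j
    using that by (auto simp: arc_host_def)
  have "\<exists>q\<in>B. f q = N"
  proof (rule ccontr)
    assume "\<not> ?thesis"
    then have n: "\<And>x. x \<in> B \<Longrightarrow> f x \<noteq> N" by blast
    have "emb B adj UNIV (arc_host L) f"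
      by (rule emb_transfer[OF f, where \<phi> = id and K = UNIV])
        (use emb_inj[OF f] n hN in \<open>auto simp: option.map_id\<close>)
    then show False using LD cB by blast
  qed
  then obtain q where q: "q \<in> B" "f q = N" by blast
  have nbr: "\<exists>y\<in>B. adj x y" if "x \<in> B" for x
  proof -
    have "\<exists>y\<in>B. y \<noteq> x"
    proof (rule ccontr)
      assume "\<not> ?thesis"
      then have "B = {x}" using that by blast
      then show False using D that conn_sub[OF cB(1)] cB(2) by blast
    qed
    then show ?thesis using conn_nbr[OF cB(1) that] by metis
  qed
  have hq: "f y = u" if "y \<in> B" "adj q y" for y
    using emb_edge[OF f q(1) that] q(2) Ls(1) u(1) by (auto simp: arc_host_def split: if_splits)
  obtain p where p: "p \<in> B" "adj q p" using nbr[OF q(1)] by blast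
  have fp: "f p = u" using hq p by blast
  have uniq: "y = p" if "y \<in> B" "adj q y" for y using hq[OF that] fp injf that p by auto
  have apq: "adj p q" using p adj_sym by blast
  have c1: "conn (B - {q})" by (rule conn_remove_leaf[OF cB(1) q(1) p(1) apq uniq])
  have fB: "finite B" using conn_fin cB by blast
  have "weight (B - {q}) < weight B"
  proof -
    have "card (B - {q}) < card B" using fB q(1) by (rule card_Diff1_less)
    moreover have "card (edges_in (B - {q})) \<le> card (edges_in B)" using le_card[OF le_sub[of "B - {q}" B] fB] by blast
    ultimately show ?thesis by (simp add: weight_def)
  qed
  then have BD: "B - {q} \<in> D" using min[OF c1 le_sub] by blast
  have "f x < N \<and> (\<exists>n\<le>card V * card V. (u, f x) \<in> S ^^ n)" if x: "x \<in> B - {q}" for x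
  proof
    have fx: "f x \<noteq> N" using x q injf by auto
    obtain y where y: "y \<in> B" "adj x y" using nbr x by blast
    have "arc_host (insert (N, u) L) (f x) (f y) \<noteq> None" using emb_edge[OF f _ y] x by blast
    then show "f x < N" using fx Ls(1) u(1) by (auto simp: arc_host_def split: if_splits)
    have "(p, x) \<in> (step (B - {q}))\<^sup>*" using c1 x p apq adj_irrefl by (auto simp: conn_def)
    moreover have fs: "step (B - {q}) \<subseteq> V \<times> V" using conn_sub[OF cB(1)] by (auto simp: step_def)
    moreover have "finite (step (B - {q}))" using fs fin by (meson finite_SigmaI finite_subset)
    \<comment> \<open>A shortest path needs no more steps than the relation has pairs; this crude
      count is the origin of the bound \<open>card V * card V\<close>.\<close>
    ultimately obtain n where n: "n \<le> card (step (B - {q}))" "(p, x) \<in> step (B - {q}) ^^ n"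
      using rtrancl_finite_eq_relpow by blast
    have "n \<le> card V * card V"
      using n(1) card_mono[OF _ fs] fin by (simp add: card_cartesian_product)
    moreover have "(f a, f b) \<in> S ^^ m" if "(a, b) \<in> step (B - {q}) ^^ m" for a b m
      using that
    proof (induction m arbitrary: b)
      case (Suc m)
      then obtain c where c: "(a, c) \<in> step (B - {q}) ^^ m" "(c, b) \<in> step (B - {q})" by auto
      have cb: "c \<in> B" "b \<in> B" "c \<noteq> q" "b \<noteq> q" "adj c b" using c(2) by (auto simp: step_def)
      have "f c \<noteq> N" "f b \<noteq> N" using cb q injf by auto
      then have "arc_host L (f c) (f b) \<noteq> None" using emb_edge[OF f cb(1,2,5)] hN by metis
      then have "(f c, f b) \<in> S" by (auto simp: arc_host_def S_def split: if_splits)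
      then show ?case using Suc.IH[OF c(1)] by auto
    qed auto
    ultimately show "\<exists>n\<le>card V * card V. (u, f x) \<in> S ^^ n" using n(2) fp by blast
  qed
  then show ?thesis unfolding leaf_witness_def S_def[symmetric] using cB min f q p fp apq uniq BD by blast
qed

end


section \<open>Joining a core to the remaining vertices\<close>

text \<open>Every exceptional pair is charged to an end \<open>u\<close> whose set
  \<open>R u\<close> contains the other end, which leaves at most \<open>r\<close> pairs per
  vertex.\<close>

theorem host_linear:
  fixes F :: "'a graph" and h :: "'v \<Rightarrow> 'v \<Rightarrow> 'c option"
  assumes F: "simple_graph F" and U: "finite U" "U \<noteq> {}" and h: "sym_host h"
    and free: "\<And>f. \<not> emb (verts F) (adj_of F) U h f"
    and R: "\<And>u. u \<in> U \<Longrightarrow> finite (R u) \<and> card (R u) \<le> r"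
    and gd: "\<And>u v. u \<in> U \<Longrightarrow> v \<in> U \<Longrightarrow> u \<noteq> v \<Longrightarrow> v \<notin> R u \<Longrightarrow> u \<notin> R v \<Longrightarrow>
         h u v = None \<and> good (verts F) (adj_of F) U h u v"
  shows "rsat (card U) F \<le> r * card U"
proof -
  define P where "P = (\<Union>u\<in>U. (\<lambda>v. {u, v}) ` R u)"
  have "card P \<le> (\<Sum>u\<in>U. card ((\<lambda>v. {u, v}) ` R u))" unfolding P_def using U(1) by (rule card_UN_le)
  also have "\<dots> \<le> (\<Sum>u\<in>U. r)"
  proof (rule sum_mono)
    fix u assume "u \<in> U"
    then show "card ((\<lambda>v. {u, v}) ` R u) \<le> r" using R card_image_le[of "R u" "\<lambda>v. {u, v}"] by force
  qed
  finally have cP: "card P \<le> r * card U" by (simp add: mult.commute)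
  have "rsat (card U) F \<le> card P"
  proof (rule host_saturated[OF F U h free])
    show "finite P" using U R by (auto simp: P_def)
    show "h u v = None \<and> good (verts F) (adj_of F) U h u v"
      if "u \<in> U" "v \<in> U" "u \<noteq> v" "{u, v} \<notin> P" for u v
    proof (rule gd[OF that(1-3)])
      show "v \<notin> R u" using that by (auto simp: P_def)
      show "u \<notin> R v" using that by (auto simp: P_def insert_commute)
    qed
  qed
  then show ?thesis using cP by linarith
qed

text \<open>In \<open>fresh h u v\<close> the added edge gets a color different from all others.\<close>

definition fresh :: "('v \<Rightarrow> 'v \<Rightarrow> 'c option) \<Rightarrow> 'v \<Rightarrow> 'v \<Rightarrow> 'v \<Rightarrow> 'v \<Rightarrow> 'c option option" where
  "fresh h u v = recolor (\<lambda>x y. map_option Some (h x y)) u v None"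

text \<open>Separates two tasks: a copy is built as if the added edge had a private color, and
  afterwards it is checked that the prescribed color does not recur on it.\<close>

lemma emb_fresh:
  assumes f: "emb A adj U (fresh h u v) f"
    and c: "\<And>x y. x \<in> A \<Longrightarrow> y \<in> A \<Longrightarrow> adj x y \<Longrightarrow> h (f x) (f y) = Some c \<Longrightarrow> {f x, f y} = {u, v}"
  shows "emb A adj U (recolor h u v c) f"
proof -
  have key: "(fresh h u v (f x) (f y) = Some None \<and> recolor h u v c (f x) (f y) = Some c) \<or>
      (\<exists>d. d \<noteq> c \<and> fresh h u v (f x) (f y) = Some (Some d) \<and> recolor h u v c (f x) (f y) = Some d)"
    if xy: "x \<in> A" "y \<in> A" "adj x y" for x y
  proof (cases "{f x, f y} = {u, v}")
    case True then show ?thesis by (simp add: fresh_def recolor_def)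
  next
    case False
    then have 1: "fresh h u v (f x) (f y) = map_option Some (h (f x) (f y))"
      "recolor h u v c (f x) (f y) = h (f x) (f y)" by (simp_all add: fresh_def recolor_def)
    then obtain d where "h (f x) (f y) = Some d" using emb_edge[OF f xy] by auto
    then show ?thesis using 1 c[OF xy] False by auto
  qed
  show ?thesis
  proof (rule embI)
    show "inj_on f A" "\<And>x. x \<in> A \<Longrightarrow> f x \<in> U" using emb_inj[OF f] emb_in[OF f] by auto
    show "recolor h u v c (f x) (f y) \<noteq> None" if "x \<in> A" "y \<in> A" "adj x y" for x y
      using key[OF that] by auto
    show "{x, y} = {x', y'}" if xy: "x \<in> A" "y \<in> A" "adj x y" and xy': "x' \<in> A" "y' \<in> A" "adj x' y'"
      and e: "recolor h u v c (f x) (f y) = recolor h u v c (f x') (f y')" for x y x' y'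
      using emb_rb[OF f xy xy'] key[OF xy] key[OF xy'] e by auto
  qed
qed

datatype ('k, 'x) join_vertex = Cr 'k | Ou 'x
datatype ('q, 'k, 'x, 'y) join_color = CC 'q | CJ 'k 'x | CX 'y

text \<open>Edges between core and outer vertices have private colors, so they can conflict only
  with the color of the added edge. The set \<open>J\<close> is there because gadgets will be added
  to the core without being joined to the outer vertices.\<close>

fun join_host :: "'k set \<Rightarrow> ('k \<Rightarrow> 'k \<Rightarrow> 'q option) \<Rightarrow> ('x \<Rightarrow> 'x \<Rightarrow> 'y option) \<Rightarrow>
    ('k, 'x) join_vertex \<Rightarrow> ('k, 'x) join_vertex \<Rightarrow> ('q, 'k, 'x, 'y) join_color option" where
  "join_host J hc hx (Cr a) (Cr b) = map_option CC (hc a b)"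
| "join_host J hc hx (Cr a) (Ou x) = (if a \<in> J then Some (CJ a x) else None)"
| "join_host J hc hx (Ou x) (Cr a) = (if a \<in> J then Some (CJ a x) else None)"
| "join_host J hc hx (Ou x) (Ou y) = map_option CX (hx x y)"

lemma join_host_sym: "sym_host hc \<Longrightarrow> sym_host hx \<Longrightarrow> sym_host (join_host J hc hx)"
  unfolding sym_host_def
proof (intro allI)
  fix s t assume "\<forall>x y. hc x y = hc y x" "\<forall>x y. hx x y = hx y x"
  then show "join_host J hc hx s t = join_host J hc hx t s" by (cases s; cases t) simp_all
qed

text \<open>The two parts are embedded independently because their colors are of different kinds.
  The conditions \<open>cC\<close>, \<open>cJ\<close> and \<open>cX\<close> treat the three kinds of
  colors that the added edge may repeat.\<close>

lemma join_emb:
  fixes hc :: "'k \<Rightarrow> 'k \<Rightarrow> 'q option" and hx :: "'x \<Rightarrow> 'x \<Rightarrow> 'y option" and c :: "('q, 'k, 'x, 'y) join_color"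
  assumes ad: "\<And>x y. adj x y \<Longrightarrow> adj y x" and W: "W \<subseteq> A"
    and \<psi>: "emb W adj K hc \<psi>" and \<phi>: "emb (A - W) adj X (fresh hx u v) \<phi>"
    and J: "\<And>w y. w \<in> W \<Longrightarrow> y \<in> A - W \<Longrightarrow> adj w y \<Longrightarrow> \<psi> w \<in> J"
    and cC: "\<And>\<kappa> x y. c = CC \<kappa> \<Longrightarrow> x \<in> W \<Longrightarrow> y \<in> W \<Longrightarrow> adj x y \<Longrightarrow> hc (\<psi> x) (\<psi> y) \<noteq> Some \<kappa>"
    and cJ: "\<And>t w y. c = CJ (\<psi> w) t \<Longrightarrow> w \<in> W \<Longrightarrow> y \<in> A - W \<Longrightarrow> adj w y \<Longrightarrow> \<phi> y \<noteq> t"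
    and cX: "\<And>\<xi> x y. c = CX \<xi> \<Longrightarrow> x \<in> A - W \<Longrightarrow> y \<in> A - W \<Longrightarrow> adj x y \<Longrightarrow>
        hx (\<phi> x) (\<phi> y) = Some \<xi> \<Longrightarrow> {\<phi> x, \<phi> y} = {u, v}"
  shows "\<exists>f. emb A adj (Cr ` K \<union> Ou ` X) (recolor (join_host J hc hx) (Ou u) (Ou v) c) f"
proof -
  define f where "f x = (if x \<in> W then Cr (\<psi> x) else Ou (\<phi> x))" for x
  let ?h = "join_host J hc hx"
  let ?F = "fresh ?h (Ou u) (Ou v)"
  have fW: "f x = Cr (\<psi> x)" if "x \<in> W" for x using that by (simp add: f_def)
  have fN: "f x = Ou (\<phi> x)" if "x \<in> A - W" for x using that by (simp add: f_def)
  have key: "(x \<in> W \<and> y \<in> W \<and> (\<exists>\<kappa>. hc (\<psi> x) (\<psi> y) = Some \<kappa> \<and> ?F (f x) (f y) = Some (Some (CC \<kappa>)) \<and> ?h (f x) (f y) = Some (CC \<kappa>)))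
    \<or> (\<exists>w z. w \<in> W \<and> z \<in> A - W \<and> adj w z \<and> {x, y} = {w, z} \<and> ?F (f x) (f y) = Some (Some (CJ (\<psi> w) (\<phi> z)))
         \<and> ?h (f x) (f y) = Some (CJ (\<psi> w) (\<phi> z)))
    \<or> (x \<in> A - W \<and> y \<in> A - W \<and> (\<exists>t. fresh hx u v (\<phi> x) (\<phi> y) = Some t \<and> ?F (f x) (f y) = Some (map_option CX t)))"
    if xy: "x \<in> A" "y \<in> A" "adj x y" for x y
  proof (cases "x \<in> W"; cases "y \<in> W")
    assume a: "x \<in> W" "y \<in> W"
    then obtain \<kappa> where "hc (\<psi> x) (\<psi> y) = Some \<kappa>" using emb_edge[OF \<psi> a xy(3)] by blast
    then show ?thesis using a fW by (auto simp: fresh_def recolor_def doubleton_eq_iff)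
  next
    assume a: "x \<in> W" "y \<notin> W"
    then have "?h (f x) (f y) = Some (CJ (\<psi> x) (\<phi> y))" using J[OF a(1) _ xy(3)] xy fW fN by simp
    moreover have "?F (f x) (f y) = map_option Some (?h (f x) (f y))"
      using a xy fW fN by (simp add: fresh_def recolor_def doubleton_eq_iff)
    ultimately show ?thesis using a xy by (intro disjI2 disjI1 exI[of _ x] exI[of _ y]) simp
  next
    assume a: "x \<notin> W" "y \<in> W"
    then have "?h (f x) (f y) = Some (CJ (\<psi> y) (\<phi> x))" using J[OF a(2) _ ad[OF xy(3)]] xy fW fN by simp
    moreover have "?F (f x) (f y) = map_option Some (?h (f x) (f y))"
      using a xy fW fN by (simp add: fresh_def recolor_def doubleton_eq_iff)
    ultimately show ?thesis using a xy ad[OF xy(3)]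
      by (intro disjI2 disjI1 exI[of _ y] exI[of _ x]) (simp add: insert_commute)
  next
    assume a: "x \<notin> W" "y \<notin> W"
    then have b: "x \<in> A - W" "y \<in> A - W" using xy by auto
    obtain t where t: "fresh hx u v (\<phi> x) (\<phi> y) = Some t" using emb_edge[OF \<phi> b xy(3)] by blast
    have "{f x, f y} = {Ou u, Ou v} \<longleftrightarrow> {\<phi> x, \<phi> y} = {u, v}"
      unfolding fN[OF b(1)] fN[OF b(2)] by (auto simp: doubleton_eq_iff)
    then have "?F (f x) (f y) = map_option (map_option CX) (fresh hx u v (\<phi> x) (\<phi> y))"
      unfolding fresh_def recolor_def using fN[OF b(1)] fN[OF b(2)]
      by (cases "hx (\<phi> x) (\<phi> y)"; cases "{\<phi> x, \<phi> y} = {u, v}") simp_all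
    then show ?thesis using b t by simp
  qed
  have "emb A adj (Cr ` K \<union> Ou ` X) ?F f"
  proof (rule embI)
    show "inj_on f A"
    proof (rule inj_onI)
      fix x y assume "x \<in> A" "y \<in> A" "f x = f y"
      then show "x = y" using emb_inj[OF \<psi>] emb_inj[OF \<phi>]
        by (cases "x \<in> W"; cases "y \<in> W") (auto simp: f_def inj_on_def)
    qed
    show "f x \<in> Cr ` K \<union> Ou ` X" if "x \<in> A" for x
      using that emb_in[OF \<psi>, of x] emb_in[OF \<phi>, of x] by (simp add: f_def)
    show "?F (f x) (f y) \<noteq> None" if "x \<in> A" "y \<in> A" "adj x y" for x y using key[OF that] by auto
    show "{x, y} = {x', y'}" if xy: "x \<in> A" "y \<in> A" "adj x y" and xy': "x' \<in> A" "y' \<in> A" "adj x' y'"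
      and e: "?F (f x) (f y) = ?F (f x') (f y')" for x y x' y'
      using key[OF xy]
    proof (elim disjE conjE exE)
      fix \<kappa> assume 1: "x \<in> W" "y \<in> W" "hc (\<psi> x) (\<psi> y) = Some \<kappa>" "?F (f x) (f y) = Some (Some (CC \<kappa>))"
      have "x' \<in> W \<and> y' \<in> W \<and> hc (\<psi> x') (\<psi> y') = Some \<kappa>"
        using key[OF xy'] e 1(4) by (auto simp: map_option_case split: option.splits)
      then show ?thesis using emb_rb[OF \<psi> 1(1,2) xy(3) _ _ xy'(3)] 1(3) by simp
    next
      fix w z assume 1: "w \<in> W" "z \<in> A - W" "{x, y} = {w, z}" "?F (f x) (f y) = Some (Some (CJ (\<psi> w) (\<phi> z)))"
      obtain w' z' where 2: "w' \<in> W" "z' \<in> A - W" "{x', y'} = {w', z'}" "\<psi> w = \<psi> w'" "\<phi> z = \<phi> z'"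
        using key[OF xy'] e 1(4) by (auto simp: map_option_case split: option.splits)
      then have "w = w'" "z = z'" using 1 emb_inj[OF \<psi>] emb_inj[OF \<phi>] by (simp_all add: inj_on_def)
      then show ?thesis using 1(3) 2(3) by simp
    next
      fix t assume 1: "x \<in> A - W" "y \<in> A - W" "fresh hx u v (\<phi> x) (\<phi> y) = Some t" "?F (f x) (f y) = Some (map_option CX t)"
      have inj: "(map_option CX t :: ('q, 'k, 'x, 'y) join_color option) = map_option CX t' \<Longrightarrow> t = t'" for t' :: "'y option"
        by (cases t; cases t') auto
      have "x' \<in> A - W \<and> y' \<in> A - W \<and> fresh hx u v (\<phi> x') (\<phi> y') = Some t"
        using key[OF xy'] e 1(4) inj by (cases t) auto
      then show ?thesis using emb_rb[OF \<phi> 1(1,2) xy(3) _ _ xy'(3)] 1(3) by simp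
    qed
  qed
  then have "emb A adj (Cr ` K \<union> Ou ` X) (recolor ?h (Ou u) (Ou v) c) f"
  proof (rule emb_fresh)
    fix x y assume xy: "x \<in> A" "y \<in> A" "adj x y" and e: "?h (f x) (f y) = Some c"
    show "{f x, f y} = {Ou u, Ou v}"
      using key[OF xy]
    proof (elim disjE conjE exE)
      fix \<kappa> assume "x \<in> W" "y \<in> W" "hc (\<psi> x) (\<psi> y) = Some \<kappa>" "?h (f x) (f y) = Some (CC \<kappa>)"
      then show ?thesis using cC[of \<kappa> x y] e xy by simp
    next
      fix w z assume "w \<in> W" "z \<in> A - W" "adj w z" "?h (f x) (f y) = Some (CJ (\<psi> w) (\<phi> z))"
      then show ?thesis using cJ[of w "\<phi> z" z] e by simp
    next
      fix t assume 1: "x \<in> A - W" "y \<in> A - W"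
      then obtain \<xi> where "c = CX \<xi>" "hx (\<phi> x) (\<phi> y) = Some \<xi>" using e fN by auto
      then have "{\<phi> x, \<phi> y} = {u, v}" using cX[of \<xi> x y] 1 xy by simp
      then show ?thesis using fN 1 by (auto simp: doubleton_eq_iff)
    qed
  qed
  then show ?thesis by blast
qed

text \<open>Used for freeness: a copy in the joined host decomposes into a part in the core and a
  part outside, each of which can be analysed by itself.\<close>

lemma join_split:
  assumes f: "emb A adj (Cr ` K \<union> Ou ` X) (join_host J hc hx) f"
  obtains W \<psi> \<phi> where "W \<subseteq> A" "emb W adj K hc \<psi>" "emb (A - W) adj X hx \<phi>"
    "\<And>x. x \<in> W \<Longrightarrow> f x = Cr (\<psi> x)" "\<And>x. x \<in> A - W \<Longrightarrow> f x = Ou (\<phi> x)"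
proof -
  define W where "W = {x \<in> A. \<exists>a. f x = Cr a}"
  define \<psi> where "\<psi> x = (case f x of Cr a \<Rightarrow> a)" for x
  define \<phi> where "\<phi> x = (case f x of Ou a \<Rightarrow> a)" for x
  have fW: "f x = Cr (\<psi> x)" "x \<in> A" if "x \<in> W" for x using that by (auto simp: W_def \<psi>_def)
  have fN: "f x = Ou (\<phi> x)" "x \<in> A" if "x \<in> A - W" for x using that by (cases "f x"; auto simp: W_def \<phi>_def)+
  show thesis
  proof
    show "W \<subseteq> A" by (auto simp: W_def)
    show "emb W adj K hc \<psi>"
    proof (rule embI)
      show "inj_on \<psi> W" using emb_inj[OF f] fW by (metis inj_onD inj_onI)
      show "\<psi> x \<in> K" if "x \<in> W" for x using emb_in[OF f, of x] fW[OF that] by auto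
      show "hc (\<psi> x) (\<psi> y) \<noteq> None" if "x \<in> W" "y \<in> W" "adj x y" for x y
        using emb_edge[OF f fW(2)[OF that(1)] fW(2)[OF that(2)] that(3)] fW(1)[OF that(1)] fW(1)[OF that(2)] by simp
      show "{x, y} = {x', y'}" if "x \<in> W" "y \<in> W" "adj x y" "x' \<in> W" "y' \<in> W" "adj x' y'"
        "hc (\<psi> x) (\<psi> y) = hc (\<psi> x') (\<psi> y')" for x y x' y'
        by (rule emb_rb[OF f]) (use that fW in auto)
    qed
    show "emb (A - W) adj X hx \<phi>"
    proof (rule embI)
      show "inj_on \<phi> (A - W)" using emb_inj[OF f] fN by (metis inj_onD inj_onI)
      show "\<phi> x \<in> X" if "x \<in> A - W" for x using emb_in[OF f, of x] fN[OF that] by auto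
      show "hx (\<phi> x) (\<phi> y) \<noteq> None" if "x \<in> A - W" "y \<in> A - W" "adj x y" for x y
        using emb_edge[OF f fN(2)[OF that(1)] fN(2)[OF that(2)] that(3)] fN(1)[OF that(1)] fN(1)[OF that(2)] by simp
      show "{x, y} = {x', y'}" if "x \<in> A - W" "y \<in> A - W" "adj x y" "x' \<in> A - W" "y' \<in> A - W" "adj x' y'"
        "hx (\<phi> x) (\<phi> y) = hx (\<phi> x') (\<phi> y')" for x y x' y'
        by (rule emb_rb[OF f]) (use that fN[OF that(1)] fN[OF that(2)] fN[OF that(4)] fN[OF that(5)] in simp_all)
    qed
  qed (use fW fN in auto)
qed

section \<open>Small trees, matchings and leaves outside the core\<close>

context fgraph begin

lemma small_tree:
  assumes "conn B" "card B \<le> 2" shows "card (edges_in B) < card B"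
proof -
  have fB: "finite B" using conn_fin assms by blast
  have B0: "card B \<noteq> 0" using fB assms(1) by (auto simp: conn_def)
  show ?thesis
  proof (cases "card B = 2")
    case True
    have "e = B" if "e \<in> edges_in B" for e
    proof -
      obtain x y where "e = {x, y}" "x \<in> B" "y \<in> B" "adj x y" using \<open>e \<in> edges_in B\<close> by (auto simp: edges_in_def)
      moreover then have "x \<noteq> y" using adj_irrefl by auto
      ultimately show ?thesis using True fB by (intro card_subset_eq) auto
    qed
    then have "edges_in B \<subseteq> {B}" by blast
    then have "card (edges_in B) \<le> card {B}" by (intro card_mono) simp_all
    then show ?thesis using True by simp
  next
    case False
    then have "card B = 1" using B0 assms(2) by linarith
    then obtain x where "B = {x}" using card_1_singletonE by blast
    then have "edges_in B = {}" using adj_irrefl by (auto simp: edges_in_def)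
    then show ?thesis using B0 by simp
  qed
qed

lemma matching_card:
  assumes B: "conn B" and m: "\<And>x y z. x \<in> B \<Longrightarrow> y \<in> B \<Longrightarrow> z \<in> B \<Longrightarrow> adj x y \<Longrightarrow> adj x z \<Longrightarrow> y = z"
  shows "card B \<le> 2"
proof (cases "\<exists>x\<in>B. \<exists>y\<in>B. adj x y")
  case True
  then obtain x y where xy: "x \<in> B" "y \<in> B" "adj x y" by blast
  have "z \<in> {x, y}" if z: "z \<in> B" for z
  proof -
    have "(z \<in> {x, y}) = (x \<in> {x, y})"
    proof (rule conn_const[OF B, of "\<lambda>z. z \<in> {x, y}", OF _ z xy(1)])
      fix a b assume ab: "a \<in> B" "b \<in> B" "adj a b"
      have "b \<in> {x, y}" if "a \<in> {x, y}" "a \<in> B" "b \<in> B" "adj a b" for a b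
        using that xy m[of x y b] m[of y x b] adj_sym by blast
      then show "(a \<in> {x, y}) = (b \<in> {x, y})" using ab adj_sym by blast
    qed
    then show ?thesis by simp
  qed
  then have "B \<subseteq> {x, y}" by blast
  then have "card B \<le> card {x, y}" by (intro card_mono) simp_all
  then show ?thesis using card_insert_le_m1[of 2 "{y}" x] by (simp add: card_insert_if split: if_splits)
next
  case False
  then obtain x where "B = {x}" using conn_no_edge_single[OF B] by blast
  then show ?thesis by simp
qed

text \<open>For a connected set, fewer edges than vertices means a tree. The edge \<open>pq\<close>
  is the one to be placed on the added pair, with the leaf \<open>q\<close> at whichever end suits
  the color.\<close>

definition "leaf_outside W p q \<longleftrightarrow> W \<subseteq> V \<and> p \<in> V - W \<and> q \<in> V - W \<and> adj p q \<and> (\<forall>y\<in>V - W. adj q y \<longrightarrow> y = p) \<and>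
   (\<forall>B\<in>comps (V - W). card (edges_in B) < card B)"

end

section \<open>Requirements on the core\<close>

locale rgraph =
  fixes F :: "'a graph"
  assumes sF: "simple_graph F"
    and nie: "\<And>p q. adj_of F p q \<Longrightarrow> \<exists>z. z \<noteq> p \<and> z \<noteq> q \<and> (adj_of F p z \<or> adj_of F q z)"
    and niv: "\<And>p. p \<in> verts F \<Longrightarrow> \<exists>q. adj_of F p q"
begin

sublocale fgraph "verts F" "adj_of F"
  by unfold_locales (use sF adj_ofD[OF sF] in \<open>auto simp: simple_graph_def\<close>)

abbreviation "V \<equiv> verts F"
abbreviation "adj \<equiv> adj_of F"

end

locale rcore = rgraph F for F :: "'a graph" +
  fixes K :: "'k set" and hc :: "'k \<Rightarrow> 'k \<Rightarrow> 'q option"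
  assumes finK: "finite K" and symhc: "sym_host hc"
begin

text \<open>The first condition prevents independent outer vertices from completing a copy. The
  other two answer a hostile color of the added edge: the color of a join from \<open>a\<close> to
  the end that receives \<open>p\<close>, or a core color. Joins at the end that receives
  \<open>q\<close> are escaped by exchanging the ends.\<close>

definition "core_ok \<longleftrightarrow> (\<forall>W \<psi>. W \<subseteq> V \<longrightarrow> emb W adj K hc \<psi> \<longrightarrow> (\<exists>x\<in>V - W. \<exists>y\<in>V - W. adj x y)) \<and>
   (\<forall>W p q \<psi>. leaf_outside W p q \<longrightarrow> emb W adj K hc \<psi> \<longrightarrow>
      (\<forall>a. \<exists>\<psi>. emb W adj K hc \<psi> \<and> a \<notin> \<psi> ` {w\<in>W. adj p w}) \<and>
      (\<forall>\<kappa>. \<exists>\<psi>. emb W adj K hc \<psi> \<and> (\<forall>x\<in>W. \<forall>y\<in>W. adj x y \<longrightarrow> hc (\<psi> x) (\<psi> y) \<noteq> Some \<kappa>)))"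

lemma core_okD:
  assumes core_ok
  shows "W \<subseteq> V \<Longrightarrow> emb W adj K hc \<psi> \<Longrightarrow> \<exists>x\<in>V - W. \<exists>y\<in>V - W. adj x y"
    "leaf_outside W p q \<Longrightarrow> emb W adj K hc \<psi> \<Longrightarrow> \<exists>\<psi>. emb W adj K hc \<psi> \<and> a \<notin> \<psi> ` {w\<in>W. adj p w}"
    "leaf_outside W p q \<Longrightarrow> emb W adj K hc \<psi> \<Longrightarrow> \<exists>\<psi>. emb W adj K hc \<psi> \<and> (\<forall>x\<in>W. \<forall>y\<in>W. adj x y \<longrightarrow> hc (\<psi> x) (\<psi> y) \<noteq> Some \<kappa>)"
proof -
  show "W \<subseteq> V \<Longrightarrow> emb W adj K hc \<psi> \<Longrightarrow> \<exists>x\<in>V - W. \<exists>y\<in>V - W. adj x y"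
    using assms unfolding core_ok_def by (elim conjE) metis
  assume a: "leaf_outside W p q" "emb W adj K hc \<psi>"
  have b: "(\<forall>a. \<exists>\<psi>. emb W adj K hc \<psi> \<and> a \<notin> \<psi> ` {w\<in>W. adj p w}) \<and>
      (\<forall>\<kappa>. \<exists>\<psi>. emb W adj K hc \<psi> \<and> (\<forall>x\<in>W. \<forall>y\<in>W. adj x y \<longrightarrow> hc (\<psi> x) (\<psi> y) \<noteq> Some \<kappa>))"
    by (rule assms[unfolded core_ok_def, THEN conjunct2, rule_format, OF a])
  show "\<exists>\<psi>. emb W adj K hc \<psi> \<and> a \<notin> \<psi> ` {w\<in>W. adj p w}"
    by (rule b[THEN conjunct1, rule_format])
  show "\<exists>\<psi>. emb W adj K hc \<psi> \<and> (\<forall>x\<in>W. \<forall>y\<in>W. adj x y \<longrightarrow> hc (\<psi> x) (\<psi> y) \<noteq> Some \<kappa>)"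
    by (rule b[THEN conjunct2, rule_format])
qed

lemma leaf_outside_avoid:
  fixes c :: "('q, 'k, 'x, 'y) join_color"
  assumes ok: core_ok and cl: "leaf_outside W p q" and e: "emb W adj K hc \<psi>"
  shows "\<exists>\<psi>. emb W adj K hc \<psi> \<and> (\<forall>a t. c = CJ a t \<longrightarrow> a \<notin> \<psi> ` {w\<in>W. adj p w}) \<and>
     (\<forall>\<kappa>. c = CC \<kappa> \<longrightarrow> (\<forall>x\<in>W. \<forall>y\<in>W. adj x y \<longrightarrow> hc (\<psi> x) (\<psi> y) \<noteq> Some \<kappa>))"
proof (cases c)
  case (CC \<kappa>) then show ?thesis using core_okD(3)[OF ok cl e] by simp
next
  case (CJ a t) then show ?thesis using core_okD(2)[OF ok cl e] by simp
qed (use e in auto)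

end


section \<open>Independent remaining vertices\<close>

lemma emb_restrict: "emb W adj K h \<psi> \<Longrightarrow> emb W adj K h (restrict \<psi> W)"
  by (subst emb_cong[of W "restrict \<psi> W" \<psi>]) simp_all

context rcore begin

definition "matching A \<longleftrightarrow> (\<forall>x\<in>A. \<forall>y\<in>A. \<forall>z\<in>A. adj x y \<longrightarrow> adj x z \<longrightarrow> y = z)"
definition "core_hosted W \<longleftrightarrow> W \<subseteq> V \<and> (\<exists>\<psi>. emb W adj K hc \<psi>)"
text \<open>When the outer vertices are independent and only gadgets supply edges outside the core,
  the vertices concerned sit in gadgets, so these edges draw their colors from the gadget
  palette.\<close>

definition "touch W = {e \<in> edges F. \<exists>x\<in>e. x \<in> V - W \<and> (\<exists>y\<in>V - W. adj x y)}"

lemma finite_edges: "finite (edges F)"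
  by (rule finite_subset[of _ "Pow (verts F)"]) (use sF in \<open>auto simp: simple_graph_def\<close>)

lemma matching_comps:
  assumes "A \<subseteq> V" "matching A" "B \<in> comps A" shows "card B \<le> 2"
proof (rule matching_card[OF comps_conn[OF assms(1,3)]])
  show "y = z" if "x \<in> B" "y \<in> B" "z \<in> B" "adj x y" "adj x z" for x y z
    using assms(2) that comps_sub[OF assms(3)] unfolding matching_def by blast
qed

text \<open>A gadget is attached to one particular embedding \<open>\<psi>\<close> of
  \<open>W\<close>, which is therefore part of its vertex names. All gadgets share a single palette,
  and \<open>i\<close> is the color that the gadget omits.\<close>

fun gadget_host :: "'a set \<Rightarrow> ('a set \<Rightarrow> nat) \<Rightarrow> ('k + 'a \<times> ('a \<Rightarrow> 'k) \<times> nat) \<Rightarrow>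
    ('k + 'a \<times> ('a \<Rightarrow> 'k) \<times> nat) \<Rightarrow> ('q + nat) option" where
  "gadget_host W \<iota> (Inl a) (Inl b) = map_option Inl (hc a b)"
| "gadget_host W \<iota> (Inl a) (Inr (x, \<psi>, i)) = (if a \<in> \<psi> ` W \<and> adj (inv_into W \<psi> a) x
     then Some (Inr (skip i (\<iota> {inv_into W \<psi> a, x}))) else None)"
| "gadget_host W \<iota> (Inr (x, \<psi>, i)) (Inl a) = (if a \<in> \<psi> ` W \<and> adj (inv_into W \<psi> a) x
     then Some (Inr (skip i (\<iota> {inv_into W \<psi> a, x}))) else None)"
| "gadget_host W \<iota> (Inr (x, \<psi>, i)) (Inr (y, \<psi>', j)) = (if \<psi> = \<psi>' \<and> i = j \<and> adj x y
     then Some (Inr (skip i (\<iota> {x, y}))) else None)"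

lemma gadget_host_sym: "sym_host (gadget_host W \<iota>)"
  unfolding sym_host_def
proof (intro allI)
  fix s t show "gadget_host W \<iota> s t = gadget_host W \<iota> t s"
    using symhc adj_comm by (cases s; cases t) (auto simp: sym_host_def insert_commute)
qed

text \<open>Among the admissible \<open>W\<close> the number of edges touching the matching \<open>V - W\<close> is minimized; the
  gadgets realize all matching edges but one and have too few colors to realize all of them.\<close>

theorem linear_matching:
  assumes ok: core_ok and ex: "\<exists>W. core_hosted W \<and> matching (V - W)"
  shows "\<exists>c n0. \<forall>n\<ge>n0. rsat n F \<le> c * n"
proof -
  obtain W where W: "core_hosted W" "matching (V - W)"
    and Wmin: "\<And>W'. core_hosted W' \<Longrightarrow> matching (V - W') \<Longrightarrow> card (touch W) \<le> card (touch W')"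
    using ex_has_least_nat[of "\<lambda>W. core_hosted W \<and> matching (V - W)" _ "\<lambda>W. card (touch W)"] ex by blast
  have WV: "W \<subseteq> V" using W by (simp add: core_hosted_def)
  obtain \<psi>1 where \<psi>1: "emb W adj K hc \<psi>1" using W by (auto simp: core_hosted_def)
  obtain p q where pq: "p \<in> V - W" "q \<in> V - W" "adj p q" using core_okD(1)[OF ok WV \<psi>1] by blast
  have qp: "adj q p" using pq adj_sym by blast
  have nb: "y = z" if "x \<in> V - W" "y \<in> V - W" "z \<in> V - W" "adj x y" "adj x z" for x y z
    using W(2) that unfolding matching_def by blast
  have cl: "leaf_outside W p q"
    unfolding leaf_outside_def
  proof (intro conjI ballI impI)
    show "y = p" if "y \<in> V - W" "adj q y" for y using nb[OF pq(2) that(1) pq(1) that(2) qp] .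
    show "card (edges_in B) < card B" if "B \<in> comps (V - W)" for B
      using small_tree[OF comps_conn[OF _ that]] matching_comps[OF _ W(2) that] by blast
  qed (use WV pq in auto)
  have pqne: "p \<noteq> q" using pq adj_irrefl by auto
  define Q where "Q = {x \<in> V - W. \<exists>y\<in>V - W. adj x y} - {p, q}"
  define Z where "Z = {x \<in> V - W. \<not> (\<exists>y\<in>V - W. adj x y)}"
  have VW: "V - W = Q \<union> {p, q} \<union> Z" using pq qp by (auto simp: Q_def Z_def)
  have fO: "finite Q" and fZ: "finite Z" and cZ: "card Z \<le> card V"
    using fin by (auto simp: Q_def Z_def intro: card_mono)
  have OO: "y \<in> Q" if "x \<in> Q" "y \<in> V - W" "adj x y" for x y
  proof -
    have x: "x \<in> V - W" "x \<noteq> p" "x \<noteq> q" using that by (auto simp: Q_def)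
    have yx: "adj y x" using that adj_sym by blast
    have "y \<noteq> p" using nb[of p x q] x pq yx by auto
    moreover have "y \<noteq> q" using nb[of q x p] x pq qp yx by auto
    ultimately show ?thesis using that(2) x(1) yx by (auto simp: Q_def)
  qed
  define EO where "EO = {e \<in> edges F. e \<inter> Q \<noteq> {}}"
  define \<eta> where "\<eta> = card EO"
  have fE: "finite EO" using finite_edges by (simp add: EO_def)
  obtain \<iota> where \<iota>: "bij_betw \<iota> EO {..<\<eta>}"
    using ex_bij_betw_finite_nat[OF fE] by (auto simp: \<eta>_def atLeast0LessThan)
  have \<iota>lt: "\<iota> e < \<eta>" if "e \<in> EO" for e using \<iota> that by (auto simp: bij_betw_def)
  have EOI: "{x, y} \<in> EO" if "adj x y" "x \<in> Q \<or> y \<in> Q" for x y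
    using that by (auto simp: EO_def adj_of_def)
  \<comment> \<open>Since \<open>pq\<close> is not isolated in \<open>F\<close>, a second edge meets
    \<open>p\<close> or \<open>q\<close>. Neither of the two lies in \<open>EO\<close>, so there is
    one more edge than the \<open>\<eta> + 1\<close> palette colors.\<close>
  have big: "\<eta> + 2 \<le> card (touch W)"
  proof -
    obtain z where z: "z \<noteq> p" "z \<noteq> q" "adj p z \<or> adj q z" using nie[OF pq(3)] by blast
    have zV: "z \<in> V" using z(3) adj_V by blast
    have zO: "z \<notin> Q" using z OO[of z p] OO[of z q] pq adj_sym by (auto simp: Q_def)
    obtain r where r: "r \<in> {p, q}" "adj r z" using z(3) by blast
    have "{r, z} \<in> touch W" "{p, q} \<in> touch W" "EO \<subseteq> touch W"
      using r pq qp by (auto simp: touch_def adj_of_def EO_def Q_def)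
    moreover have "{r, z} \<notin> EO" "{p, q} \<notin> EO" using r zO by (auto simp: EO_def Q_def)
    moreover have "{r, z} \<noteq> {p, q}" using z by (auto simp: doubleton_eq_iff)
    moreover have "finite (touch W)" using finite_edges by (simp add: touch_def)
    ultimately have "card (insert {r, z} (insert {p, q} EO)) \<le> card (touch W)" by (intro card_mono) auto
    then show ?thesis using fE \<open>{r, z} \<notin> EO\<close> \<open>{p, q} \<notin> EO\<close> \<open>{r, z} \<noteq> {p, q}\<close> by (simp add: \<eta>_def)
  qed
  \<comment> \<open>Restriction to extensional functions makes the set of gadgets finite.\<close>
  define \<Psi> where "\<Psi> = {\<psi> \<in> W \<rightarrow>\<^sub>E K. emb W adj K hc \<psi>}"
  have f\<Psi>: "finite \<Psi>" unfolding \<Psi>_def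
    by (rule finite_subset[OF _ finite_PiE[OF finite_V_sub[OF WV]], of _ "\<lambda>_. K"]) (use finK in auto)
  define Gd where "Gd = Q \<times> \<Psi> \<times> {..\<eta>}"
  define K' where "K' = Inl ` K \<union> (Inr ` Gd :: ('k + 'a \<times> ('a \<Rightarrow> 'k) \<times> nat) set)"
  have fK': "finite K'" using finK fO f\<Psi> by (simp add: K'_def Gd_def)
  let ?hc = "gadget_host W \<iota>"
  define h0 :: "nat \<Rightarrow> nat \<Rightarrow> unit option" where "h0 = (\<lambda>_ _. None)"
  \<comment> \<open>Only the original core vertices are joined to the outer vertices.\<close>
  let ?h = "join_host (Inl ` K) ?hc h0"
  define m where "m = card K'"
  have main: "rsat (m + N) F \<le> m * (m + N)" if N: "card V + 3 \<le> N" for N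
  proof -
    define U where "U = Cr ` K' \<union> Ou ` {..<N}"
    have cU: "card U = m + N"
      unfolding U_def by (subst card_Un_disjoint) (use fK' in \<open>auto simp: card_image inj_on_def m_def\<close>)
    define CK where "CK = (Cr ` K' :: ('k + 'a \<times> ('a \<Rightarrow> 'k) \<times> nat, nat) join_vertex set)"
    have "rsat (card U) F \<le> m * card U"
    proof (rule host_linear[OF sF, where R = "\<lambda>_. CK"])
      show "finite U" using fK' by (simp add: U_def)
      show "U \<noteq> {}" using N by (auto simp: U_def lessThan_empty_iff)
      show "sym_host ?h" by (rule join_host_sym[OF gadget_host_sym]) (simp add: sym_host_def h0_def)
      show "finite CK \<and> card CK \<le> m" using fK' card_image_le[OF fK'] by (simp add: m_def CK_def)
      show "\<not> emb V adj U ?h f" for f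
      proof
        assume f: "emb V adj U ?h f"
        define W' where "W' = {x \<in> V. \<exists>a. f x = Cr (Inl a)}"
        define \<psi> where "\<psi> x = (case f x of Cr (Inl a) \<Rightarrow> a)" for x
        have fW: "f x = Cr (Inl (\<psi> x))" "x \<in> V" if "x \<in> W'" for x using that by (auto simp: W'_def \<psi>_def)
        have "emb W' adj K hc \<psi>"
        proof (rule embI)
          show "inj_on \<psi> W'" using emb_inj[OF f] fW by (metis inj_onD inj_onI)
          show "\<psi> x \<in> K" if "x \<in> W'" for x using emb_in[OF f, of x] fW[OF that] by (auto simp: U_def K'_def)
          show "hc (\<psi> x) (\<psi> y) \<noteq> None" if "x \<in> W'" "y \<in> W'" "adj x y" for x y
            using emb_edge[OF f fW(2)[OF that(1)] fW(2)[OF that(2)] that(3)] fW(1)[OF that(1)] fW(1)[OF that(2)] by simp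
          show "{x, y} = {x', y'}" if "x \<in> W'" "y \<in> W'" "adj x y" "x' \<in> W'" "y' \<in> W'" "adj x' y'"
            "hc (\<psi> x) (\<psi> y) = hc (\<psi> x') (\<psi> y')" for x y x' y'
            by (rule emb_rb[OF f]) (use that fW in auto)
        qed
        then have cW': "core_hosted W'" using fW(2) by (auto simp: core_hosted_def)
        have gad: "\<exists>a \<psi> i b. f x = Cr (Inr (a, \<psi>, i)) \<and> f y = Cr (Inr (b, \<psi>, i)) \<and> a \<in> Q \<and> b \<in> Q \<and> adj a b \<and> i \<le> \<eta>"
          if xy: "x \<in> V - W'" "y \<in> V - W'" "adj x y" for x y
        proof -
          have e: "?h (f x) (f y) \<noteq> None" using emb_edge[OF f] xy by blast
          have "f x \<in> U" "f y \<in> U" using emb_in[OF f] xy by auto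
          moreover have "\<nexists>a. f x = Cr (Inl a)" "\<nexists>a. f y = Cr (Inl a)" using xy by (auto simp: W'_def)
          ultimately have "f x \<in> Cr ` Inr ` Gd \<union> Ou ` {..<N}" "f y \<in> Cr ` Inr ` Gd \<union> Ou ` {..<N}"
            by (auto simp: U_def K'_def)
          then show ?thesis using e by (auto simp: h0_def Gd_def split: if_splits)
        qed
        have "matching (V - W')"
          unfolding matching_def
        proof (intro ballI impI)
          fix x y z assume xyz: "x \<in> V - W'" "y \<in> V - W'" "z \<in> V - W'" "adj x y" "adj x z"
          obtain a \<psi> i b where 1: "f x = Cr (Inr (a, \<psi>, i))" "f y = Cr (Inr (b, \<psi>, i))" "a \<in> Q" "b \<in> Q" "adj a b"
            using gad[OF xyz(1,2,4)] by blast
          obtain a' \<psi>' i' b' where 2: "f x = Cr (Inr (a', \<psi>', i'))" "f z = Cr (Inr (b', \<psi>', i'))" "b' \<in> Q" "adj a' b'"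
            using gad[OF xyz(1,3,5)] by blast
          have "b = b'" using nb[of a b b'] 1 2 by (auto simp: Q_def)
          then have "f y = f z" using 1 2 by simp
          then show "y = z" using emb_inj[OF f] xyz by (auto simp: inj_on_def)
        qed
        \<comment> \<open>The set \<open>W'\<close> mapped to the original core competes in the
          minimization, so at least \<open>\<eta> + 2\<close> edges would have to share the
          palette.\<close>
        then have "\<eta> + 2 \<le> card (touch W')" using Wmin[OF cW'] big by linarith
        moreover have "card (touch W') \<le> card {..\<eta>}"
        proof -
          have "\<exists>t. t \<le> \<eta> \<and> (\<exists>x y. x \<in> V \<and> y \<in> V \<and> adj x y \<and> e = {x, y} \<and> ?h (f x) (f y) = Some (CC (Inr t)))"
            if e: "e \<in> touch W'" for e
          proof -
            obtain x z where xz: "e \<in> edges F" "x \<in> e" "x \<in> V - W'" "z \<in> V - W'" "adj x z" using e by (auto simp: touch_def)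
            obtain a \<psi> i where g: "f x = Cr (Inr (a, \<psi>, i))" "a \<in> Q" "i \<le> \<eta>" using gad[OF xz(3-5)] by blast
            obtain y where y: "e = {x, y}" "adj x y"
              using simple_edgeE[OF sF xz(1)] xz(2) adj_sym by (metis insertE insert_commute singletonD)
            have yV: "y \<in> V" using adj_V y by blast
            obtain t where t: "?h (f x) (f y) = Some t" using emb_edge[OF f _ yV y(2)] xz(3) by auto
            have "f y \<in> U" using emb_in[OF f yV] .
            then have "\<exists>w. adj w a \<and> t = CC (Inr (skip i (\<iota> {w, a})))"
              using t g by (auto simp: U_def K'_def insert_commute adj_comm[of a] split: if_splits)
            then have "\<exists>s. s \<in> EO \<and> t = CC (Inr (skip i (\<iota> s)))" using EOI g(2) by blast
            then show ?thesis using \<iota>lt skip_le t y xz(3) yV by blast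
          qed
          then obtain \<gamma> where \<gamma>: "\<And>e. e \<in> touch W' \<Longrightarrow> \<gamma> e \<le> \<eta> \<and>
              (\<exists>x y. x \<in> V \<and> y \<in> V \<and> adj x y \<and> e = {x, y} \<and> ?h (f x) (f y) = Some (CC (Inr (\<gamma> e))))"
            by metis
          show ?thesis
          proof (rule card_inj_on_le[of \<gamma>])
            show "inj_on \<gamma> (touch W')"
            proof (rule inj_onI)
              fix e e' assume a: "e \<in> touch W'" "e' \<in> touch W'" "\<gamma> e = \<gamma> e'"
              obtain x y where 1: "x \<in> V" "y \<in> V" "adj x y" "e = {x, y}" "?h (f x) (f y) = Some (CC (Inr (\<gamma> e)))"
                using \<gamma>[OF a(1)] by blast
              obtain x' y' where 2: "x' \<in> V" "y' \<in> V" "adj x' y'" "e' = {x', y'}" "?h (f x') (f y') = Some (CC (Inr (\<gamma> e')))"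
                using \<gamma>[OF a(2)] by blast
              show "e = e'" using emb_rb[OF f 1(1-3) 2(1-3)] 1 2 a(3) by simp
            qed
          qed (use \<gamma> in auto)
        qed
        ultimately show False by simp
      qed
      \<comment> \<open>A join color at \<open>v\<close> is excluded here and treated by exchanging
        \<open>u\<close> and \<open>v\<close>; a join color at \<open>u\<close>, where
        \<open>p\<close> goes, is avoided by rerouting the neighbors of \<open>p\<close>.\<close>
      have good1: "\<exists>f. emb V adj U (recolor ?h (Ou u) (Ou v) c) f"
        if uv: "u < N" "v < N" "u \<noteq> v" and cv: "\<And>a. c \<noteq> CJ a v" for u v c
      proof -
        \<comment> \<open>The color as seen by the original core; colors that do not concern it
          become a dummy.\<close>
        define c' :: "('q, 'k, nat, unit) join_color" where
          "c' = (case c of CC (Inl \<kappa>) \<Rightarrow> CC \<kappa> | CJ (Inl a) t \<Rightarrow> CJ a t | _ \<Rightarrow> CX ())"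
        \<comment> \<open>A palette color is avoided by the gadget that omits it; for any other
          color every index works, and 0 is taken.\<close>
        define i where "i = (case c of CC (Inr t) \<Rightarrow> if t \<le> \<eta> then t else 0 | _ \<Rightarrow> 0)"
        have i\<eta>: "i \<le> \<eta>" by (auto simp: i_def split: join_color.splits sum.splits)
        obtain \<psi>0 where \<psi>0: "emb W adj K hc \<psi>0" "\<And>a t. c' = CJ a t \<Longrightarrow> a \<notin> \<psi>0 ` {w\<in>W. adj p w}"
          "\<And>\<kappa> x y. c' = CC \<kappa> \<Longrightarrow> x \<in> W \<Longrightarrow> y \<in> W \<Longrightarrow> adj x y \<Longrightarrow> hc (\<psi>0 x) (\<psi>0 y) \<noteq> Some \<kappa>"
        proof -
          obtain \<psi>0 where "emb W adj K hc \<psi>0 \<and> (\<forall>a t. c' = CJ a t \<longrightarrow> a \<notin> \<psi>0 ` {w\<in>W. adj p w}) \<and>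
             (\<forall>\<kappa>. c' = CC \<kappa> \<longrightarrow> (\<forall>x\<in>W. \<forall>y\<in>W. adj x y \<longrightarrow> hc (\<psi>0 x) (\<psi>0 y) \<noteq> Some \<kappa>))"
            using leaf_outside_avoid[OF ok cl \<psi>1, of c'] by (elim exE)
          then show thesis by (intro that[of \<psi>0]) simp_all
        qed
        define \<psi> where "\<psi> = restrict \<psi>0 W"
        have \<psi>: "emb W adj K hc \<psi>" unfolding \<psi>_def by (rule emb_restrict[OF \<psi>0(1)])
        have \<psi>eq: "\<psi> x = \<psi>0 x" if "x \<in> W" for x using that by (simp add: \<psi>_def)
        have "\<psi> \<in> \<Psi>" using \<psi> emb_in[OF \<psi>0(1)] by (auto simp: \<Psi>_def \<psi>_def)
        have inv: "inv_into W \<psi> (\<psi> x) = x" if "x \<in> W" for x using emb_inj[OF \<psi>] that by (rule inv_into_f_f)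
        define \<psi>' where "\<psi>' x = (if x \<in> W then Inl (\<psi> x) else Inr (x, \<psi>, i))" for x
        let ?W = "W \<union> Q"
        have OW: "x \<notin> W" if "x \<in> Q" for x using that by (auto simp: Q_def)
        have col: "(x \<in> W \<and> y \<in> W \<and> (\<exists>\<kappa>. hc (\<psi> x) (\<psi> y) = Some \<kappa> \<and> ?hc (\<psi>' x) (\<psi>' y) = Some (Inl \<kappa>))) \<or>
            ({x, y} \<in> EO \<and> ?hc (\<psi>' x) (\<psi>' y) = Some (Inr (skip i (\<iota> {x, y}))))"
          if xy: "x \<in> ?W" "y \<in> ?W" "adj x y" for x y
        proof (cases "x \<in> W \<and> y \<in> W")
          case True
          then show ?thesis using emb_edge[OF \<psi> _ _ xy(3)] by (auto simp: \<psi>'_def)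
        next
          case False
          then have "{x, y} \<in> EO" using EOI[OF xy(3)] xy by blast
          moreover have "?hc (\<psi>' x) (\<psi>' y) = Some (Inr (skip i (\<iota> {x, y})))"
            using False xy adj_comm inv by (auto simp: \<psi>'_def insert_commute)
          ultimately show ?thesis by blast
        qed
        have e\<psi>: "emb ?W adj K' ?hc \<psi>'"
        proof (rule embI)
          show "inj_on \<psi>' ?W"
            using emb_inj[OF \<psi>] OW by (auto simp: inj_on_def \<psi>'_def)
          show "\<psi>' x \<in> K'" if "x \<in> ?W" for x
            using that emb_in[OF \<psi>, of x] OW \<open>\<psi> \<in> \<Psi>\<close> i\<eta> by (auto simp: \<psi>'_def K'_def Gd_def)
          show "?hc (\<psi>' x) (\<psi>' y) \<noteq> None" if "x \<in> ?W" "y \<in> ?W" "adj x y" for x y using col[OF that] by auto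
          show "{x, y} = {x', y'}" if xy: "x \<in> ?W" "y \<in> ?W" "adj x y" and xy': "x' \<in> ?W" "y' \<in> ?W" "adj x' y'"
            and e: "?hc (\<psi>' x) (\<psi>' y) = ?hc (\<psi>' x') (\<psi>' y')" for x y x' y'
            using col[OF xy]
          proof (elim disjE conjE exE)
            fix \<kappa> assume 1: "x \<in> W" "y \<in> W" "hc (\<psi> x) (\<psi> y) = Some \<kappa>" "?hc (\<psi>' x) (\<psi>' y) = Some (Inl \<kappa>)"
            then have "x' \<in> W \<and> y' \<in> W \<and> hc (\<psi> x') (\<psi> y') = Some \<kappa>" using col[OF xy'] e by auto
            then show ?thesis using emb_rb[OF \<psi> 1(1,2) xy(3) _ _ xy'(3)] 1(3) by simp
          next
            assume 1: "{x, y} \<in> EO" "?hc (\<psi>' x) (\<psi>' y) = Some (Inr (skip i (\<iota> {x, y})))"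
            then have 2: "{x', y'} \<in> EO" "skip i (\<iota> {x, y}) = skip i (\<iota> {x', y'})" using col[OF xy'] e by auto
            then have "\<iota> {x, y} = \<iota> {x', y'}" using skip_inj by blast
            then show ?thesis using \<iota> 1 2 by (simp add: bij_betw_def inj_on_def)
          qed
        qed
        \<comment> \<open>The outer end of a join color, which the isolated vertices of
          \<open>V - W\<close> must not occupy. Excluding it together with \<open>u\<close> and
          \<open>v\<close> explains \<open>card V + 3\<close>.\<close>
        define av where "av = (case c of CJ a t \<Rightarrow> t | _ \<Rightarrow> 0)"
        have "card V \<le> card ({..<N} - {u, v, av})"
        proof -
          have "card {u, v, av} \<le> 3" by (simp add: card_insert_if)
          moreover have "card {..<N} - card {u, v, av} \<le> card ({..<N} - {u, v, av})"
            by (rule diff_card_le_card_Diff) simp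
          ultimately show ?thesis using N by simp
        qed
        then obtain \<zeta> where \<zeta>: "inj_on \<zeta> Z" "\<zeta> ` Z \<subseteq> {..<N} - {u, v, av}"
          using inj_on_iff_card_le[OF fZ finite_Diff[OF finite_lessThan], of N "{u, v, av}"] cZ by auto
        define \<phi> where "\<phi> x = (if x = p then u else if x = q then v else \<zeta> x)" for x
        have rest: "V - ?W = {p, q} \<union> Z" "p \<notin> Z" "q \<notin> Z" "Z \<inter> W = {}" "Z \<inter> Q = {}"
        proof -
          show pZ: "p \<notin> Z" "q \<notin> Z" "Z \<inter> W = {}" "Z \<inter> Q = {}" using pq qp by (auto simp: Q_def Z_def)
          have "p \<notin> ?W" "q \<notin> ?W" using pq by (auto simp: Q_def)
          then show "V - ?W = {p, q} \<union> Z" using VW pZ by blast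
        qed
        have redge: "{x, y} = {p, q}" if "x \<in> V - ?W" "y \<in> V - ?W" "adj x y" for x y
        proof -
          have "x \<notin> Z" "y \<notin> Z" using that adj_sym by (auto simp: Z_def)
          then have "x \<in> {p, q}" "y \<in> {p, q}" "x \<noteq> y" using that rest adj_irrefl by auto
          then show ?thesis by auto
        qed
        have \<phi>pq: "\<phi> p = u" "\<phi> q = v" using pqne by (auto simp: \<phi>_def)
        have \<phi>Z: "\<phi> x = \<zeta> x" "\<zeta> x < N" "\<zeta> x \<noteq> u" "\<zeta> x \<noteq> v" "\<zeta> x \<noteq> av" if "x \<in> Z" for x
          using that rest \<zeta>(2) by (auto simp: \<phi>_def)
        have e\<phi>: "emb (V - ?W) adj {..<N} (fresh h0 u v) \<phi>"
        proof (rule embI)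
          show "inj_on \<phi> (V - ?W)"
          proof -
            have "inj_on \<phi> Z" using \<zeta>(1) \<phi>Z(1) by (metis inj_on_cong)
            moreover have "\<phi> z \<noteq> \<phi> p" "\<phi> z \<noteq> \<phi> q" if "z \<in> Z" for z
              using \<phi>Z(1,3,4)[OF that] \<phi>pq by auto
            moreover have "\<phi> p \<noteq> \<phi> q" using \<phi>pq uv(3) by simp
            ultimately show ?thesis unfolding rest(1) by (fastforce simp: inj_on_def)
          qed
          show "\<phi> x \<in> {..<N}" if "x \<in> V - ?W" for x using that \<phi>Z \<phi>pq uv unfolding rest(1) by auto
          show "fresh h0 u v (\<phi> x) (\<phi> y) \<noteq> None" if "x \<in> V - ?W" "y \<in> V - ?W" "adj x y" for x y
          proof -
            have "\<phi> ` {x, y} = \<phi> ` {p, q}" using redge[OF that] by simp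
            then show ?thesis using \<phi>pq by (simp add: fresh_def recolor_def)
          qed
          show "{x, y} = {x', y'}" if "x \<in> V - ?W" "y \<in> V - ?W" "adj x y" "x' \<in> V - ?W" "y' \<in> V - ?W" "adj x' y'" for x y x' y'
            using redge that by simp
        qed
        have OWn: "w \<in> W" if "w \<in> ?W" "y \<in> V - ?W" "adj w y" for w y
          using OO[of w y] that by blast
        show ?thesis
          unfolding U_def
        proof (rule join_emb[OF adj_sym _ e\<psi> e\<phi>])
          show "?W \<subseteq> V" using WV by (auto simp: Q_def)
          show "\<psi>' w \<in> Inl ` K" if "w \<in> ?W" "y \<in> V - ?W" "adj w y" for w y
            using OWn[OF that] emb_in[OF \<psi>] by (simp add: \<psi>'_def)
          show "?hc (\<psi>' x) (\<psi>' y) \<noteq> Some \<kappa>" if c: "c = CC \<kappa>" and xy: "x \<in> ?W" "y \<in> ?W" "adj x y" for \<kappa> x y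
          proof (cases \<kappa>)
            case (Inl \<kappa>')
            then have "c' = CC \<kappa>'" using c by (simp add: c'_def)
            then show ?thesis using col[OF xy] \<psi>0(3)[of \<kappa>' x y] \<psi>eq xy(3) Inl by auto
          next
            case (Inr t)
            then have "i = (if t \<le> \<eta> then t else 0)" using c by (simp add: i_def)
            moreover have "skip i (\<iota> {x, y}) \<noteq> t" if "{x, y} \<in> EO"
              using skip_neq[of i "\<iota> {x, y}"] skip_le[OF \<iota>lt[OF that], of i] calculation by (auto split: if_splits)
            ultimately show ?thesis using col[OF xy] Inr by auto
          qed
          show "\<phi> y \<noteq> t" if c: "c = CJ (\<psi>' w) t" and wy: "w \<in> ?W" "y \<in> V - ?W" "adj w y" for t w y
          proof
            assume eq: "\<phi> y = t"
            have wW: "w \<in> W" using OWn[OF wy] .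
            have c'e: "c' = CJ (\<psi>0 w) t" using c wW \<psi>eq by (simp add: c'_def \<psi>'_def)
            have "av = t" using c by (simp add: av_def)
            consider "y = p" | "y = q" | "y \<in> Z" using wy(2) rest(1) by blast
            then show False
            proof cases
              case 1
              then show ?thesis using \<psi>0(2)[OF c'e] wW wy(3) adj_sym by blast
            next
              case 2
              then have "v = t" using eq \<phi>pq by simp
              then show ?thesis using cv[of "\<psi>' w"] c by simp
            next
              case 3 then show ?thesis using \<phi>Z[OF 3] eq \<open>av = t\<close> by simp
            qed
          qed
        qed (simp_all add: h0_def)
      qed
      show "?h s t = None \<and> good V adj U ?h s t"
        if st: "s \<in> U" "t \<in> U" "s \<noteq> t" "t \<notin> CK" "s \<notin> CK" for s t
      proof -
        obtain u v where uv: "s = Ou u" "t = Ou v" "u < N" "v < N" "u \<noteq> v" using st by (auto simp: U_def CK_def)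
        have "\<exists>f. emb V adj U (recolor ?h s t c) f" for c
        proof (cases "\<exists>a. c = CJ a v")
          case True
          then have "\<And>a. c \<noteq> CJ a u" using uv(5) by auto
          then show ?thesis using good1[of v u c] uv recolor_commute by metis
        next
          case False then show ?thesis using good1[of u v c] uv by blast
        qed
        then show ?thesis using uv by (simp add: good_def h0_def)
      qed
    qed
    then show ?thesis by (simp add: cU)
  qed
  show ?thesis
  proof (rule exI[of _ m], rule exI[of _ "m + card V + 3"], intro allI impI)
    fix n assume n: "m + card V + 3 \<le> n"
    then show "rsat n F \<le> m * n" using main[of "n - m"] by simp
  qed
qed

end


section \<open>Sparse remaining vertices\<close>

lemma relpow_sym:
  assumes "sym S" "(a, b) \<in> S ^^ n" shows "(b, a) \<in> S ^^ n"
  using assms(2)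
proof (induction n arbitrary: b)
  case (Suc n)
  then obtain c where "(a, c) \<in> S ^^ n" "(c, b) \<in> S" by auto
  then show ?case using Suc.IH assms(1) by (meson relpow_Suc_I2 symD)
qed simp

section \<open>Digraphs beside the universal graph; pieces that are trees\<close>

context fgraph begin

fun arc_gamma_host :: "(nat \<times> nat) set \<Rightarrow> (nat + 'a gamma_vertex) \<Rightarrow> (nat + 'a gamma_vertex) \<Rightarrow> (nat + 'a gamma_color) option" where
  "arc_gamma_host L (Inl i) (Inl j) = map_option Inl (arc_host L i j)"
| "arc_gamma_host L (Inr s) (Inr t) = map_option Inr (gamma_host s t)"
| "arc_gamma_host L (Inl i) (Inr t) = None"
| "arc_gamma_host L (Inr s) (Inl j) = None"

lemma arc_gamma_host_sym:
  assumes "\<And>i j. (i, j) \<in> L \<Longrightarrow> (j, i) \<notin> L" shows "sym_host (arc_gamma_host L)"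
  unfolding sym_host_def
proof (intro allI)
  fix s t
  have "arc_host L i j = arc_host L j i" for i j using assms[of i j] by (simp add: arc_host_def)
  moreover have "gamma_host a b = gamma_host b a" for a b by (rule gamma_host_sym)
  ultimately show "arc_gamma_host L s t = arc_gamma_host L t s" by (cases s; cases t) simp_all
qed

text \<open>Imposing the inequality on everything below \<open>B\<close> makes the family downward
  closed, as the selection of pieces demands.\<close>

definition "tree_sets = {B. conn B \<and> (\<forall>B'. conn B' \<longrightarrow> le B' B \<longrightarrow> card (edges_in B') < card B')}"

lemma small_comps_matching:
  assumes c: "\<And>C. C \<in> comps A \<Longrightarrow> finite C \<and> card C \<le> 2"
    and xyz: "x \<in> A" "y \<in> A" "z \<in> A" "adj x y" "adj x z"
  shows "y = z"
proof -
  have C: "comp_of A x \<in> comps A" "x \<in> comp_of A x" using comp_of_in[OF xyz(1)] comp_of_self by auto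
  then have "y \<in> comp_of A x" "z \<in> comp_of A x" using comps_closed[OF C] xyz by auto
  then have sub: "{x, y, z} \<subseteq> comp_of A x" using C(2) by simp
  then have "card {x, y, z} \<le> 2" using c[OF C(1)] card_mono[OF _ sub] by linarith
  moreover have "x \<noteq> y" "x \<noteq> z" using xyz adj_irrefl by auto
  ultimately show "y = z" by (auto simp: card_insert_if split: if_splits)
qed

lemma conn_single: "x \<in> V \<Longrightarrow> conn {x}" by (simp add: conn_def)

text \<open>The leaf \<open>q\<close> adds one vertex and one edge to the tree
  \<open>B - {q}\<close>. A piece below \<open>B\<close> is either lighter, hence in
  \<open>D\<close>, or has the same numbers of vertices and edges as \<open>B\<close>.\<close>

lemma leaf_witness_tree:
  assumes w: "leaf_witness D N L u B f p q" and D: "D \<subseteq> tree_sets" shows "B \<in> tree_sets"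
proof -
  have B: "conn B" "q \<in> B" "p \<in> B" "adj p q" "\<And>y. y \<in> B \<Longrightarrow> adj q y \<Longrightarrow> y = p" "B - {q} \<in> D"
    and min: "\<And>B'. conn B' \<Longrightarrow> le B' B \<Longrightarrow> weight B' < weight B \<Longrightarrow> B' \<in> D"
    using w unfolding leaf_witness_def by blast+
  have fB: "finite B" using conn_fin B(1) by blast
  have "edges_in B \<subseteq> insert {p, q} (edges_in (B - {q}))"
  proof
    fix e assume "e \<in> edges_in B"
    then obtain x y where e: "e = {x, y}" "x \<in> B" "y \<in> B" "adj x y" by (auto simp: edges_in_def)
    show "e \<in> insert {p, q} (edges_in (B - {q}))"
    proof (cases "x = q \<or> y = q")
      case True then show ?thesis using e B(5) adj_sym by auto
    next
      case False then show ?thesis using e by (auto simp: edges_in_def)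
    qed
  qed
  then have "card (edges_in B) \<le> card (insert {p, q} (edges_in (B - {q})))"
    using fB finite_edges_in by (intro card_mono) auto
  also have "\<dots> \<le> card (edges_in (B - {q})) + 1" using fB finite_edges_in by (simp add: card_insert_if)
  finally have 1: "card (edges_in B) \<le> card (edges_in (B - {q})) + 1" .
  have Bq: "B - {q} \<in> tree_sets" using B(6) D by blast
  then have "card (edges_in (B - {q})) < card (B - {q})" using le_refl by (auto simp: tree_sets_def)
  moreover have "card (B - {q}) + 1 = card B" using fB B(2) by (metis Suc_eq_plus1 card.remove)
  ultimately have c: "card (edges_in B) < card B" using 1 by linarith
  have "card (edges_in B') < card B'" if B': "conn B'" "le B' B" for B'
  proof (cases "weight B' < weight B")
    case True
    then have "B' \<in> tree_sets" using min B' D by blast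
    then show ?thesis using le_refl B'(1) by (auto simp: tree_sets_def)
  next
    case False
    then have "weight B' = weight B" using le_weight[OF B'(2) fB] by simp
    then show ?thesis using weight_eq[OF B'(2) fB] c by simp
  qed
  then show ?thesis using B(1) by (simp add: tree_sets_def)
qed

end

section \<open>Joining the core to a sparse digraph\<close>

context rcore begin

definition "core_complements = {V - W |W. core_hosted W}"

text \<open>By the selection, some target lacks only a copy of \<open>B\<close>. The witness at
  \<open>u\<close>, with its leaf moved from \<open>N\<close> to \<open>v\<close>, is this copy; the
  rest of the target goes to the universal graph and \<open>W\<close> to the core. The conditions
  \<open>c1\<close>, \<open>c2\<close> and \<open>c3\<close> exclude the colors that are escaped by
  exchanging the two ends.\<close>

lemma centre_embedding:
  fixes c :: "('q, 'k, nat + 'a gamma_vertex, nat + 'a gamma_color) join_color"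
  assumes ok: core_ok and gs: "gamma_system D P" and D: "D \<subseteq> tree_sets" and P: "fst ` P \<subseteq> tree_sets"
    and sel: "\<And>B. minimal_outside tree_sets D B \<Longrightarrow> \<exists>A\<in>core_complements. \<exists>B'\<in>comps A. B' \<notin> D \<and> le B' B \<and> weight B' = weight B \<and> fits D P (A - B')"
    and w: "leaf_witness D N L u B f p q" and v: "v < N" "v \<notin> f ` (B - {q})"
    and c1: "\<And>t. c = CX (Inl t) \<Longrightarrow> t \<notin> f ` (B - {q})"
    and c2: "\<And>a. c \<noteq> CJ a (Inl v)"
    and c3: "\<And>a i. c = CJ a (Inl i) \<Longrightarrow> i \<in> f ` (B - {q}) \<Longrightarrow> i = u"
  shows "\<exists>g. emb V adj (Cr ` K \<union> Ou ` (Inl ` {..<N} \<union> Inr ` gamma_verts D P))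
    (recolor (join_host K hc (arc_gamma_host L)) (Ou (Inl u)) (Ou (Inl v)) c) g"
proof -
  have B: "conn B" "B \<notin> D" "q \<in> B" "f q = N" "p \<in> B" "f p = u" "adj p q" "\<And>y. y \<in> B \<Longrightarrow> adj q y \<Longrightarrow> y = p"
    and fN: "\<And>x. x \<in> B - {q} \<Longrightarrow> f x < N"
    and min: "\<And>B'. conn B' \<Longrightarrow> le B' B \<Longrightarrow> weight B' < weight B \<Longrightarrow> B' \<in> D"
    and f: "emb B adj UNIV (arc_host (insert (N, u) L)) f"
    using w unfolding leaf_witness_def by blast+
  have BU: "B \<in> tree_sets" by (rule leaf_witness_tree[OF w D])
  then have "minimal_outside tree_sets D B" using B(2) min by (simp add: minimal_outside_def)
  then obtain A B' where A: "A \<in> core_complements" "B' \<in> comps A" "le B' B" "weight B' = weight B" "fits D P (A - B')"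
    using sel by blast
  obtain W \<psi>1 where W: "A = V - W" "W \<subseteq> V" and \<psi>1: "emb W adj K hc \<psi>1"
    using A(1) by (auto simp: core_complements_def core_hosted_def)
  have AV: "A \<subseteq> V" using W by blast
  have cB': "conn B'" and B'A: "B' \<subseteq> A" using comps_conn[OF AV A(2)] comps_sub[OF A(2)] by auto
  have fB: "finite B" using conn_fin B(1) by blast
  obtain g where g: "inj_on g B'" "\<And>x. x \<in> B' \<Longrightarrow> g x \<in> B"
    "\<And>x y. x \<in> B' \<Longrightarrow> y \<in> B' \<Longrightarrow> adj x y \<Longrightarrow> adj (g x) (g y)" using A(3) by (auto simp: le_def)
  \<comment> \<open>Equal weights make \<open>g\<close> onto, so the leaf \<open>q\<close> and its
    neighbor \<open>p\<close> have counterparts in the component \<open>B'\<close> of the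
    target.\<close>
  have gB: "g ` B' = B"
  proof (rule card_subset_eq[OF fB])
    show "g ` B' \<subseteq> B" using g(2) by auto
    show "card (g ` B') = card B" using weight_eq[OF A(3) fB A(4)] g(1) by (simp add: card_image)
  qed
  obtain q' where q': "q' \<in> B'" "g q' = q" using gB B(3) by blast
  obtain p' where p': "p' \<in> B'" "g p' = p" using gB B(5) by blast
  have pq': "p' \<noteq> q'" using p' q' B(7) adj_irrefl by auto
  have leaf: "y = p'" if "y \<in> A" "adj q' y" for y
  proof -
    have yB: "y \<in> B'" using comps_closed[OF A(2) q'(1) that] .
    then have "g y = p" using B(8) g(2,3) q' that(2) by metis
    then show ?thesis using g(1) yB p' by (simp add: inj_on_def)
  qed
  have "adj p' q'"
  proof -
    obtain z where "z \<in> B'" "adj q' z" using conn_nbr[OF cB' q'(1) p'(1)] pq' by auto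
    then show ?thesis using leaf B'A adj_sym by blast
  qed
  have cl: "leaf_outside W p' q'"
    unfolding leaf_outside_def W(1)[symmetric]
  proof (intro conjI ballI impI)
    show "W \<subseteq> V" "p' \<in> A" "q' \<in> A" "adj p' q'" using W p' q' B'A \<open>adj p' q'\<close> by auto
    show "y = p'" if "y \<in> A" "adj q' y" for y using leaf that .
    fix C assume C: "C \<in> comps A"
    have cC: "conn C" using comps_conn[OF AV C] .
    \<comment> \<open>A component of the target lies in \<open>D\<close>, is the copy of
      \<open>B\<close>, or fits a position; in each case it is below a tree.\<close>
    have "\<exists>B0\<in>tree_sets. le C B0"
    proof (cases "C \<in> D")
      case True then show ?thesis using D le_refl by blast
    next
      case CD: False
      show ?thesis
      proof (cases "C = B'")
        case True then show ?thesis using BU A(3) by blast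
      next
        case False
        then have "C \<in> comps (A - B') - D" using comps_minus[OF AV A(2)] C CD by simp
        then obtain pos where "pos C \<in> P" "le C (fst (pos C))" using A(5) by (auto simp: fits_def)
        then show ?thesis using P by auto
      qed
    qed
    then show "card (edges_in C) < card C" using cC by (auto simp: tree_sets_def)
  qed
  define c' :: "('q, 'k, nat + 'a gamma_vertex, unit) join_color" where
    "c' = (case c of CC \<kappa> \<Rightarrow> CC \<kappa> | CJ a t \<Rightarrow> CJ a t | _ \<Rightarrow> CX ())"
  obtain \<psi> where \<psi>: "emb W adj K hc \<psi>" "\<forall>a t. c' = CJ a t \<longrightarrow> a \<notin> \<psi> ` {w\<in>W. adj p' w}"
    "\<forall>\<kappa>. c' = CC \<kappa> \<longrightarrow> (\<forall>x\<in>W. \<forall>y\<in>W. adj x y \<longrightarrow> hc (\<psi> x) (\<psi> y) \<noteq> Some \<kappa>)"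
  proof -
    obtain \<psi> where "emb W adj K hc \<psi> \<and> (\<forall>a t. c' = CJ a t \<longrightarrow> a \<notin> \<psi> ` {w\<in>W. adj p' w}) \<and>
       (\<forall>\<kappa>. c' = CC \<kappa> \<longrightarrow> (\<forall>x\<in>W. \<forall>y\<in>W. adj x y \<longrightarrow> hc (\<psi> x) (\<psi> y) \<noteq> Some \<kappa>))"
      using leaf_outside_avoid[OF ok cl \<psi>1, of c'] by (elim exE)
    then show thesis by (intro that[of \<psi>]) simp_all
  qed
  have AB: "A - B' \<subseteq> V" using AV by blast
  \<comment> \<open>A color threatens the universal graph either through a join to one of its
    vertices or through one of its edges, so avoiding a single vertex or a single color is
    enough.\<close>
  have "\<exists>\<gamma>. emb (A - B') adj (gamma_verts D P) gamma_host \<gamma> \<and> (\<forall>a w. c = CJ a (Inr w) \<longrightarrow> w \<notin> \<gamma> ` (A - B')) \<and>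
      (\<forall>\<kappa>. c = CX (Inr \<kappa>) \<longrightarrow> (\<forall>x\<in>A-B'. \<forall>y\<in>A-B'. adj x y \<longrightarrow> gamma_host (\<gamma> x) (\<gamma> y) \<noteq> Some \<kappa>))"
  proof (cases "\<exists>\<kappa>. c = CX (Inr \<kappa>)")
    case True
    then obtain \<kappa> where "c = CX (Inr \<kappa>)" by blast
    then show ?thesis using fits_avoid_color[OF gs AB A(5), of \<kappa>] by simp
  next
    case False
    define w where "w = (case c of CJ a (Inr w) \<Rightarrow> w | _ \<Rightarrow> undefined)"
    have wq: "\<And>a w'. c = CJ a (Inr w') \<Longrightarrow> w' = w" by (simp add: w_def)
    obtain \<gamma> where ge: "emb (A - B') adj (gamma_verts D P) gamma_host \<gamma>" and gw: "w \<notin> \<gamma> ` (A - B')"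
      using fits_avoid_vertex[OF gs AB A(5)] by blast
    show ?thesis
    proof (intro exI[of _ \<gamma>] conjI allI impI)
      show "emb (A - B') adj (gamma_verts D P) gamma_host \<gamma>" by (rule ge)
      show "w' \<notin> \<gamma> ` (A - B')" if "c = CJ a (Inr w')" for a w' using wq[OF that] gw by simp
    qed (use False in blast)
  qed
  then obtain \<gamma> where *: "emb (A - B') adj (gamma_verts D P) gamma_host \<gamma> \<and> (\<forall>a w. c = CJ a (Inr w) \<longrightarrow> w \<notin> \<gamma> ` (A - B')) \<and>
      (\<forall>\<kappa>. c = CX (Inr \<kappa>) \<longrightarrow> (\<forall>x\<in>A-B'. \<forall>y\<in>A-B'. adj x y \<longrightarrow> gamma_host (\<gamma> x) (\<gamma> y) \<noteq> Some \<kappa>))"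
    by (elim exE)
  have \<gamma>: "emb (A - B') adj (gamma_verts D P) gamma_host \<gamma>"
    and \<gamma>J: "\<And>a w. c = CJ a (Inr w) \<Longrightarrow> w \<notin> \<gamma> ` (A - B')"
    and \<gamma>X: "\<And>\<kappa> x y. c = CX (Inr \<kappa>) \<Longrightarrow> x \<in> A - B' \<Longrightarrow> y \<in> A - B' \<Longrightarrow> adj x y \<Longrightarrow> gamma_host (\<gamma> x) (\<gamma> y) \<noteq> Some \<kappa>"
    using * by simp_all
  define \<phi> :: "'a \<Rightarrow> nat + 'a gamma_vertex" where
    "\<phi> x = (if x = q' then Inl v else if x \<in> B' then Inl (f (g x)) else Inr (\<gamma> x))" for x
  have injf: "\<And>x y. x \<in> B \<Longrightarrow> y \<in> B \<Longrightarrow> f x = f y \<Longrightarrow> x = y" using emb_inj[OF f] by (auto simp: inj_on_def)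
  have injg: "\<And>x y. x \<in> B' \<Longrightarrow> y \<in> B' \<Longrightarrow> g x = g y \<Longrightarrow> x = y" using g(1) by (auto simp: inj_on_def)
  have gq: "g x \<in> B - {q}" if "x \<in> B'" "x \<noteq> q'" for x using g(2) injg q' that by auto
  have \<phi>q: "\<phi> q' = Inl v" by (simp add: \<phi>_def)
  have \<phi>p: "\<phi> p' = Inl u" using pq' p' B(6) by (simp add: \<phi>_def)
  have \<phi>B: "\<phi> x = Inl (f (g x))" "f (g x) \<in> f ` (B - {q})" "f (g x) \<noteq> v" if "x \<in> B'" "x \<noteq> q'" for x
    using that gq[OF that] v(2) by (auto simp: \<phi>_def)
  have \<phi>A: "\<phi> x = Inr (\<gamma> x)" if "x \<in> A - B'" for x using that q' by (auto simp: \<phi>_def)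
  let ?hx = "arc_gamma_host L"
  let ?F = "fresh ?hx (Inl u) (Inl v)"
  have key: "({x, y} = {p', q'} \<and> {\<phi> x, \<phi> y} = {Inl u, Inl v} \<and> ?F (\<phi> x) (\<phi> y) = Some None)
      \<or> (x \<in> B' \<and> y \<in> B' \<and> x \<noteq> q' \<and> y \<noteq> q' \<and> (\<exists>t. t \<in> f ` (B - {q}) \<and> ?F (\<phi> x) (\<phi> y) = Some (Some (Inl t))
          \<and> ?hx (\<phi> x) (\<phi> y) = Some (Inl t) \<and> arc_host (insert (N, u) L) (f (g x)) (f (g y)) = Some t))
      \<or> (x \<in> A - B' \<and> y \<in> A - B' \<and> (\<exists>\<kappa>. ?F (\<phi> x) (\<phi> y) = Some (Some (Inr \<kappa>))
          \<and> ?hx (\<phi> x) (\<phi> y) = Some (Inr \<kappa>) \<and> gamma_host (\<gamma> x) (\<gamma> y) = Some \<kappa>))"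
    if xy: "x \<in> A" "y \<in> A" "adj x y" for x y
  proof -
    have yx: "adj y x" using xy adj_sym by blast
    have same: "x \<in> B' \<longleftrightarrow> y \<in> B'" using comps_closed[OF A(2) _ xy(2,3)] comps_closed[OF A(2) _ xy(1) yx] by blast
    consider "x = q' \<or> y = q'" | "x \<in> B'" "y \<in> B'" "x \<noteq> q'" "y \<noteq> q'" | "x \<in> A - B'" "y \<in> A - B'"
      using same xy by blast
    then show ?thesis
    proof cases
      case 1
      then have "{x, y} = {p', q'}" using leaf[of x] leaf[of y] xy yx by auto
      moreover then have "\<phi> ` {x, y} = \<phi> ` {p', q'}" by simp
      then have "{\<phi> x, \<phi> y} = {Inl u, Inl v}" using \<phi>p \<phi>q by simp
      ultimately show ?thesis by (simp add: fresh_def recolor_def)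
    next
      case 2
      have e: "arc_host (insert (N, u) L) (f (g x)) (f (g y)) = arc_host L (f (g x)) (f (g y))"
        using fN[OF gq[OF 2(1,3)]] fN[OF gq[OF 2(2,4)]] by (auto simp: arc_host_def)
      obtain t where t: "arc_host (insert (N, u) L) (f (g x)) (f (g y)) = Some t"
        using emb_edge[OF f g(2)[OF 2(1)] g(2)[OF 2(2)] g(3)[OF 2(1,2) xy(3)]] by blast
      have "t = f (g x) \<or> t = f (g y)" using t e by (auto simp: arc_host_def split: if_splits)
      then have tf: "t \<in> f ` (B - {q})" using \<phi>B(2)[OF 2(1,3)] \<phi>B(2)[OF 2(2,4)] by metis
      have h: "?hx (\<phi> x) (\<phi> y) = Some (Inl t)" using t e \<phi>B(1)[OF 2(1,3)] \<phi>B(1)[OF 2(2,4)] by simp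
      have "{\<phi> x, \<phi> y} \<noteq> {Inl u, Inl v}"
        using \<phi>B[OF 2(1,3)] \<phi>B[OF 2(2,4)] by (auto simp: doubleton_eq_iff)
      then have "?F (\<phi> x) (\<phi> y) = Some (Some (Inl t))" using h by (simp add: fresh_def recolor_def)
      then show ?thesis using 2 tf h t by blast
    next
      case 3
      obtain \<kappa> where \<kappa>: "gamma_host (\<gamma> x) (\<gamma> y) = Some \<kappa>" using emb_edge[OF \<gamma> 3 xy(3)] by blast
      then have h: "?hx (\<phi> x) (\<phi> y) = Some (Inr \<kappa>)" using \<phi>A 3 by simp
      have "{\<phi> x, \<phi> y} \<noteq> {Inl u, Inl v}" using \<phi>A 3 by (auto simp: doubleton_eq_iff)
      then have "?F (\<phi> x) (\<phi> y) = Some (Some (Inr \<kappa>))" using h by (simp add: fresh_def recolor_def)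
      then show ?thesis using 3 \<kappa> h by blast
    qed
  qed
  have e\<phi>: "emb A adj (Inl ` {..<N} \<union> Inr ` gamma_verts D P) ?F \<phi>"
  proof (rule embI)
    show "inj_on \<phi> A"
    proof (rule inj_onI)
      fix x y assume xy: "x \<in> A" "y \<in> A" "\<phi> x = \<phi> y"
      show "x = y"
      proof (cases "x \<in> B'")
        case xB: True
        then have yB: "y \<in> B'" using xy \<phi>A[of y] \<phi>q \<phi>B(1)[of x] by (metis DiffI sum.distinct(1))
        show ?thesis
        proof (cases "x = q' \<or> y = q'")
          case True then show ?thesis using \<phi>q \<phi>B[OF xB] \<phi>B[OF yB] xy(3) by (metis sum.inject(1))
        next
          case False
          then have "f (g x) = f (g y)" using xy(3) \<phi>B(1)[OF xB] \<phi>B(1)[OF yB] by simp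
          then show ?thesis using injf injg g(2) xB yB by metis
        qed
      next
        case False
        then have y: "y \<notin> B'" using xy \<phi>A[of x] \<phi>q \<phi>B(1)[of y] by (metis DiffI sum.distinct(1))
        then have "\<gamma> x = \<gamma> y" using xy False \<phi>A by simp
        then show ?thesis using emb_inj[OF \<gamma>] xy False y by (simp add: inj_on_def)
      qed
    qed
    show "\<phi> x \<in> Inl ` {..<N} \<union> Inr ` gamma_verts D P" if x: "x \<in> A" for x
      using \<phi>q v(1) \<phi>B(1)[of x] fN[OF gq[of x]] \<phi>A[of x] emb_in[OF \<gamma>, of x] x
      by (cases "x = q'"; cases "x \<in> B'") auto
    show "?F (\<phi> x) (\<phi> y) \<noteq> None" if "x \<in> A" "y \<in> A" "adj x y" for x y using key[OF that] by auto
    show "{x, y} = {x', y'}" if xy: "x \<in> A" "y \<in> A" "adj x y" and xy': "x' \<in> A" "y' \<in> A" "adj x' y'"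
      and e: "?F (\<phi> x) (\<phi> y) = ?F (\<phi> x') (\<phi> y')" for x y x' y'
      using key[OF xy]
    proof (elim disjE conjE exE)
      assume "{x, y} = {p', q'}" "?F (\<phi> x) (\<phi> y) = Some None"
      then show ?thesis using key[OF xy'] e by auto
    next
      fix t assume 1: "x \<in> B'" "y \<in> B'" "?F (\<phi> x) (\<phi> y) = Some (Some (Inl t))"
        "arc_host (insert (N, u) L) (f (g x)) (f (g y)) = Some t"
      have 2: "x' \<in> B'" "y' \<in> B'" "arc_host (insert (N, u) L) (f (g x')) (f (g y')) = Some t"
        using key[OF xy'] e 1(3) by auto
      have "{g x, g y} = {g x', g y'}"
        using emb_rb[OF f g(2)[OF 1(1)] g(2)[OF 1(2)] g(3)[OF 1(1,2) xy(3)]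
            g(2)[OF 2(1)] g(2)[OF 2(2)] g(3)[OF 2(1,2) xy'(3)]] 1 2 by simp
      then show ?thesis using injg 1 2 by (metis doubleton_eq_iff)
    next
      fix \<kappa> assume 1: "x \<in> A - B'" "y \<in> A - B'" "?F (\<phi> x) (\<phi> y) = Some (Some (Inr \<kappa>))" "gamma_host (\<gamma> x) (\<gamma> y) = Some \<kappa>"
      have 2: "x' \<in> A - B'" "y' \<in> A - B'" "gamma_host (\<gamma> x') (\<gamma> y') = Some \<kappa>"
        using key[OF xy'] e 1(3) by auto
      then show ?thesis using emb_rb[OF \<gamma> 1(1,2) xy(3) 2(1,2) xy'(3)] 1 by simp
    qed
  qed
  show ?thesis
  proof (rule join_emb[OF adj_sym W(2) \<psi>(1), where \<phi> = \<phi>])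
    show "emb (V - W) adj (Inl ` {..<N} \<union> Inr ` gamma_verts D P) ?F \<phi>" using e\<phi> W(1) by simp
    show "\<psi> w \<in> K" if "w \<in> W" for w using emb_in[OF \<psi>(1) that] .
    show "hc (\<psi> x) (\<psi> y) \<noteq> Some \<kappa>" if "c = CC \<kappa>" "x \<in> W" "y \<in> W" "adj x y" for \<kappa> x y
      using \<psi>(3) that by (simp add: c'_def)
    show "\<phi> y \<noteq> t" if c: "c = CJ (\<psi> w) t" and wy: "w \<in> W" "y \<in> V - W" "adj w y" for t w y
    proof
      assume eq: "\<phi> y = t"
      consider "y = q'" | "y \<in> B'" "y \<noteq> q'" | "y \<in> A - B'" using wy(2) W(1) by blast
      then show False
      proof cases
        case 1 then show ?thesis using c2[of "\<psi> w"] c eq \<phi>q by simp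
      next
        case 2
        then have "f (g y) = u" using c3[of "\<psi> w" "f (g y)"] c eq \<phi>B[OF 2] by simp
        then have "y = p'" using injf[of "g y" p] injg[OF 2(1) p'(1)] g(2)[OF 2(1)] B(5,6) p'(2) by simp
        moreover have "\<psi> w \<notin> \<psi> ` {w\<in>W. adj p' w}" using \<psi>(2) c by (simp add: c'_def)
        ultimately show ?thesis using wy adj_sym by blast
      next
        case 3 then show ?thesis using \<gamma>J[of "\<psi> w" "\<gamma> y"] c eq \<phi>A by simp
      qed
    qed
    show "{\<phi> x, \<phi> y} = {Inl u, Inl v}"
      if c: "c = CX \<xi>" and xy: "x \<in> V - W" "y \<in> V - W" "adj x y" "?hx (\<phi> x) (\<phi> y) = Some \<xi>" for \<xi> x y
      using key[of x y] xy W(1) c c1 \<gamma>X by auto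
  qed
qed

theorem linear_no_matching:
  assumes ok: core_ok and nm: "\<And>W. core_hosted W \<Longrightarrow> \<not> matching (V - W)"
    and ex: "\<exists>W z. core_hosted W \<and> z \<in> V - W \<and> (\<forall>x\<in>V - W. \<forall>y\<in>V - W. adj x y \<longrightarrow> x = z \<or> y = z)"
  shows "\<exists>c n0. \<forall>n\<ge>n0. rsat n F \<le> c * n"
proof -
  define D1 where "D1 = {B. conn B \<and> card B \<le> 2}"
  have D1: "B' \<in> D1" if "B \<in> D1" "conn B'" "le B' B" for B B'
    using that le_card(1)[OF that(3)] conn_fin[of B] by (auto simp: D1_def)
  have D1U: "D1 \<subseteq> tree_sets"
  proof
    fix B assume B: "B \<in> D1"
    have "card (edges_in B') < card B'" if "conn B'" "le B' B" for B'
      using D1[OF B that] small_tree by (simp add: D1_def)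
    then show "B \<in> tree_sets" using B by (simp add: D1_def tree_sets_def)
  qed
  have core_complements: "A \<subseteq> V" "\<not> comps A \<subseteq> D1" if A: "A \<in> core_complements" for A
  proof -
    show AV: "A \<subseteq> V" using A by (auto simp: core_complements_def)
    show "\<not> comps A \<subseteq> D1"
    proof
      assume c: "comps A \<subseteq> D1"
      have "matching A"
        unfolding matching_def
        by (intro ballI impI, rule small_comps_matching[of A])
          (use c conn_fin in \<open>auto simp: D1_def\<close>)
      then show False using nm A by (auto simp: core_complements_def)
    qed
  qed
  obtain D P where gs: "gamma_system D P" and D: "D1 \<subseteq> D" "D \<subseteq> tree_sets" and P: "fst ` P \<subseteq> tree_sets"
    and nf: "\<And>A. A \<in> core_complements \<Longrightarrow> \<not> fits D P A"
    and sel: "\<And>B. minimal_outside tree_sets D B \<Longrightarrow> \<exists>A\<in>core_complements. \<exists>B'\<in>comps A. B' \<notin> D \<and> le B' B \<and> weight B' = weight B \<and> fits D P (A - B')"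
  proof -
    assume *: "\<And>D P. \<lbrakk>gamma_system D P; D1 \<subseteq> D; D \<subseteq> tree_sets; fst ` P \<subseteq> tree_sets; \<And>A. A \<in> core_complements \<Longrightarrow> \<not> fits D P A;
      \<And>B. minimal_outside tree_sets D B \<Longrightarrow> \<exists>A\<in>core_complements. \<exists>B'\<in>comps A. B' \<notin> D \<and> le B' B \<and> weight B' = weight B \<and> fits D P (A - B')\<rbrakk> \<Longrightarrow> thesis"
    show thesis
    proof (rule select_gamma_system[of tree_sets D1 core_complements])
      show "thesis" if "gamma_system D P" "D1 \<subseteq> D" "D \<subseteq> tree_sets" "fst ` P \<subseteq> tree_sets" "\<And>A. A \<in> core_complements \<Longrightarrow> \<not> fits D P A"
        "\<And>B. minimal_outside tree_sets D B \<Longrightarrow> \<exists>A\<in>core_complements. \<exists>B'\<in>comps A. B' \<notin> D \<and> le B' B \<and> weight B' = weight B \<and> fits D P (A - B')" for D P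
        using that by (rule *)
      show "conn B" if "B \<in> tree_sets" for B using that by (simp add: tree_sets_def)
      show "B' \<in> tree_sets" if "B \<in> tree_sets" "conn B'" "le B' B" for B B' using that le_trans by (auto simp: tree_sets_def)
      show "B \<in> D1" if "B \<in> tree_sets" "card B \<le> 2" for B using that by (simp add: tree_sets_def D1_def)
      show "D1 \<subseteq> tree_sets" "\<And>B B'. B \<in> D1 \<Longrightarrow> conn B' \<Longrightarrow> le B' B \<Longrightarrow> B' \<in> D1"
        "\<And>A. A \<in> core_complements \<Longrightarrow> A \<subseteq> V" "\<And>A. A \<in> core_complements \<Longrightarrow> \<not> comps A \<subseteq> D1"
        by (fact D1U, fact D1, fact core_complements(1), fact core_complements(2))
    qed
  qed
  have single: "{x} \<in> D" if "x \<in> V" for x using conn_single[OF that] D(1) by (auto simp: D1_def)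
  \<comment> \<open>If all components of this complement were in \<open>D\<close>, it would fit
    without any position. A component outside \<open>D\<close> has an edge, because single vertices
    are in \<open>D\<close>, and all its edges pass through \<open>z\<close>.\<close>
  obtain S z where S: "conn S" "z \<in> S" "S \<notin> D" "\<And>x y. x \<in> S \<Longrightarrow> y \<in> S \<Longrightarrow> adj x y \<Longrightarrow> x = z \<or> y = z"
  proof -
    obtain W z where W: "core_hosted W" "z \<in> V - W" and z: "\<And>x y. x \<in> V - W \<Longrightarrow> y \<in> V - W \<Longrightarrow> adj x y \<Longrightarrow> x = z \<or> y = z"
      using ex by blast
    have "V - W \<in> core_complements" using W by (auto simp: core_complements_def)
    moreover have "fits D P (V - W)" if "comps (V - W) \<subseteq> D"
    proof -
      have e: "comps (V - W) - D = {}" using that by blast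
      show ?thesis unfolding fits_def e by simp
    qed
    ultimately have "\<not> comps (V - W) \<subseteq> D" using nf by blast
    then obtain S where S: "S \<in> comps (V - W)" "S \<notin> D" by blast
    have cS: "conn S" "S \<subseteq> V - W" using comps_conn[OF _ S(1)] comps_sub[OF S(1)] by auto
    have "\<exists>x\<in>S. \<exists>y\<in>S. adj x y"
      using conn_no_edge_single[OF cS(1)] single S(2) by metis
    then have "z \<in> S" using z cS(2) by blast
    then show thesis using that[OF cS(1) _ S(2)] z cS(2) by blast
  qed
  define k where "k = card V"
  \<comment> \<open>The sum of the bounds \<open>k\<close> on indegrees and \<open>3 * k + 1\<close>
    on outdegrees.\<close>
  define d where "d = 4 * k + 1"
  \<comment> \<open>Witnesses reach at most \<open>k * k\<close> steps from their centers, so a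
    distance above \<open>2 * (k * k)\<close> makes two of them disjoint; the summand 1 keeps
    \<open>T\<close> positive, which rules out adjacent pairs.\<close>
  define T where "T = 2 * (k * k) + 1"
  define G where "G = gamma_verts D P"
  have fG: "finite G" unfolding G_def by (rule finite_gamma_verts[OF gs])
  define r where "r = card K + card G + (2 * k + 1) + (d + 1) ^ T"
  define m where "m = card K + card G"
  have main: "rsat (m + N) F \<le> r * (m + N)" if N: "0 < N" for N
  proof -
    obtain L where ok': "arcs_ok D N L" and ind: "\<And>u. card {v. (v, u) \<in> L} \<le> k"
      and outd: "\<And>v. card {u. (v, u) \<in> L} \<le> 3 * k + 1"
      and unsat: "card {u. u < N \<and> \<not> arc_saturated D N L u} \<le> 2 * k + 1"
    proof -
      have "\<exists>L. arcs_ok D N L \<and> (\<forall>u. card {v. (v, u) \<in> L} \<le> k) \<and> (\<forall>v. card {u. (v, u) \<in> L} \<le> 3 * k + 1) \<and>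
          card {u. u < N \<and> \<not> arc_saturated D N L u} \<le> 2 * k + 1"
      proof (rule extremal_arcs[OF _ S(1-3), of N])
        show "{x} \<in> D" if "x \<in> V" for x by (rule single[OF that])
        show "x = z \<or> y = z" if "x \<in> S" "y \<in> S" "adj x y" for x y by (rule S(4)[OF that])
      qed (unfold k_def, intro exI conjI allI, assumption+)
      then show thesis by (elim exE conjE) (rule that, simp_all)
    qed
    have Ls: "L \<subseteq> {..<N} \<times> {..<N}" "\<And>i j. (i, j) \<in> L \<Longrightarrow> (j, i) \<notin> L"
      and LD: "\<And>B f. conn B \<Longrightarrow> emb B adj UNIV (arc_host L) f \<Longrightarrow> B \<in> D" using ok' unfolding arcs_ok_def by blast+
    define Ns where "Ns = {u. u < N \<and> \<not> arc_saturated D N L u}"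
    define E where "E = {(i, j). (i, j) \<in> L \<or> (j, i) \<in> L}"
    have symE: "sym E" by (auto simp: E_def sym_def)
    have deg: "finite {y. (y, w) \<in> E} \<and> card {y. (y, w) \<in> E} \<le> d" for w
    proof -
      have eq: "{y. (y, w) \<in> E} = {y. (y, w) \<in> L} \<union> {y. (w, y) \<in> L}" by (auto simp: E_def)
      have "finite {y. (y, w) \<in> L}" "finite {y. (w, y) \<in> L}"
        by (rule finite_subset[of _ "{..<N}"]; use Ls in auto)+
      then show ?thesis unfolding eq using card_Un_le[of "{y. (y, w) \<in> L}" "{y. (w, y) \<in> L}"] ind[of w] outd[of w]
        by (simp add: d_def)
    qed
    define Ball where "Ball w = {u. \<exists>n\<le>T. (u, w) \<in> E ^^ n}" for w
    have ball: "finite (Ball w)" "card (Ball w) \<le> (d + 1) ^ T" for w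
      using relpow_ball[of E d T w, OF deg] unfolding Ball_def by blast+
    define X where "X = Inl ` {..<N} \<union> Inr ` G"
    define U where "U = (Cr ` K \<union> Ou ` X :: ('k, nat + 'a gamma_vertex) join_vertex set)"
    have fU: "finite U" using finK fG by (simp add: U_def X_def)
    have cU: "card U = m + N"
    proof -
      have cX: "card X = N + card G"
        unfolding X_def by (subst card_Un_disjoint) (use fG in \<open>auto simp: card_image inj_on_def\<close>)
      have "finite X" using fG by (simp add: X_def)
      then show ?thesis
        unfolding U_def by (subst card_Un_disjoint) (use finK cX in \<open>auto simp: card_image inj_on_def m_def\<close>)
    qed
    define Rb :: "('k, nat + 'a gamma_vertex) join_vertex \<Rightarrow> ('k, nat + 'a gamma_vertex) join_vertex set" where
      "Rb s = (case s of Ou (Inl w) \<Rightarrow> Ou ` Inl ` Ball w | _ \<Rightarrow> {})" for s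
    define R :: "('k, nat + 'a gamma_vertex) join_vertex \<Rightarrow> ('k, nat + 'a gamma_vertex) join_vertex set" where
      "R s = Cr ` K \<union> (Ou ` (Inr ` G \<union> Inl ` Ns) \<union> Rb s)" for s
    have fUn: "finite Ns" by (simp add: Ns_def)
    have R: "finite (R s) \<and> card (R s) \<le> r" for s
    proof
      have c3: "finite (Rb s)" "card (Rb s) \<le> (d + 1) ^ T"
        using ball by (auto simp: Rb_def card_image inj_on_def split: join_vertex.splits sum.splits)
      then show "finite (R s)" using finK fG fUn by (simp add: R_def)
      have "card (Inr ` G \<union> Inl ` Ns :: (nat + 'a gamma_vertex) set) \<le> card G + (2 * k + 1)"
        using card_Un_le[of "Inr ` G :: (nat + 'a gamma_vertex) set" "Inl ` Ns :: (nat + 'a gamma_vertex) set"] unsat card_image_le[OF fG, of "Inr :: 'a gamma_vertex \<Rightarrow> nat + 'a gamma_vertex"] card_image_le[OF fUn, of "Inl :: nat \<Rightarrow> nat + 'a gamma_vertex"]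
        unfolding Ns_def by linarith
      moreover have "card (Ou ` (Inr ` G \<union> Inl ` Ns) :: ('k, nat + 'a gamma_vertex) join_vertex set) = card (Inr ` G \<union> Inl ` Ns :: (nat + 'a gamma_vertex) set)"
        by (simp add: card_image inj_on_def)
      moreover have "card (Cr ` K :: ('k, nat + 'a gamma_vertex) join_vertex set) = card K" by (simp add: card_image inj_on_def)
      ultimately show "card (R s) \<le> r"
        unfolding R_def r_def
        using c3(2) card_Un_le[of "Cr ` K" "Ou ` (Inr ` G \<union> Inl ` Ns) \<union> Rb s"]
          card_Un_le[of "Ou ` (Inr ` G \<union> Inl ` Ns)" "Rb s"] by linarith
    qed
    let ?h = "join_host K hc (arc_gamma_host L)"
    have hs: "sym_host ?h" by (rule join_host_sym[OF symhc arc_gamma_host_sym[OF Ls(2)]])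
    have "rsat (card U) F \<le> r * card U"
    proof (rule host_linear[OF sF fU _ hs, where R = R])
      show "U \<noteq> {}" using cU N by auto
      show "\<not> emb V adj U ?h f" for f
      proof
        assume "emb V adj U ?h f"
        then obtain W \<psi> \<phi> where W: "W \<subseteq> V" "emb W adj K hc \<psi>" and \<phi>: "emb (V - W) adj X (arc_gamma_host L) \<phi>"
          unfolding U_def by (rule join_split)
        define A where "A = V - W"
        have "A \<in> core_complements" using W by (auto simp: core_complements_def core_hosted_def A_def)
        have AV: "A \<subseteq> V" by (auto simp: A_def)
        note \<phi> = \<phi>[folded A_def]
        define A1 where "A1 = {x\<in>A. \<exists>i. \<phi> x = Inl i}"
        define A2 where "A2 = {x\<in>A. \<exists>i. \<phi> x = Inr i}"
        define f1 where "f1 x = projl (\<phi> x)" for x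
        define f2 where "f2 x = projr (\<phi> x)" for x
        have A12: "A = A1 \<union> A2" "A1 \<subseteq> A" "A2 \<subseteq> A"
        proof -
          have "(\<exists>i. \<phi> x = Inl i) \<or> (\<exists>i. \<phi> x = Inr i)" for x by (cases "\<phi> x") auto
          then show "A = A1 \<union> A2" unfolding A1_def A2_def by blast
        qed (auto simp: A1_def A2_def)
        have f1: "\<phi> x = Inl (f1 x)" if "x \<in> A1" for x using that by (auto simp: A1_def f1_def)
        have f2: "\<phi> x = Inr (f2 x)" if "x \<in> A2" for x using that by (auto simp: A2_def f2_def)
        have cl1: "y \<in> A1" if "x \<in> A1" "y \<in> A" "adj x y" for x y
          using emb_edge[OF \<phi> _ that(2,3)] that A12 f1[OF that(1)] f2[of y] by (cases "y \<in> A1") auto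
        have cl2: "y \<in> A2" if "x \<in> A2" "y \<in> A" "adj x y" for x y
          using emb_edge[OF \<phi> _ that(2,3)] that A12 f2[OF that(1)] f1[of y] by (cases "y \<in> A2") auto
        have e1: "emb A1 adj UNIV (arc_host L) f1"
        proof (rule embI)
          show "inj_on f1 A1" using emb_inj[OF \<phi>] f1 A12(2) unfolding inj_on_def by (metis subsetD)
          show "arc_host L (f1 x) (f1 y) \<noteq> None" if "x \<in> A1" "y \<in> A1" "adj x y" for x y
            using emb_edge[OF \<phi> _ _ that(3)] that f1[OF that(1)] f1[OF that(2)] A12(2) by auto
          show "{x, y} = {x', y'}" if "x \<in> A1" "y \<in> A1" "adj x y" "x' \<in> A1" "y' \<in> A1" "adj x' y'"
            "arc_host L (f1 x) (f1 y) = arc_host L (f1 x') (f1 y')" for x y x' y'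
            by (rule emb_rb[OF \<phi>]) (use that f1 A12(2) in auto)
        qed simp
        have e2: "emb A2 adj (gamma_verts D P) gamma_host f2"
        proof (rule embI)
          show "inj_on f2 A2" using emb_inj[OF \<phi>] f2 A12(3) unfolding inj_on_def by (metis subsetD)
          show "f2 x \<in> gamma_verts D P" if "x \<in> A2" for x
            using emb_in[OF \<phi>, of x] that f2[OF that] A12(3) by (auto simp: X_def G_def)
          show "gamma_host (f2 x) (f2 y) \<noteq> None" if "x \<in> A2" "y \<in> A2" "adj x y" for x y
            using emb_edge[OF \<phi> _ _ that(3)] that f2[OF that(1)] f2[OF that(2)] A12(3) by auto
          show "{x, y} = {x', y'}" if "x \<in> A2" "y \<in> A2" "adj x y" "x' \<in> A2" "y' \<in> A2" "adj x' y'"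
            "gamma_host (f2 x) (f2 y) = gamma_host (f2 x') (f2 y')" for x y x' y'
            by (rule emb_rb[OF \<phi>]) (use that f2 A12(3) in auto)
        qed
        have "A1 \<subseteq> V" "A2 \<subseteq> V" using A12 AV by auto
        have "comps A1 \<subseteq> D"
        proof
          fix C assume C: "C \<in> comps A1"
          show "C \<in> D" by (rule LD[OF comps_conn[OF \<open>A1 \<subseteq> V\<close> C] emb_mono[OF e1 comps_sub[OF C]]])
        qed
        moreover have "C \<in> comps A1 \<or> C \<in> comps A2" if C: "C \<in> comps A" for C
        proof -
          have "comps A1 \<subseteq> comps A" "comps A2 \<subseteq> comps A"
            by (rule comps_closed_sub[OF A12(2)], fact cl1, rule comps_closed_sub[OF A12(3)], fact cl2)
          moreover obtain x where x: "x \<in> C" using comps_ne[OF C] by blast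
          moreover have "x \<in> A1 \<or> x \<in> A2" using x comps_sub[OF C] A12(1) by blast
          ultimately show ?thesis
            using comps_disj[OF C, of "comp_of A1 x" x] comps_disj[OF C, of "comp_of A2 x" x]
              comp_of_in[of x A1] comp_of_in[of x A2] comp_of_self[of x A1] comp_of_self[of x A2] by auto
        qed
        \<comment> \<open>What lies on the arcs is in \<open>D\<close>, so whether the target fits
          is decided by the part in the universal graph.\<close>
        ultimately have sub: "comps A - D \<subseteq> comps A2 - D" by blast
        have "fits D P A2" by (rule gamma_fits[OF gs \<open>A2 \<subseteq> V\<close> e2])
        then have "fits D P A" unfolding fits_def using sub by (meson inj_on_subset subsetD)
        then show False using nf[OF \<open>A \<in> core_complements\<close>] by blast
      qed
      show "finite (R s) \<and> card (R s) \<le> r" for s by (rule R)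
      show "?h s t = None \<and> good V adj U ?h s t"
        if st: "s \<in> U" "t \<in> U" "s \<noteq> t" "t \<notin> R s" "s \<notin> R t" for s t
      proof -
        have "\<exists>u. s = Ou (Inl u) \<and> u < N \<and> u \<notin> Ns" "\<exists>v. t = Ou (Inl v) \<and> v < N \<and> v \<notin> Ns"
          using st by (auto simp: U_def X_def R_def Rb_def)
        then obtain u v where uv: "s = Ou (Inl u)" "t = Ou (Inl v)" "u < N" "v < N" "u \<notin> Ns" "v \<notin> Ns" by blast
        have "v \<notin> Ball u" using st(4) uv by (auto simp: R_def Rb_def)
        then have nb: "(v, u) \<notin> E ^^ n" if "n \<le> T" for n using that by (auto simp: Ball_def)
        have "arc_host L u v = None"
        proof -
          have "(v, u) \<notin> E" using nb[of 1] by (simp add: T_def)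
          then show ?thesis by (auto simp: E_def arc_host_def)
        qed
        have su: "arc_saturated D N L u" and sv: "arc_saturated D N L v" using uv by (auto simp: Ns_def)
        obtain B f p q where w: "leaf_witness D N L u B f p q" using leaf_witness_exists[OF single ok' uv(3) su] by blast
        obtain B' f' p' q' where w': "leaf_witness D N L v B' f' p' q'" using leaf_witness_exists[OF single ok' uv(4) sv] by blast
        have nu: "\<exists>n\<le>k * k. (u, x) \<in> E ^^ n" if "x \<in> f ` (B - {q})" for x
          using w that unfolding leaf_witness_def E_def k_def by blast
        have nv: "\<exists>n\<le>k * k. (v, x) \<in> E ^^ n" if "x \<in> f' ` (B' - {q'})" for x
          using w' that unfolding leaf_witness_def E_def k_def by blast
        have disj: "x \<notin> f' ` (B' - {q'})" if x: "x \<in> f ` (B - {q})" for x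
        proof
          assume "x \<in> f' ` (B' - {q'})"
          then obtain n n' where n: "n \<le> k * k" "(u, x) \<in> E ^^ n" "n' \<le> k * k" "(v, x) \<in> E ^^ n'"
            using nu[OF x] nv by blast
          have "(v, u) \<in> E ^^ (n' + n)" using n(4) relpow_sym[OF symE n(2)] by (auto simp: relpow_add)
          then show False using nb[of "n' + n"] n by (simp add: T_def)
        qed
        have "u \<in> f ` (B - {q})" "v \<in> f' ` (B' - {q'})"
        proof -
          have "p \<in> B" "f p = u" "adj p q" "p' \<in> B'" "f' p' = v" "adj p' q'" using w w' unfolding leaf_witness_def by blast+
          moreover have "p \<noteq> q" "p' \<noteq> q'" using calculation adj_irrefl by auto
          ultimately show "u \<in> f ` (B - {q})" "v \<in> f' ` (B' - {q'})" by blast+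
        qed
        then have vu: "v \<notin> f ` (B - {q})" "u \<notin> f' ` (B' - {q'})" using disj by blast+
        have "\<exists>g. emb V adj U (recolor ?h s t c) g" for c
        proof (cases "(\<forall>t. c = CX (Inl t) \<longrightarrow> t \<notin> f ` (B - {q})) \<and> (\<forall>a. c \<noteq> CJ a (Inl v)) \<and>
            (\<forall>a i. c = CJ a (Inl i) \<longrightarrow> i \<in> f ` (B - {q}) \<longrightarrow> i = u)")
          case True
          have "\<exists>g. emb V adj (Cr ` K \<union> Ou ` (Inl ` {..<N} \<union> Inr ` gamma_verts D P))
             (recolor (join_host K hc (arc_gamma_host L)) (Ou (Inl u)) (Ou (Inl v)) c) g"
            by (rule centre_embedding[OF ok gs D(2) P sel w uv(4) vu(1)]) (use True in auto)
          then show ?thesis by (simp add: U_def X_def G_def uv)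
        next
          \<comment> \<open>Now \<open>c\<close> is tied to the witness at \<open>u\<close> or is a
            join color at \<open>v\<close>. The witness at \<open>v\<close> is disjoint from the one
            at \<open>u\<close>, so the exchanged embedding meets all three conditions.\<close>
          case False
          have "\<exists>g. emb V adj (Cr ` K \<union> Ou ` (Inl ` {..<N} \<union> Inr ` gamma_verts D P))
             (recolor (join_host K hc (arc_gamma_host L)) (Ou (Inl v)) (Ou (Inl u)) c) g"
          proof (rule centre_embedding[OF ok gs D(2) P sel w' uv(3) vu(2)])
            show "t \<notin> f' ` (B' - {q'})" if "c = CX (Inl t)" for t using False that disj by auto
            show "c \<noteq> CJ a (Inl u)" for a using False \<open>u \<in> f ` (B - {q})\<close> st(3) uv(1,2) by auto
            show "i = v" if "c = CJ a (Inl i)" "i \<in> f' ` (B' - {q'})" for a i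
              using False that disj by auto
          qed
          then show ?thesis using recolor_commute[of ?h s t c] by (simp add: U_def X_def G_def uv)
        qed
        then show ?thesis using \<open>arc_host L u v = None\<close> uv by (simp add: good_def)
      qed
    qed
    then show ?thesis by (simp add: cU)
  qed
  show ?thesis
  proof (rule exI[of _ r], rule exI[of _ "m + 1"], intro allI impI)
    fix n assume n: "m + 1 \<le> n"
    then show "rsat n F \<le> r * n" using main[of "n - m"] by simp
  qed
qed

theorem linear_core:
  assumes ok: core_ok
    and ex: "\<exists>W. core_hosted W \<and> (matching (V - W) \<or> (\<exists>z\<in>V - W. \<forall>x\<in>V - W. \<forall>y\<in>V - W. adj x y \<longrightarrow> x = z \<or> y = z))"
  shows "\<exists>c n0. \<forall>n\<ge>n0. rsat n F \<le> c * n"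
proof (cases "\<exists>W. core_hosted W \<and> matching (V - W)")
  case True then show ?thesis by (rule linear_matching[OF ok])
next
  case False then show ?thesis using linear_no_matching[OF ok] ex by blast
qed

end

section \<open>The core method for an arbitrary finite core\<close>

context rgraph begin

text \<open>The requirements on the core are spelled out, so that the concrete cores below, over
  different vertex types, need not interpret the locale.\<close>

theorem core_linear:
  fixes K :: "'k set" and hc :: "'k \<Rightarrow> 'k \<Rightarrow> 'q option"
  assumes K: "finite K" "sym_host hc"
    and P1: "\<And>W \<psi>. W \<subseteq> V \<Longrightarrow> emb W adj K hc \<psi> \<Longrightarrow> \<exists>x\<in>V - W. \<exists>y\<in>V - W. adj x y"
    and P2: "W0 \<subseteq> V" "emb W0 adj K hc \<psi>0"
      "(\<forall>x\<in>V - W0. \<forall>y\<in>V - W0. \<forall>z\<in>V - W0. adj x y \<longrightarrow> adj x z \<longrightarrow> y = z) \<or>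
       (\<exists>z\<in>V - W0. \<forall>x\<in>V - W0. \<forall>y\<in>V - W0. adj x y \<longrightarrow> x = z \<or> y = z)"
    and P3: "\<And>W p q \<psi> a. leaf_outside W p q \<Longrightarrow> emb W adj K hc \<psi> \<Longrightarrow> \<exists>\<psi>. emb W adj K hc \<psi> \<and> a \<notin> \<psi> ` {w\<in>W. adj p w}"
      "\<And>W p q \<psi> \<kappa>. leaf_outside W p q \<Longrightarrow> emb W adj K hc \<psi> \<Longrightarrow>
         \<exists>\<psi>. emb W adj K hc \<psi> \<and> (\<forall>x\<in>W. \<forall>y\<in>W. adj x y \<longrightarrow> hc (\<psi> x) (\<psi> y) \<noteq> Some \<kappa>)"
  shows "\<exists>c n0. \<forall>n\<ge>n0. rsat n F \<le> c * n"
proof -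
  interpret C: rcore F K hc
    by unfold_locales (fact K)+
  have ok: C.core_ok
    unfolding C.core_ok_def
  proof (intro conjI allI impI)
    show "\<exists>x\<in>V - W. \<exists>y\<in>V - W. adj x y" if "W \<subseteq> V" "emb W adj K hc \<psi>" for W \<psi> by (rule P1[OF that])
    show "\<exists>\<psi>. emb W adj K hc \<psi> \<and> a \<notin> \<psi> ` {w\<in>W. adj p w}" if "leaf_outside W p q" "emb W adj K hc \<psi>" for W p q \<psi> a
      by (rule P3(1)[OF that])
    show "\<exists>\<psi>. emb W adj K hc \<psi> \<and> (\<forall>x\<in>W. \<forall>y\<in>W. adj x y \<longrightarrow> hc (\<psi> x) (\<psi> y) \<noteq> Some \<kappa>)"
      if "leaf_outside W p q" "emb W adj K hc \<psi>" for W p q \<psi> \<kappa> by (rule P3(2)[OF that])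
  qed
  have cl: "C.core_hosted W0" using P2(1,2) unfolding C.core_hosted_def by blast
  show ?thesis
    by (rule C.linear_core[OF ok], rule exI[of _ W0], unfold C.matching_def, rule conjI, rule cl, rule P2(3))
qed

end


section \<open>Choice of the core\<close>

lemma bij_one:
  assumes "finite A" "finite B" "card A = card B" "x \<in> A" "y \<in> B"
  obtains g where "bij_betw g A B" "g x = y"
proof -
  have "card (A - {x}) = card (B - {y})" using assms by simp
  then obtain g where g: "bij_betw g (A - {x}) (B - {y})"
    using finite_same_card_bij[of "A - {x}" "B - {y}"] assms by auto
  define g' where "g' = g(x := y)"
  have "bij_betw g' (A - {x} \<union> {x}) (B - {y} \<union> {y})"
  proof (rule bij_betw_combine)
    show "bij_betw g' (A - {x}) (B - {y})" using g by (rule bij_betw_cong[THEN iffD1, rotated]) (auto simp: g'_def)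
    show "bij_betw g' {x} {y}" by (auto simp: bij_betw_def g'_def)
  qed auto
  moreover have "A - {x} \<union> {x} = A" "B - {y} \<union> {y} = B" using assms by auto
  ultimately show thesis using that[of g'] by (simp add: g'_def)
qed

context fgraph begin

text \<open>Double counting of incidences; it will show that a component without leaves is not a
  tree.\<close>

lemma min_deg_edges:
  assumes C: "finite C" and two: "\<And>x. x \<in> C \<Longrightarrow> \<exists>y\<in>C. \<exists>z\<in>C. y \<noteq> z \<and> adj x y \<and> adj x z"
  shows "card C \<le> card (edges_in C)"
proof -
  have fE: "finite (edges_in C)" by (rule finite_edges_in[OF C])
  have "(\<Sum>x\<in>C. card {e\<in>edges_in C. x \<in> e}) = (\<Sum>e\<in>edges_in C. 2)"
  proof (rule sum_multicount_gen[OF C fE], rule ballI)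
    fix e assume "e \<in> edges_in C"
    then obtain x y where xy: "e = {x, y}" "x \<in> C" "y \<in> C" "adj x y" by (auto simp: edges_in_def)
    then have "{i \<in> C. i \<in> e} = {x, y}" "x \<noteq> y" using adj_irrefl by auto
    then show "card {i \<in> C. i \<in> e} = 2" by simp
  qed
  moreover have "(\<Sum>x\<in>C. 2) \<le> (\<Sum>x\<in>C. card {e\<in>edges_in C. x \<in> e})"
  proof (rule sum_mono)
    fix x assume x: "x \<in> C"
    obtain y z where yz: "y \<in> C" "z \<in> C" "y \<noteq> z" "adj x y" "adj x z" using two[OF x] by blast
    have "{{x, y}, {x, z}} \<subseteq> {e\<in>edges_in C. x \<in> e}" using x yz by (auto simp: edges_in_def)
    moreover have "card {{x, y}, {x, z}} = 2" using yz by (simp add: doubleton_eq_iff)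
    ultimately show "2 \<le> card {e\<in>edges_in C. x \<in> e}" using card_mono[of "{e\<in>edges_in C. x \<in> e}" "{{x, y}, {x, z}}"] fE by simp
  qed
  ultimately show ?thesis by simp
qed

end

section \<open>The three kinds of cores\<close>

context rgraph begin

definition "indep A \<longleftrightarrow> (\<forall>x\<in>A. \<forall>y\<in>A. \<not> adj x y)"

text \<open>For universal graphs the rerouting conditions follow from
  \<open>fits_avoid_vertex\<close> and \<open>fits_avoid_color\<close>; only the choice of pieces
  and positions remains.\<close>

lemma gamma_core:
  assumes gs: "gamma_system D P" and P1: "\<And>W. W \<subseteq> V \<Longrightarrow> fits D P W \<Longrightarrow> \<not> indep (V - W)"
    and P2: "W0 \<subseteq> V" "fits D P W0"
      "(\<forall>x\<in>V - W0. \<forall>y\<in>V - W0. \<forall>z\<in>V - W0. adj x y \<longrightarrow> adj x z \<longrightarrow> y = z) \<or>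
       (\<exists>z\<in>V - W0. \<forall>x\<in>V - W0. \<forall>y\<in>V - W0. adj x y \<longrightarrow> x = z \<or> y = z)"
  shows "\<exists>c n0. \<forall>n\<ge>n0. rsat n F \<le> c * n"
proof -
  have s: "sym_host gamma_host" using gamma_host_sym by (simp add: sym_host_def)
  obtain \<psi>0 where \<psi>0: "emb W0 adj (gamma_verts D P) gamma_host \<psi>0" using fits_avoid_vertex[OF gs P2(1,2)] by blast
  show ?thesis
  proof (rule core_linear[OF finite_gamma_verts[OF gs] s _ P2(1) \<psi>0 P2(3)])
    show "\<exists>x\<in>V - W. \<exists>y\<in>V - W. adj x y" if "W \<subseteq> V" "emb W adj (gamma_verts D P) gamma_host \<psi>" for W \<psi>
      using P1[OF that(1) gamma_fits[OF gs that]] by (auto simp: indep_def)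
    show "\<exists>\<psi>. emb W adj (gamma_verts D P) gamma_host \<psi> \<and> a \<notin> \<psi> ` {w \<in> W. adj p w}"
      if "leaf_outside W p q" "emb W adj (gamma_verts D P) gamma_host \<psi>" for W p q \<psi> a
    proof -
      have W: "W \<subseteq> V" using that(1) by (simp add: leaf_outside_def)
      show ?thesis using fits_avoid_vertex[OF gs W gamma_fits[OF gs W that(2)], of a] by blast
    qed
    show "\<exists>\<psi>. emb W adj (gamma_verts D P) gamma_host \<psi> \<and> (\<forall>x\<in>W. \<forall>y\<in>W. adj x y \<longrightarrow> gamma_host (\<psi> x) (\<psi> y) \<noteq> Some \<kappa>)"
      if "leaf_outside W p q" "emb W adj (gamma_verts D P) gamma_host \<psi>" for W p q \<psi> \<kappa>
    proof -
      have W: "W \<subseteq> V" using that(1) by (simp add: leaf_outside_def)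
      show ?thesis by (rule fits_avoid_color[OF gs W gamma_fits[OF gs W that(2)]])
    qed
  qed
qed

text \<open>With singletons as pieces and no positions, the core hosts exactly the independent sets.
  Their complements contain edges because \<open>F\<close> is not bipartite, and hosting
  \<open>V - W0\<close> leaves the matching \<open>W0\<close> outside.\<close>

lemma nonbip_matching:
  assumes W0: "W0 \<subseteq> V" "indep (V - W0)" "\<forall>x\<in>W0. \<forall>y\<in>W0. \<forall>z\<in>W0. adj x y \<longrightarrow> adj x z \<longrightarrow> y = z"
    and nb: "\<And>W. W \<subseteq> V \<Longrightarrow> indep W \<Longrightarrow> \<not> indep (V - W)"
  shows "\<exists>c n0. \<forall>n\<ge>n0. rsat n F \<le> c * n"
proof -
  define D where "D = (\<lambda>x. {x}) ` V"
  have gs: "gamma_system D {}"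
    unfolding gamma_system_def
  proof (intro conjI ballI allI impI)
    show "conn B" if "B \<in> D" for B using that conn_single by (auto simp: D_def)
    show "B' \<in> D" if B: "B \<in> D" "conn B'" "le B' B" for B B'
    proof -
      obtain x where x: "B = {x}" using B(1) by (auto simp: D_def)
      have "finite B'" "B' \<noteq> {}" using conn_fin B(2) by (auto simp: conn_def)
      moreover have "card B' \<le> 1" using le_card(1)[OF B(3)] x by simp
      ultimately have "card B' = 1" by (metis card_eq_0_iff le_antisym less_one not_le)
      then obtain y where "B' = {y}" using card_1_singletonE by blast
      then show ?thesis using conn_sub[OF B(2)] by (auto simp: D_def)
    qed
  qed auto
  show ?thesis
  proof (rule gamma_core[OF gs])
    fix W assume W: "W \<subseteq> V" "fits D {} W"
    then have "comps W \<subseteq> D" by (auto simp: fits_def)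
    have "indep W"
      unfolding indep_def
    proof (intro ballI notI)
      fix x y assume xy: "x \<in> W" "y \<in> W" "adj x y"
      have C: "comp_of W x \<in> comps W" "x \<in> comp_of W x" using comp_of_in[OF xy(1)] comp_of_self by auto
      then have "y \<in> comp_of W x" using comps_closed[OF C] xy by auto
      moreover obtain t where "comp_of W x = {t}" using C(1) \<open>comps W \<subseteq> D\<close> by (auto simp: D_def)
      ultimately have "x = y" using C(2) by simp
      then show False using xy adj_irrefl by simp
    qed
    then show "\<not> indep (V - W)" by (rule nb[OF W(1)])
  next
    show "V - W0 \<subseteq> V" by blast
    have "comps (V - W0) - D = {}"
    proof -
      have "C \<in> D" if C: "C \<in> comps (V - W0)" for C
      proof -
        have "conn C" "C \<subseteq> V - W0" using comps_conn[OF _ C] comps_sub[OF C] by auto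
        then show ?thesis using conn_no_edge_single[of C] W0(2) unfolding indep_def D_def by blast
      qed
      then show ?thesis by blast
    qed
    then show "fits D {} (V - W0)" unfolding fits_def by (metis empty_iff inj_on_empty)
    have "V - (V - W0) = W0" using W0(1) by blast
    then show "(\<forall>x\<in>V - (V - W0). \<forall>y\<in>V - (V - W0). \<forall>z\<in>V - (V - W0). adj x y \<longrightarrow> adj x z \<longrightarrow> y = z) \<or>
       (\<exists>z\<in>V - (V - W0). \<forall>x\<in>V - (V - W0). \<forall>y\<in>V - (V - W0). adj x y \<longrightarrow> x = z \<or> y = z)"
      using W0(3) by simp
  qed
qed

text \<open>The targets are the sets with independent complement. Some target fits up to a component
  that is a copy of a lightest missing piece. Deleting just one vertex \<open>z\<close> of this
  component leaves fragments that are lighter and so in \<open>D\<close>, and then all edges outside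
  the core pass through \<open>z\<close>.\<close>

lemma no_matching_core:
  assumes nm: "\<And>W. W \<subseteq> V \<Longrightarrow> indep (V - W) \<Longrightarrow> \<not> (\<forall>x\<in>W. \<forall>y\<in>W. \<forall>z\<in>W. adj x y \<longrightarrow> adj x z \<longrightarrow> y = z)"
  shows "\<exists>c n0. \<forall>n\<ge>n0. rsat n F \<le> c * n"
proof -
  define U where "U = {B. conn B}"
  define D1 where "D1 = {B. conn B \<and> card B \<le> 2}"
  define VV where "VV = {W. W \<subseteq> V \<and> indep (V - W)}"
  have "\<exists>D P. gamma_system D P \<and> (\<forall>A\<in>VV. \<not> fits D P A) \<and>
      (\<forall>B. minimal_outside U D B \<longrightarrow> (\<exists>A\<in>VV. \<exists>B'\<in>comps A. B' \<notin> D \<and> le B' B \<and> weight B' = weight B \<and> fits D P (A - B')))"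
  proof (rule select_gamma_system[of U D1 VV])
    show "\<not> comps A \<subseteq> D1" if "A \<in> VV" for A
    proof
      assume "comps A \<subseteq> D1"
      then have "finite C \<and> card C \<le> 2" if "C \<in> comps A" for C using that conn_fin by (auto simp: D1_def)
      then have "\<forall>x\<in>A. \<forall>y\<in>A. \<forall>z\<in>A. adj x y \<longrightarrow> adj x z \<longrightarrow> y = z" using small_comps_matching by blast
      moreover have "A \<subseteq> V" "indep (V - A)" using \<open>A \<in> VV\<close> by (simp_all add: VV_def)
      ultimately show False using nm[of A] by blast
    qed
    show "B' \<in> D1" if "B \<in> D1" "conn B'" "le B' B" for B B'
      using that le_card(1)[OF that(3)] conn_fin[of B] by (auto simp: D1_def)
  qed (auto simp: U_def D1_def VV_def)
  then obtain D P where gs: "gamma_system D P" and nf: "\<And>A. A \<in> VV \<Longrightarrow> \<not> fits D P A"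
    and sel: "\<And>B. minimal_outside U D B \<Longrightarrow> \<exists>A\<in>VV. \<exists>B'\<in>comps A. B' \<notin> D \<and> le B' B \<and> weight B' = weight B \<and> fits D P (A - B')"
    by (elim exE conjE) blast
  have "V \<in> VV" by (auto simp: VV_def indep_def)
  have "\<exists>B. conn B \<and> B \<notin> D"
  proof (rule ccontr)
    assume "\<nexists>B. conn B \<and> B \<notin> D"
    then have e: "comps V - D = {}" using comps_conn[of V] by blast
    have "fits D P V" unfolding fits_def e by simp
    then show False using nf \<open>V \<in> VV\<close> by blast
  qed
  then obtain B1 where "conn B1 \<and> B1 \<notin> D" by blast
  then obtain B where B: "conn B" "B \<notin> D" and Bmin: "\<And>B'. conn B' \<and> B' \<notin> D \<Longrightarrow> weight B \<le> weight B'"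
    using ex_has_least_nat[of "\<lambda>B. conn B \<and> B \<notin> D" B1 weight] by blast
  have min: "B' \<in> D" if "conn B'" "weight B' < weight B" for B' using Bmin[of B'] that by force
  have "minimal_outside U D B" using B min by (auto simp: minimal_outside_def U_def)
  then obtain A B' where A: "A \<in> VV" "B' \<in> comps A" "B' \<notin> D" "le B' B" "weight B' = weight B" "fits D P (A - B')"
    using sel by blast
  have AV: "A \<subseteq> V" and ind: "indep (V - A)" using A(1) by (auto simp: VV_def)
  have cB': "conn B'" "B' \<subseteq> A" using comps_conn[OF AV A(2)] comps_sub[OF A(2)] by auto
  obtain z where z: "z \<in> B'" using comps_ne[OF A(2)] by blast
  have zA: "z \<in> A" using z cB' by blast
  show ?thesis
  proof (rule gamma_core[OF gs])
    show "\<not> indep (V - W)" if "W \<subseteq> V" "fits D P W" for W using nf[of W] that by (auto simp: VV_def)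
    show "A - {z} \<subseteq> V" using AV by blast
    have "comps (A - {z}) - D \<subseteq> comps (A - B') - D"
    proof
      fix C assume C: "C \<in> comps (A - {z}) - D"
      have "\<not> C \<subseteq> B' - {z}"
      proof
        assume sub: "C \<subseteq> B' - {z}"
        have cC: "conn C" using comps_conn[of "A - {z}" C] C AV by blast
        have fB': "finite B'" using conn_fin cB' by blast
        have "card C < card B'" using sub z fB' by (metis Diff_insert_absorb card_Diff1_less card_mono finite_Diff le_less_trans)
        moreover have "card (edges_in C) \<le> card (edges_in B')" using le_card(2)[OF le_sub fB', of C] sub by blast
        ultimately have "weight C < weight B" using A(5) by (simp add: weight_def)
        then show False using min[OF cC] C by blast
      qed
      then have "C \<in> comps A \<and> C \<noteq> B'" using comps_remove[OF AV A(2) z, of C] C by blast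
      then show "C \<in> comps (A - B') - D" using comps_minus[OF AV A(2)] C by blast
    qed
    then show "fits D P (A - {z})" using A(6) unfolding fits_def by (meson inj_on_subset subsetD)
    have eq: "V - (A - {z}) = insert z (V - A)" using zA AV by blast
    have "\<forall>x\<in>insert z (V - A). \<forall>y\<in>insert z (V - A). adj x y \<longrightarrow> x = z \<or> y = z"
      using ind by (auto simp: indep_def)
    then show "(\<forall>x\<in>V - (A - {z}). \<forall>y\<in>V - (A - {z}). \<forall>za\<in>V - (A - {z}). adj x y \<longrightarrow> adj x za \<longrightarrow> y = za) \<or>
       (\<exists>za\<in>V - (A - {z}). \<forall>x\<in>V - (A - {z}). \<forall>y\<in>V - (A - {z}). adj x y \<longrightarrow> x = za \<or> y = za)"
      unfolding eq by blast
  qed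
qed

text \<open>An edgeless core with one vertex less than a smallest side of a bipartition hosts only
  independent sets too small to be a side. There are no core colors to avoid, and a core vertex is
  avoided by leaving it free or by giving it to a non-neighbor of \<open>p\<close>. The leafless
  component \<open>C\<close> excludes the remaining case that \<open>p\<close> is adjacent to all of
  \<open>W\<close>.\<close>

lemma bipartite_core:
  assumes Ws: "Ws \<subseteq> V" "indep Ws" "indep (V - Ws)"
    and C: "C \<in> comps V" and nl: "\<And>x y. x \<in> C \<Longrightarrow> adj x y \<Longrightarrow> \<exists>z. z \<noteq> y \<and> adj x z"
  shows "\<exists>c n0. \<forall>n\<ge>n0. rsat n F \<le> c * n"
proof -
  define Q where "Q W \<longleftrightarrow> W \<subseteq> V \<and> indep W \<and> indep (V - W)" for W
  have "Q Ws" using Ws by (simp add: Q_def)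
  then obtain Wm where Wm: "Q Wm" and least: "\<And>W. Q W \<Longrightarrow> card Wm \<le> card W"
    using ex_has_least_nat[of Q Ws card] by blast
  have WmV: "Wm \<subseteq> V" "indep Wm" "indep (V - Wm)" using Wm by (auto simp: Q_def)
  have "Wm \<noteq> {}"
  proof
    assume "Wm = {}"
    then have i: "indep V" using WmV by simp
    obtain x where "x \<in> C" using comps_ne[OF C] by blast
    then have "x \<in> V" using comps_sub[OF C] by blast
    then show False using niv[of x] adj_V i unfolding indep_def by blast
  qed
  then obtain z where z: "z \<in> Wm" by blast
  have fWm: "finite Wm" using finite_V_sub WmV(1) by blast
  define s where "s = card Wm - 1"
  have cz: "card (Wm - {z}) = s" and cs: "card Wm = Suc s" using z fWm card_gt_0_iff[of Wm] by (auto simp: s_def)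
  define hc :: "nat \<Rightarrow> nat \<Rightarrow> unit option" where "hc = (\<lambda>_ _. None)"
  have embI0: "emb W adj {..<s} hc \<psi>" if "inj_on \<psi> W" "\<psi> ` W \<subseteq> {..<s}" "indep W" for W \<psi>
    by (rule embI) (use that in \<open>auto simp: indep_def\<close>)
  have embD0: "inj_on \<psi> W" "indep W" "card W \<le> s" if "emb W adj {..<s} hc \<psi>" for W \<psi>
  proof -
    show i: "inj_on \<psi> W" by (rule emb_inj[OF that])
    have "\<not> adj x y" if "x \<in> W" "y \<in> W" for x y
      using emb_edge[OF \<open>emb W adj {..<s} hc \<psi>\<close> that] by (auto simp: hc_def)
    then show "indep W" by (simp add: indep_def)
    have "\<psi> ` W \<subseteq> {..<s}" using emb_in[OF that] by blast
    then have "card W \<le> card {..<s}" by (rule card_inj_on_le[OF i]) simp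
    then show "card W \<le> s" by simp
  qed
  have exinj: "\<exists>\<psi>. emb W adj {..<s} hc \<psi> \<and> \<psi> ` W \<subseteq> S" if fW: "finite W" and S: "S \<subseteq> {..<s}" "card W \<le> card S" and iW: "indep W" for W S
  proof -
    have "finite S" using S(1) finite_subset by blast
    then obtain \<psi> where "inj_on \<psi> W" "\<psi> ` W \<subseteq> S" using inj_on_iff_card_le[OF fW] S(2) by blast
    then show ?thesis using embI0[of \<psi> W] S(1) iW by blast
  qed
  have izm: "indep (Wm - {z})" using WmV(2) by (auto simp: indep_def)
  obtain \<psi>0 where \<psi>0: "emb (Wm - {z}) adj {..<s} hc \<psi>0"
    using exinj[of "Wm - {z}" "{..<s}"] fWm cz izm by auto
  have eq: "V - (Wm - {z}) = insert z (V - Wm)" using z WmV(1) by blast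
  show ?thesis
  proof (rule core_linear[of "{..<s}" hc "Wm - {z}" \<psi>0])
    show "sym_host hc" by (simp add: sym_host_def hc_def)
    show "\<exists>x\<in>V - W. \<exists>y\<in>V - W. adj x y" if W: "W \<subseteq> V" "emb W adj {..<s} hc \<psi>" for W \<psi>
    proof (rule ccontr)
      assume "\<not> ?thesis"
      then have "Q W" using W embD0(2)[OF W(2)] by (auto simp: Q_def indep_def)
      then show False using least[of W] embD0(3)[OF W(2)] cs by simp
    qed
    show "Wm - {z} \<subseteq> V" using WmV by blast
    have "\<forall>x\<in>insert z (V - Wm). \<forall>y\<in>insert z (V - Wm). adj x y \<longrightarrow> x = z \<or> y = z"
      using WmV(3) by (auto simp: indep_def)
    then show "(\<forall>x\<in>V - (Wm - {z}). \<forall>y\<in>V - (Wm - {z}). \<forall>za\<in>V - (Wm - {z}). adj x y \<longrightarrow> adj x za \<longrightarrow> y = za) \<or>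
       (\<exists>za\<in>V - (Wm - {z}). \<forall>x\<in>V - (Wm - {z}). \<forall>y\<in>V - (Wm - {z}). adj x y \<longrightarrow> x = za \<or> y = za)"
      unfolding eq by blast
    show "\<exists>\<psi>. emb W adj {..<s} hc \<psi> \<and> (\<forall>x\<in>W. \<forall>y\<in>W. adj x y \<longrightarrow> hc (\<psi> x) (\<psi> y) \<noteq> Some \<kappa>)"
      if "emb W adj {..<s} hc \<psi>" for W \<psi> \<kappa> using that by (auto simp: hc_def)
    show "\<exists>\<psi>. emb W adj {..<s} hc \<psi> \<and> a \<notin> \<psi> ` {w \<in> W. adj p w}"
      if cl: "leaf_outside W p q" and e: "emb W adj {..<s} hc \<psi>" for W p q \<psi> a
    proof -
      have W: "W \<subseteq> V" "p \<in> V - W" "q \<in> V - W" "adj p q" "\<And>y. y \<in> V - W \<Longrightarrow> adj q y \<Longrightarrow> y = p"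
        "\<And>B. B \<in> comps (V - W) \<Longrightarrow> card (edges_in B) < card B" using cl unfolding leaf_outside_def by blast+
      have fW: "finite W" using finite_V_sub[OF W(1)] .
      consider "a \<notin> {..<s}" | "a < s" "card W < s" | "a < s" "card W = s" "\<exists>w\<in>W. \<not> adj p w"
        | "\<forall>w\<in>W. adj p w" using embD0(3)[OF e] by force
      then show ?thesis
      proof cases
        case 1
        then show ?thesis using e emb_in[OF e] by blast
      next
        case 2
        then have "card W \<le> card ({..<s} - {a})" by simp
        then show ?thesis using exinj[OF fW, of "{..<s} - {a}"] embD0(2)[OF e] by blast
      next
        case 3
        then obtain w0 where w0: "w0 \<in> W" "\<not> adj p w0" by blast
        obtain g where g: "bij_betw g W {..<s}" "g w0 = a"
          using bij_one[OF fW, of "{..<s}" w0 a] 3 w0 by auto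
        have "emb W adj {..<s} hc g" using g embD0(2)[OF e] by (intro embI0) (auto simp: bij_betw_def)
        moreover have "a \<notin> g ` {w \<in> W. adj p w}" using g w0 by (auto simp: bij_betw_def inj_on_def)
        ultimately show ?thesis by blast
      next
        case 4
        have False
        proof (cases "p \<in> C")
          \<comment> \<open>As \<open>C\<close> has no leaves, \<open>q\<close> has a second
            neighbor, which must lie in \<open>W\<close> and is thus adjacent to \<open>p\<close>: a
            triangle in a bipartite graph.\<close>
          case True
          then have "q \<in> C" using comps_closed[OF C True _ W(4)] W(3) by blast
          then obtain y where y: "y \<noteq> p" "adj q y" using nl[of q p] W(4) adj_sym by blast
          then have "y \<in> V" using adj_V by blast
          then have "y \<in> W" using W(5) y by blast
          then have "adj p y" using 4 by blast
          then show False using y(2) W(2,3,4) \<open>y \<in> V\<close> Ws(2,3) unfolding indep_def by blast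
        next
          \<comment> \<open>All of \<open>W\<close> lies in the component of \<open>p\<close>, so
            \<open>C\<close> survives as a component of \<open>V - W\<close>. It would be a tree
            with minimum degree two.\<close>
          case False
          have "w \<notin> W" if "w \<in> C" for w
          proof
            assume "w \<in> W"
            then have "adj w p" using 4 adj_sym by blast
            then show False using comps_closed[OF C that] W(2) False by blast
          qed
          then have CW: "C \<subseteq> V - W" using comps_sub[OF C] by blast
          have cC: "conn C" using comps_conn[OF _ C] by blast
          obtain C' where C': "C' \<in> comps (V - W)" "C \<subseteq> C'" using conn_comp_ex[OF cC CW] by blast
          have "conn C'" "C' \<subseteq> V" using comps_conn[OF _ C'(1)] comps_sub[OF C'(1)] by auto
          then obtain C'' where C'': "C'' \<in> comps V" "C' \<subseteq> C''" using conn_comp_ex by blast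
          obtain x where "x \<in> C" using comps_ne[OF C] by blast
          then have "C = C''" using comps_disj[OF C C''(1)] C' C'' by blast
          then have "C' = C" using C' C'' by blast
          then have lt: "card (edges_in C) < card C" using W(6) C'(1) by blast
          have "card C \<le> card (edges_in C)"
          proof (rule min_deg_edges[OF conn_fin[OF cC]])
            fix x assume x: "x \<in> C"
            then obtain y where y: "adj x y" using niv comps_sub[OF C] by blast
            obtain y' where y': "y' \<noteq> y" "adj x y'" using nl[OF x y] by blast
            have "y \<in> C" "y' \<in> C" using comps_closed[OF C x] y y' adj_V by blast+
            then show "\<exists>y\<in>C. \<exists>z\<in>C. y \<noteq> z \<and> adj x y \<and> adj x z" using y y' by blast
          qed
          then show False using lt by simp
        qed
        then show ?thesis ..
      qed
    qed
  qed (use \<psi>0 in auto)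
qed

text \<open>The leafless component serves the bipartite case, where the edgeless core cannot be
  rerouted by itself; the other two cases start from \<open>F\<close> not being bipartite.\<close>

theorem linear_no_leaf:
  assumes C: "C \<in> comps V" and nl: "\<And>x y. x \<in> C \<Longrightarrow> adj x y \<Longrightarrow> \<exists>z. z \<noteq> y \<and> adj x z"
  shows "\<exists>c n0. \<forall>n\<ge>n0. rsat n F \<le> c * n"
proof (cases "\<exists>W. W \<subseteq> V \<and> indep W \<and> indep (V - W)")
  case True
  then show ?thesis using bipartite_core[OF _ _ _ C nl] by blast
next
  case False
  show ?thesis
  proof (cases "\<exists>W. W \<subseteq> V \<and> indep (V - W) \<and> (\<forall>x\<in>W. \<forall>y\<in>W. \<forall>z\<in>W. adj x y \<longrightarrow> adj x z \<longrightarrow> y = z)")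
    case True
    then show ?thesis using nonbip_matching False by blast
  next
    case False
    then show ?thesis by (intro no_matching_core) blast
  qed
qed

end


section \<open>A largest component with a leaf\<close>

context fgraph begin

text \<open>Blocks of \<open>h\<close> consecutive numbers are rainbow cliques in which an edge is
  its own color. The remaining vertices form gadgets with a common palette, the \<open>j\<close>-th
  of which omits color \<open>j\<close>.\<close>

fun clique_host :: "nat \<Rightarrow> ('a set \<Rightarrow> nat) \<Rightarrow> nat + nat \<times> 'a \<Rightarrow> nat + nat \<times> 'a \<Rightarrow> (nat set + nat) option" where
  "clique_host h \<iota> (Inl i) (Inl j) = (if i \<noteq> j \<and> i div h = j div h then Some (Inl {i, j}) else None)"
| "clique_host h \<iota> (Inr (j, x)) (Inr (k, y)) = (if j = k \<and> adj x y then Some (Inr (skip j (\<iota> {x, y}))) else None)"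
| "clique_host h \<iota> (Inl i) (Inr y) = None"
| "clique_host h \<iota> (Inr x) (Inl j) = None"

lemma clique_host_sym: "sym_host (clique_host h \<iota>)"
  unfolding sym_host_def
proof (intro allI)
  fix s t show "clique_host h \<iota> s t = clique_host h \<iota> t s"
    using adj_comm by (cases s; cases t) (auto simp: insert_commute)
qed

end

lemma block: "0 < h \<Longrightarrow> {i. i div h = t} = {t * h..<t * h + h}" for h t :: nat
proof -
  assume h: "0 < h"
  have "i div h = t \<longleftrightarrow> t * h \<le> i \<and> i < t * h + h" for i
  proof
    assume t: "i div h = t"
    have "t * h + i mod h = i" using div_mult_mod_eq[of i h] unfolding t .
    then show "t * h \<le> i \<and> i < t * h + h"
      using mod_less_divisor[OF h, of i] by (intro conjI; linarith)
  next
    assume "t * h \<le> i \<and> i < t * h + h"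
    then have 1: "h * t \<le> i" "i < h * Suc t" by (simp_all add: mult.commute)
    show "i div h = t" by (rule div_nat_eqI[OF 1])
  qed
  then show ?thesis by (intro set_eqI) (simp only: mem_Collect_eq atLeastLessThan_iff)
qed

section \<open>Cliques and gadgets for a largest component with a leaf\<close>

context rgraph begin

text \<open>A component with \<open>h + 1\<close> vertices does not fit into a clique of
  \<open>h\<close> vertices. The palette has one color more than needed for all such components
  except \<open>C0\<close>, while \<open>C0\<close> has at least two edges. An edge between two
  blocks makes room for \<open>C0\<close>: all but the leaf \<open>q\<close> fill one block, and
  \<open>q\<close> lies in the other.\<close>

theorem linear_leaf:
  assumes C0: "C0 \<in> comps V" and big: "\<And>C. C \<in> comps V \<Longrightarrow> card C \<le> card C0"
    and q: "q \<in> C0" "adj q p" "\<And>y. adj q y \<Longrightarrow> y = p"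
  shows "\<exists>c n0. \<forall>n\<ge>n0. rsat n F \<le> c * n"
proof -
  have compsV: "conn C" "C \<subseteq> V" "finite C" if "C \<in> comps V" for C
    using comps_conn[OF _ that] comps_sub[OF that] finite_V_sub by auto
  note C0V = compsV[OF C0]
  have apq: "adj p q" using q(2) adj_sym by blast
  have pV: "p \<in> V" "q \<in> V" using apq adj_V by blast+
  have pC0: "p \<in> C0" using comps_closed[OF C0 q(1) pV(1) q(2)] .
  have pq: "p \<noteq> q" using apq adj_irrefl by auto
  obtain z where z: "z \<noteq> p" "z \<noteq> q" "adj p z" using nie[OF apq] q(3) by blast
  have zV: "z \<in> V" using adj_V z(3) by blast
  have zC0: "z \<in> C0" using comps_closed[OF C0 pC0 zV z(3)] .
  have "{p, q, z} \<subseteq> C0" "card {p, q, z} = 3" using q(1) pC0 zC0 pq z by auto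
  then have C3: "3 \<le> card C0" using card_mono[OF C0V(3)] by metis
  define h where "h = card C0 - 1"
  have h: "card C0 = h + 1" "0 < h" using C3 by (auto simp: h_def)
  have elC0: "2 \<le> card (edges_in C0)" by (rule conn_two_edges[OF C0V(1) C3])
  define Mx where "Mx = {C \<in> comps V. card C = h + 1 \<and> C \<noteq> C0}"
  define Q where "Q = \<Union> Mx"
  have QV: "Q \<subseteq> V" using compsV(2) by (auto simp: Q_def Mx_def)
  have fQ: "finite Q" using finite_V_sub[OF QV] .
  have QC0: "Q \<inter> C0 = {}"
  proof -
    have "x \<notin> C0" if "C \<in> Mx" "x \<in> C" for C x
      using comps_disj[OF C0, of C x] that by (auto simp: Mx_def)
    then show ?thesis by (auto simp: Q_def)
  qed
  have Qcl: "y \<in> Q" if xQ: "x \<in> Q" and xy: "adj x y" for x y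
  proof -
    obtain C where C: "C \<in> Mx" "x \<in> C" using xQ by (auto simp: Q_def)
    have "y \<in> C" using comps_closed[of C V x y] C xy adj_V by (auto simp: Mx_def)
    then show ?thesis using C(1) by (auto simp: Q_def)
  qed
  define \<eta> where "\<eta> = card (edges_in Q)"
  define \<iota> where "\<iota> = eidx Q"
  have \<iota>: "bij_betw \<iota> (edges_in Q) {..<\<eta>}" using eidx[OF fQ] by (simp add: \<iota>_def \<eta>_def)
  have \<iota>lt: "\<iota> e < \<eta>" if "e \<in> edges_in Q" for e using \<iota> that by (auto simp: bij_betw_def)
  let ?h = "clique_host h \<iota>"
  define Gd where "Gd = {..\<eta>} \<times> Q"
  have fGd: "finite Gd" using fQ by (simp add: Gd_def)
  define m where "m = card Gd"
  \<comment> \<open>Exceptional partners of a vertex: the \<open>m\<close> gadget vertices, its own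
    block, and the last block, which may be incomplete.\<close>
  define r where "r = m + 2 * h"
  define k where "k = card V"
  have cblock: "finite {i. i div h = t}" "card {i. i div h = t} = h" for t using block[OF h(2)] by auto
  have main: "rsat (m + M) F \<le> r * (m + M)" if M: "h * (k + 3) \<le> M" for M
  proof -
    define N where "N = M div h"
    \<comment> \<open>One block for each of at most \<open>k\<close> components, besides the two
      blocks of the added edge and the block of its color.\<close>
    have Nk: "k + 3 \<le> N" using div_le_mono[OF M, of h] h(2) by (simp add: N_def)
    have ltM: "i < M" if "i div h < N" for i
    proof (rule ccontr)
      assume "\<not> i < M"
      then have "N \<le> i div h" unfolding N_def by (intro div_le_mono) simp
      then show False using that by simp
    qed
    define U :: "(nat + nat \<times> 'a) set" where "U = Inl ` {..<M} \<union> Inr ` Gd"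
    have fU: "finite U" using fGd by (simp add: U_def)
    have cU: "card U = m + M"
      unfolding U_def by (subst card_Un_disjoint) (use fGd in \<open>auto simp: card_image inj_on_def m_def\<close>)
    define R :: "nat + nat \<times> 'a \<Rightarrow> (nat + nat \<times> 'a) set" where
      "R s = Inr ` Gd \<union> (Inl ` {i. i div h = N} \<union> (case s of Inl j \<Rightarrow> Inl ` {i. i div h = j div h} | Inr x \<Rightarrow> {}))" for s
    have R: "finite (R s) \<and> card (R s) \<le> r" for s
    proof
      show "finite (R s)" using fGd cblock by (cases s) (simp_all add: R_def)
      have 1: "card (Inr ` Gd :: (nat + nat \<times> 'a) set) = m" by (simp add: card_image m_def)
      have 2: "card (Inl ` {i. i div h = N} :: (nat + nat \<times> 'a) set) = h" using cblock by (simp add: card_image)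
      have 3: "card (case s of Inl j \<Rightarrow> Inl ` {i. i div h = j div h} | Inr x \<Rightarrow> ({} :: (nat + nat \<times> 'a) set)) \<le> h"
        using cblock by (cases s) (simp_all add: card_image)
      show "card (R s) \<le> r"
        unfolding R_def r_def
        using card_Un_le[of "Inr ` Gd" "Inl ` {i. i div h = N} \<union> (case s of Inl j \<Rightarrow> Inl ` {i. i div h = j div h} | Inr x \<Rightarrow> {})"]
          card_Un_le[of "Inl ` {i. i div h = N}" "case s of Inl j \<Rightarrow> Inl ` {i. i div h = j div h} | Inr x \<Rightarrow> ({} :: (nat + nat \<times> 'a) set)"]
          1 2 3 by linarith
    qed
    have "rsat (card U) F \<le> r * card U"
    proof (rule host_linear[OF sF fU _ clique_host_sym, where R = R])
      have "M > 0" using M h(2) by (cases M) auto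
      then show "U \<noteq> {}" by (auto simp: U_def)
      show "finite (R s) \<and> card (R s) \<le> r" for s by (rule R)
      show "\<not> emb V adj U ?h f" for f
      proof
        assume f: "emb V adj U ?h f"
        have col: "\<exists>t. t \<le> \<eta> \<and> ?h (f x) (f y) = Some (Inr t)"
          if C: "C \<in> insert C0 Mx" and xy: "x \<in> C" "y \<in> C" "adj x y" for C x y
        proof -
          have C': "C \<in> comps V" "card C = h + 1" using C C0 h by (auto simp: Mx_def)
          note CV = compsV[OF C'(1)]
          define cl :: "nat + nat \<times> 'a \<Rightarrow> nat option" where "cl s = (case s of Inl i \<Rightarrow> Some (i div h) | Inr _ \<Rightarrow> None)" for s
          have he: "?h (f a) (f b) \<noteq> None" if "a \<in> C" "b \<in> C" "adj a b" for a b
            using emb_edge[OF f _ _ that(3)] that CV(2) by blast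
          have eqcl: "cl (f a) = cl (f b)" if ab: "a \<in> C" "b \<in> C" "adj a b" for a b
            using he[OF ab] by (cases "f a"; cases "f b") (auto simp: cl_def split: if_splits)
          have const: "cl (f a) = cl (f x)" if "a \<in> C" for a
            using conn_const[OF CV(1), of "\<lambda>a. cl (f a)", OF eqcl that xy(1)] by blast
          have "cl (f x) = None"
          proof (rule ccontr)
            assume "cl (f x) \<noteq> None"
            then obtain t where t: "cl (f x) = Some t" by blast
            have "f a \<in> Inl ` {i. i div h = t}" if "a \<in> C" for a
              using const[OF that] t by (cases "f a") (auto simp: cl_def)
            then have "f ` C \<subseteq> Inl ` {i. i div h = t}" by blast
            moreover have "inj_on f C" using emb_inj[OF f] CV(2) inj_on_subset by blast
            moreover have "finite (Inl ` {i. i div h = t} :: (nat + nat \<times> 'a) set)" using cblock by blast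
            ultimately have "card C \<le> card (Inl ` {i. i div h = t} :: (nat + nat \<times> 'a) set)"
              using card_inj_on_le by blast
            also have "\<dots> = h" using cblock by (simp add: card_image)
            finally show False using C'(2) by simp
          qed
          then have "cl (f y) = None" using const[OF xy(2)] by simp
          then obtain j a l b where 1: "f x = Inr (j, a)" "f y = Inr (l, b)"
            using \<open>cl (f x) = None\<close> by (cases "f x"; cases "f y") (auto simp: cl_def)
          have "f x \<in> U" "f y \<in> U" using emb_in[OF f] xy CV(2) by auto
          then have 2: "j \<le> \<eta>" "a \<in> Q" "b \<in> Q" using 1 by (auto simp: U_def Gd_def)
          have 3: "l = j \<and> adj a b" using he[OF xy] 1 by (auto split: if_splits)
          then have "{a, b} \<in> edges_in Q" using 2 by (auto simp: edges_in_def)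
          then have "skip j (\<iota> {a, b}) \<le> \<eta>" using \<iota>lt skip_le by blast
          then show ?thesis using 1 3 by simp
        qed
        have sub: "edges_in C0 \<union> edges_in Q \<subseteq> {e. \<exists>x y C. C \<in> insert C0 Mx \<and> x \<in> C \<and> y \<in> C \<and> adj x y \<and> e = {x, y}}"
        proof
          fix e assume "e \<in> edges_in C0 \<union> edges_in Q"
          then show "e \<in> {e. \<exists>x y C. C \<in> insert C0 Mx \<and> x \<in> C \<and> y \<in> C \<and> adj x y \<and> e = {x, y}}"
          proof
            assume "e \<in> edges_in C0" then show ?thesis unfolding edges_in_def by blast
          next
            assume "e \<in> edges_in Q"
            then obtain x y where xy: "x \<in> Q" "adj x y" "e = {x, y}" by (auto simp: edges_in_def)
            obtain C where C: "C \<in> Mx" "x \<in> C" using xy(1) by (auto simp: Q_def)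
            have "y \<in> C" using comps_closed[of C V x y] C xy(2) adj_V by (auto simp: Mx_def)
            then show ?thesis using C xy by blast
          qed
        qed
        have "\<exists>t. t \<le> \<eta> \<and> (\<exists>x y. x \<in> V \<and> y \<in> V \<and> adj x y \<and> e = {x, y} \<and> ?h (f x) (f y) = Some (Inr t))"
          if e: "e \<in> edges_in C0 \<union> edges_in Q" for e
        proof -
          obtain x y C where 1: "C \<in> insert C0 Mx" "x \<in> C" "y \<in> C" "adj x y" "e = {x, y}" using sub e by blast
          have "C \<subseteq> V" using 1(1) compsV(2) C0 by (auto simp: Mx_def)
          then show ?thesis using col[OF 1(1-4)] 1 by blast
        qed
        then obtain \<gamma> where \<gamma>: "\<And>e. e \<in> edges_in C0 \<union> edges_in Q \<Longrightarrow> \<gamma> e \<le> \<eta> \<and>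
            (\<exists>x y. x \<in> V \<and> y \<in> V \<and> adj x y \<and> e = {x, y} \<and> ?h (f x) (f y) = Some (Inr (\<gamma> e)))"
          by metis
        \<comment> \<open>Neither \<open>C0\<close> nor the other largest components can lie in a
          block, so all their edges have distinct colors from one palette of
          \<open>\<eta> + 1\<close>.\<close>
        have "card (edges_in C0 \<union> edges_in Q) \<le> card {..\<eta>}"
        proof (rule card_inj_on_le[of \<gamma>])
          show "inj_on \<gamma> (edges_in C0 \<union> edges_in Q)"
          proof (rule inj_onI)
            fix e e' assume a: "e \<in> edges_in C0 \<union> edges_in Q" "e' \<in> edges_in C0 \<union> edges_in Q" "\<gamma> e = \<gamma> e'"
            obtain x y where 1: "x \<in> V" "y \<in> V" "adj x y" "e = {x, y}" "?h (f x) (f y) = Some (Inr (\<gamma> e))"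
              using \<gamma>[OF a(1)] by blast
            obtain x' y' where 2: "x' \<in> V" "y' \<in> V" "adj x' y'" "e' = {x', y'}" "?h (f x') (f y') = Some (Inr (\<gamma> e'))"
              using \<gamma>[OF a(2)] by blast
            show "e = e'" using emb_rb[OF f 1(1-3) 2(1-3)] 1 2 a(3) by simp
          qed
        qed (use \<gamma> in auto)
        moreover have "edges_in C0 \<inter> edges_in Q = {}" using QC0 by (auto simp: edges_in_def doubleton_eq_iff)
        then have "card (edges_in C0 \<union> edges_in Q) = card (edges_in C0) + \<eta>"
          unfolding \<eta>_def using finite_edges_in C0V(3) fQ by (intro card_Un_disjoint) auto
        ultimately show False using elC0 by simp
      qed
      \<comment> \<open>The set \<open>C0 - {q}\<close> fills the block of \<open>i\<close>, so a
        color from that block cannot be avoided there; in this case \<open>i\<close> and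
        \<open>i'\<close> exchange roles.\<close>
      have good1: "\<exists>f. emb V adj U (recolor ?h (Inl i) (Inl i') c) f"
        if ii: "i div h < N" "i' div h < N" "i div h \<noteq> i' div h"
          and c: "\<And>e. c = Inl e \<Longrightarrow> e \<noteq> {} \<Longrightarrow> \<not> e \<subseteq> {x. x div h = i div h}" for i i' c
      proof -
        define t where "t = i div h"
        define j where "j = (case c of Inr s \<Rightarrow> if s \<le> \<eta> then s else 0 | Inl _ \<Rightarrow> 0)"
        \<comment> \<open>A clique color determines the block of its vertices, found from any one of
          them; the small components keep off this block.\<close>
        define \<tau> where "\<tau> = (case c of Inl e \<Rightarrow> (SOME x. x \<in> e) div h | Inr _ \<Rightarrow> 0)"
        have j\<eta>: "j \<le> \<eta>" by (auto simp: j_def split: sum.splits)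
        obtain g where g: "bij_betw g (C0 - {q}) {x. x div h = t}" "g p = i"
          using bij_one[of "C0 - {q}" "{x. x div h = t}" p i] C0V(3) q(1) h cblock pC0 pq t_def by auto
        have fc: "finite (comps V)" "card (comps V) \<le> k" using card_comps[of V] by (auto simp: k_def)
        have "card (comps V) \<le> card ({..<N} - {t, i' div h, \<tau>})"
        proof -
          have "card {t, i' div h, \<tau>} \<le> 3" by (simp add: card_insert_if)
          moreover have "card {..<N} - card {t, i' div h, \<tau>} \<le> card ({..<N} - {t, i' div h, \<tau>})"
            by (rule diff_card_le_card_Diff) simp
          ultimately show ?thesis using Nk fc(2) by simp
        qed
        then obtain \<kappa> where \<kappa>: "inj_on \<kappa> (comps V)" "\<kappa> ` comps V \<subseteq> {..<N} - {t, i' div h, \<tau>}"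
          using inj_on_iff_card_le[OF fc(1) finite_Diff[OF finite_lessThan], of N "{t, i' div h, \<tau>}"] by auto
        define Sm where "Sm = V - C0 - Q"
        have cx: "comp_of V x \<in> comps V" "x \<in> comp_of V x" if "x \<in> V" for x using comp_of_in[OF that] comp_of_self by auto
        have small: "card (comp_of V x) \<le> h" if x: "x \<in> Sm" for x
        proof -
          have xV: "x \<in> V" "x \<notin> C0" "x \<notin> Q" using x by (auto simp: Sm_def)
          have "comp_of V x \<noteq> C0" "comp_of V x \<notin> Mx" using xV cx[OF xV(1)] by (auto simp: Q_def)
          then have "card (comp_of V x) \<noteq> h + 1" using cx[OF xV(1)] by (auto simp: Mx_def)
          then show ?thesis using big[OF cx(1)[OF xV(1)]] h(1) by linarith
        qed
        have "\<exists>b. inj_on b C \<and> b ` C \<subseteq> {x. x div h = \<kappa> C}" if "C \<in> comps V" "card C \<le> h" for C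
          using inj_on_iff_card_le[OF compsV(3)[OF that(1)] cblock(1), of "\<kappa> C"] that(2) cblock(2) by simp
        then obtain b where b: "\<And>C. C \<in> comps V \<Longrightarrow> card C \<le> h \<Longrightarrow> inj_on (b C) C \<and> b C ` C \<subseteq> {x. x div h = \<kappa> C}"
          by metis
        define w where "w x = (if x = q then i' else if x \<in> C0 then g x else b (comp_of V x) x)" for x
        define f :: "'a \<Rightarrow> nat + nat \<times> 'a" where "f x = (if x \<in> Q then Inr (j, x) else Inl (w x))" for x
        have wq: "w q = i'" by (simp add: w_def)
        have wC: "w x = g x" "w x div h = t" if "x \<in> C0" "x \<noteq> q" for x
          using that g(1) by (auto simp: w_def bij_betw_def)
        have wS: "w x = b (comp_of V x) x" "w x div h = \<kappa> (comp_of V x)" "\<kappa> (comp_of V x) < N" "\<kappa> (comp_of V x) \<notin> {t, i' div h, \<tau>}" if x: "x \<in> Sm" for x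
        proof -
          have xV: "x \<in> V" "x \<notin> C0" using x by (auto simp: Sm_def)
          show 1: "w x = b (comp_of V x) x" using xV q(1) by (auto simp: w_def)
          show "w x div h = \<kappa> (comp_of V x)" using b[OF cx(1)[OF xV(1)] small[OF x]] cx(2)[OF xV(1)] 1 by auto
          show "\<kappa> (comp_of V x) < N" "\<kappa> (comp_of V x) \<notin> {t, i' div h, \<tau>}" using \<kappa>(2) cx(1)[OF xV(1)] by blast+
        qed
        have split: "x = q \<or> (x \<in> C0 \<and> x \<noteq> q) \<or> x \<in> Sm" if "x \<in> V" "x \<notin> Q" for x using that by (auto simp: Sm_def)
        have wN: "w x div h < N" if "x \<in> V" "x \<notin> Q" for x
          using split[OF that] wq wC wS ii by (auto simp: t_def)
        have injw: "x = y" if xy: "x \<in> V" "x \<notin> Q" "y \<in> V" "y \<notin> Q" "w x = w y" for x y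
        proof -
          have d: "w x div h = w y div h" using xy(5) by simp
          have tq: "t \<noteq> i' div h" using ii(3) by (simp add: t_def)
          from split[OF xy(1,2)] show ?thesis
          proof (elim disjE conjE)
            assume "x = q"
            then show ?thesis using split[OF xy(3,4)] d wq wC(2)[of y] wS(2,4)[of y] tq by auto
          next
            assume x: "x \<in> C0" "x \<noteq> q"
            then have "y \<in> C0 \<and> y \<noteq> q" using split[OF xy(3,4)] d wq wC(2)[of x] wS(2,4)[of y] tq by auto
            then show ?thesis using g(1) x xy(5) wC(1) by (auto simp: bij_betw_def inj_on_def)
          next
            assume x: "x \<in> Sm"
            then have y: "y \<in> Sm" using split[OF xy(3,4)] d wq wC(2)[of y] wS(2,4)[of x] tq by auto
            have "\<kappa> (comp_of V x) = \<kappa> (comp_of V y)" using wS(2)[OF x] wS(2)[OF y] d by simp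
            then have e: "comp_of V x = comp_of V y" using \<kappa>(1) cx xy by (auto simp: inj_on_def)
            have "inj_on (b (comp_of V x)) (comp_of V x)" using b[OF cx(1)[OF xy(1)] small[OF x]] by blast
            moreover have "b (comp_of V x) x = b (comp_of V x) y" using wS(1)[OF x] wS(1)[OF y] xy(5) e by simp
            ultimately show ?thesis using cx(2)[OF xy(1)] cx(2)[OF xy(3)] e by (auto dest: inj_onD)
          qed
        qed
        let ?F = "fresh ?h (Inl i) (Inl i')"
        have key: "({x, y} = {p, q} \<and> {f x, f y} = {Inl i, Inl i'} \<and> ?F (f x) (f y) = Some None)
           \<or> (x \<notin> Q \<and> y \<notin> Q \<and> ?F (f x) (f y) = Some (Some (Inl {w x, w y})) \<and> ?h (f x) (f y) = Some (Inl {w x, w y}) \<and>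
               (w x div h \<noteq> t \<longrightarrow> w x div h \<noteq> \<tau>) \<and> w x div h = w y div h)
           \<or> ({x, y} \<in> edges_in Q \<and> ?F (f x) (f y) = Some (Some (Inr (skip j (\<iota> {x, y})))) \<and> ?h (f x) (f y) = Some (Inr (skip j (\<iota> {x, y}))))"
          if xy: "x \<in> V" "y \<in> V" "adj x y" for x y
        proof -
          have yx: "adj y x" using xy adj_sym by blast
          have ne: "x \<noteq> y" using xy adj_irrefl by auto
          have pqQ: "p \<notin> Q" "q \<notin> Q" using QC0 pC0 q(1) by auto
          consider "x \<in> Q" "y \<in> Q" | "{x, y} = {p, q}" | "x \<notin> Q" "y \<notin> Q" "x \<noteq> q" "y \<noteq> q"
            using Qcl[OF _ xy(3)] Qcl[OF _ yx] q(3)[of y] q(3)[of x] xy(3) yx by (cases "x = q"; cases "y = q") auto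
          then show ?thesis
          proof cases
            case 1
            then have "{x, y} \<in> edges_in Q" using xy(3) by (auto simp: edges_in_def)
            moreover have "?h (f x) (f y) = Some (Inr (skip j (\<iota> {x, y})))" using 1 xy(3) by (simp add: f_def)
            moreover have "?F (f x) (f y) = map_option Some (?h (f x) (f y))"
              using 1 by (simp add: f_def fresh_def recolor_def doubleton_eq_iff)
            ultimately show ?thesis by simp
          next
            case 2
            have "f p = Inl i" "f q = Inl i'" using pqQ wq wC(1)[OF pC0 pq] g(2) by (simp_all add: f_def)
            moreover have "f ` {x, y} = f ` {p, q}" using 2 by simp
            ultimately have "{f x, f y} = {Inl i, Inl i'}" by simp
            then show ?thesis using 2 by (simp add: fresh_def recolor_def)
          next
            case 3
            have f: "f x = Inl (w x)" "f y = Inl (w y)" using 3 by (simp_all add: f_def)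
            have same: "x \<in> C0 \<longleftrightarrow> y \<in> C0" using comps_closed[OF C0 _ xy(2,3)] comps_closed[OF C0 _ xy(1) yx] by blast
            have cs: "comp_of V y = comp_of V x" using comps_closed[OF cx[OF xy(1)] xy(2,3)] by (rule comp_of_eq)
            have d: "w x div h = w y div h \<and> (w x div h = t \<or> w x div h \<noteq> \<tau>) \<and> w x div h \<noteq> i' div h"
            proof (cases "x \<in> C0")
              case True
              then show ?thesis using wC(2)[of x] wC(2)[of y] 3 same ii(3) by (simp add: t_def)
            next
              case False
              then have "x \<in> Sm" "y \<in> Sm" using 3 same xy by (auto simp: Sm_def)
              then show ?thesis using wS(2,4)[of x] wS(2)[of y] cs by simp
            qed
            have "w x \<noteq> w y" using injw xy 3 ne by blast
            then have hh: "?h (f x) (f y) = Some (Inl {w x, w y})" using f d by simp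
            have "{f x, f y} \<noteq> {Inl i, Inl i'}" using f d by (auto simp: doubleton_eq_iff)
            then have "?F (f x) (f y) = Some (Some (Inl {w x, w y}))" using hh by (simp add: fresh_def recolor_def)
            then show ?thesis using 3 hh d by blast
          qed
        qed
        have "emb V adj U ?F f"
        proof (rule embI)
          show "inj_on f V" using injw by (auto simp: inj_on_def f_def split: if_splits)
          show "f x \<in> U" if "x \<in> V" for x
            using ltM[OF wN[OF that]] j\<eta> by (auto simp: f_def U_def Gd_def)
          show "?F (f x) (f y) \<noteq> None" if "x \<in> V" "y \<in> V" "adj x y" for x y using key[OF that] by auto
          show "{x, y} = {x', y'}" if xy: "x \<in> V" "y \<in> V" "adj x y" and xy': "x' \<in> V" "y' \<in> V" "adj x' y'"
            and e: "?F (f x) (f y) = ?F (f x') (f y')" for x y x' y'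
            using key[OF xy]
          proof (elim disjE conjE)
            assume "{x, y} = {p, q}" "?F (f x) (f y) = Some None"
            then show ?thesis using key[OF xy'] e by auto
          next
            assume 1: "x \<notin> Q" "y \<notin> Q" "?F (f x) (f y) = Some (Some (Inl {w x, w y}))"
            then have 2: "x' \<notin> Q" "y' \<notin> Q" "{w x, w y} = {w x', w y'}" using key[OF xy'] e by auto
            have "(w x = w x' \<and> w y = w y') \<or> (w x = w y' \<and> w y = w x')" using 2(3) by (auto simp: doubleton_eq_iff)
            then show ?thesis using injw xy xy' 1 2 by (elim disjE conjE) blast+
          next
            assume 1: "{x, y} \<in> edges_in Q" "?F (f x) (f y) = Some (Some (Inr (skip j (\<iota> {x, y}))))"
            then have 2: "{x', y'} \<in> edges_in Q" "skip j (\<iota> {x, y}) = skip j (\<iota> {x', y'})" using key[OF xy'] e by auto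
            then have "\<iota> {x, y} = \<iota> {x', y'}" using skip_inj by blast
            then show ?thesis using \<iota> 1 2 by (simp add: bij_betw_def inj_on_def)
          qed
        qed
        then have "emb V adj U (recolor ?h (Inl i) (Inl i') c) f"
        proof (rule emb_fresh)
          fix x y assume xy: "x \<in> V" "y \<in> V" "adj x y" and e: "?h (f x) (f y) = Some c"
          from key[OF xy] show "{f x, f y} = {Inl i, Inl i'}"
          proof (elim disjE conjE)
            assume 1: "?h (f x) (f y) = Some (Inl {w x, w y})" "w x div h \<noteq> t \<longrightarrow> w x div h \<noteq> \<tau>" "w x div h = w y div h"
            then have ce: "c = Inl {w x, w y}" using e by simp
            have "(SOME s. s \<in> {w x, w y}) \<in> {w x, w y}" by (rule someI_ex) blast
            then have "\<tau> = w x div h" using ce 1(3) by (auto simp: \<tau>_def)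
            then have "w x div h = t" using 1(2) by simp
            then have "{w x, w y} \<subseteq> {x. x div h = i div h}" using 1(3) by (simp add: t_def)
            then show ?thesis using c[OF ce] by blast
          next
            assume 1: "{x, y} \<in> edges_in Q" "?h (f x) (f y) = Some (Inr (skip j (\<iota> {x, y})))"
            obtain s where s: "s = skip j (\<iota> {x, y})" by blast
            have ce: "c = Inr s" using e 1(2) s by simp
            have "s \<le> \<eta>" unfolding s by (rule skip_le[OF \<iota>lt[OF 1(1)]])
            then have "j = s" unfolding j_def ce by simp
            then have "j = skip j (\<iota> {x, y})" using s by (rule trans)
            then show ?thesis using skip_neq[of j "\<iota> {x, y}", symmetric] by blast
          qed
        qed
        then show ?thesis by blast
      qed
      show "?h s s' = None \<and> good V adj U ?h s s'"
        if st: "s \<in> U" "s' \<in> U" "s \<noteq> s'" "s' \<notin> R s" "s \<notin> R s'" for s s'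
      proof -
        have leN: "i div h \<le> N" if "i < M" for i unfolding N_def using that by (intro div_le_mono) simp
        have "\<exists>i. s = Inl i \<and> i < M \<and> i div h \<noteq> N" "\<exists>i. s' = Inl i \<and> i < M \<and> i div h \<noteq> N"
          using st by (auto simp: U_def R_def)
        then obtain i i' where i: "s = Inl i" "s' = Inl i'" "i div h < N" "i' div h < N"
          using leN by (metis le_neq_implies_less)
        have ne: "i div h \<noteq> i' div h" using st(4) i by (auto simp: R_def)
        have "\<exists>f. emb V adj U (recolor ?h s s' c) f" for c
        proof (cases "\<exists>e. c = Inl e \<and> e \<noteq> {} \<and> e \<subseteq> {x. x div h = i div h}")
          case True
          then obtain e where e: "c = Inl e" "e \<noteq> {}" "e \<subseteq> {x. x div h = i div h}" by blast
          have "\<exists>f. emb V adj U (recolor ?h (Inl i') (Inl i) c) f"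
          proof (rule good1[OF i(4,3) ne[symmetric]])
            fix e' assume e': "c = Inl e'"
            obtain x where "x \<in> e" using e(2) by blast
            then have "x \<in> e'" "x div h = i div h" using e e' by auto
            then show "\<not> e' \<subseteq> {x. x div h = i' div h}" using ne by auto
          qed
          then show ?thesis using recolor_commute[of ?h s s' c] i by simp
        next
          case False
          have "\<exists>f. emb V adj U (recolor ?h (Inl i) (Inl i') c) f"
            by (rule good1[OF i(3,4) ne]) (use False in blast)
          then show ?thesis using i by simp
        qed
        then show ?thesis using i ne by (simp add: good_def)
      qed
    qed
    then show ?thesis by (simp add: cU)
  qed
  show ?thesis
  proof (rule exI[of _ r], rule exI[of _ "m + h * (k + 3)"], intro allI impI)
    fix n assume n: "m + h * (k + 3) \<le> n"
    then show "rsat n F \<le> r * n" using main[of "n - m"] by simp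
  qed
qed

text \<open>Any leafless component, largest or not, is enough for the core method; otherwise every
  component has a leaf, in particular a largest one.\<close>

theorem linear_upper: "\<exists>c n0. \<forall>n\<ge>n0. rsat n F \<le> c * n"
proof (cases "\<exists>C\<in>comps V. \<forall>x\<in>C. \<forall>y. adj x y \<longrightarrow> (\<exists>z. z \<noteq> y \<and> adj x z)")
  case True
  then show ?thesis using linear_no_leaf by blast
next
  case False
  obtain x where "x \<in> V" using sF by (auto simp: simple_graph_def)
  then have ne: "comps V \<noteq> {}" using comp_of_in by blast
  have fc: "finite (comps V)" using card_comps by blast
  obtain C0 where C0: "C0 \<in> comps V" "\<And>C. C \<in> comps V \<Longrightarrow> card C \<le> card C0"
  proof -
    have "Max (card ` comps V) \<in> card ` comps V" using fc ne by (intro Max_in) auto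
    then obtain C0 where "C0 \<in> comps V" "card C0 = Max (card ` comps V)" by auto
    moreover have "card C \<le> Max (card ` comps V)" if "C \<in> comps V" for C using fc that by (intro Max_ge) auto
    ultimately show thesis by (intro that[of C0]) auto
  qed
  obtain q p where "q \<in> C0" "adj q p" "\<And>y. adj q y \<Longrightarrow> y = p" using False C0(1) by blast
  then show ?thesis using linear_leaf[OF C0] by blast
qed

end


section \<open>Isolated edges\<close>

lemma has_isolated_edgeE:
  assumes F: "simple_graph F" and h: "has_isolated_edge F"
  obtains p q where "adj_of F p q" "\<And>z. adj_of F p z \<Longrightarrow> z = q" "\<And>z. adj_of F q z \<Longrightarrow> z = p"
proof -
  obtain v where v: "v \<in> verts F"
    and iso: "isomorphic (induced_subgraph F ((adjacency F)\<^sup>* `` {v})) (complete_graph 2)"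
    using h by (auto simp: has_isolated_edge_def components_def)
  define X where "X = (adjacency F)\<^sup>* `` {v}"
  define H where "H = induced_subgraph F X"
  obtain f where f: "bij_betw f (verts H) {..<2::nat}"
    "{e. e \<subseteq> {..<2} \<and> card e = 2} = (\<lambda>e. f ` e) ` edges H"
    using iso by (auto simp: isomorphic_def complete_graph_def H_def X_def)
  have "{..<2::nat} \<in> {e. e \<subseteq> {..<2} \<and> card e = 2}" by simp
  then obtain e where e: "e \<in> edges H" using f(2) by blast
  then have e': "e \<in> edges F" "e \<subseteq> X" by (auto simp: H_def induced_subgraph_def)
  obtain p q where pq: "e = {p, q}" "p \<noteq> q" "adj_of F p q" using simple_edgeE[OF F e'(1)] by metis
  have "card X = 2" using bij_betw_same_card[OF f(1)] by (simp add: H_def induced_subgraph_def)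
  then have X: "X = {p, q}" using e'(2) pq by (metis card_2_iff card_seteq card.infinite zero_neq_numeral order_refl)
  have cl: "z \<in> X" if "w \<in> X" "adj_of F w z" for w z
    using that by (auto simp: X_def adjacency_def adj_of_def intro: rtrancl_into_rtrancl)
  show thesis
  proof
    show "adj_of F p q" by (rule pq)
    show "z = q" if "adj_of F p z" for z using cl[of p z] X that adj_ofD[OF F that] by auto
    show "z = p" if "adj_of F q z" for z using cl[of q z] X that adj_ofD[OF F that] by auto
  qed
qed

lemma has_isolated_edgeI:
  assumes F: "simple_graph F" and pq: "adj_of F p q" "\<And>z. adj_of F p z \<Longrightarrow> z = q" "\<And>z. adj_of F q z \<Longrightarrow> z = p"
  shows "has_isolated_edge F"
proof -
  have ne: "p \<noteq> q" "p \<in> verts F" using adj_ofD[OF F pq(1)] by auto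
  have "y \<in> {p, q}" if "(p, y) \<in> (adjacency F)\<^sup>*" for y
    using that
  proof induction
    case (step y z)
    then show ?case using pq(2,3) by (auto simp: adjacency_def adj_of_def)
  qed auto
  moreover have "(p, q) \<in> (adjacency F)\<^sup>*" using pq(1) by (auto simp: adjacency_def adj_of_def)
  ultimately have X: "(adjacency F)\<^sup>* `` {p} = {p, q}" by auto
  have ed: "{e \<in> edges F. e \<subseteq> {p, q}} = {{p, q}}"
  proof -
    have "e = {p, q}" if "e \<in> edges F" "e \<subseteq> {p, q}" for e
      using simple_edgeE[OF F that(1)] that(2) by (metis doubleton_eq_iff insertE insert_subset singletonD)
    then show ?thesis using pq(1) by (auto simp: adj_of_def)
  qed
  have k2: "{e. e \<subseteq> {..<2::nat} \<and> card e = 2} = {{0, 1}}"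
  proof -
    have two: "{..<2::nat} = {0, 1}" by auto
    have "e = {..<2}" if "e \<subseteq> {..<2::nat}" "card e = 2" for e
      by (rule card_subset_eq) (use that in simp_all)
    then show ?thesis unfolding two by (auto simp: card_insert_if)
  qed
  have "isomorphic (induced_subgraph F {p, q}) (complete_graph 2)"
    unfolding isomorphic_def induced_subgraph_def complete_graph_def graph.sel ed k2
    using ne by (intro exI[of _ "\<lambda>x. if x = p then 0 else 1"]) (auto simp: bij_betw_def inj_on_def)
  moreover have "induced_subgraph F {p, q} \<in> components F"
    unfolding components_def using X ne(2) by (metis (mono_tags, lifting) mem_Collect_eq)
  ultimately show ?thesis by (auto simp: has_isolated_edge_def)
qed

lemma bij_two:
  assumes "finite A" "finite B" "card A = card B" "x \<in> A" "y \<in> A" "x \<noteq> y" "i \<in> B" "j \<in> B" "i \<noteq> j"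
  obtains g where "bij_betw g A B" "g x = i" "g y = j"
proof -
  have "card (A - {x, y}) = card (B - {i, j})" using assms by (simp add: card_Diff_subset)
  then obtain g where g: "bij_betw g (A - {x, y}) (B - {i, j})"
    using finite_same_card_bij[of "A - {x, y}" "B - {i, j}"] assms by auto
  define g' where "g' z = (if z = x then i else if z = y then j else g z)" for z
  have "bij_betw g' (A - {x, y} \<union> {x, y}) (B - {i, j} \<union> {i, j})"
  proof (rule bij_betw_combine)
    show "bij_betw g' (A - {x, y}) (B - {i, j})" using g by (rule bij_betw_cong[THEN iffD1, rotated]) (auto simp: g'_def)
    show "bij_betw g' {x, y} {i, j}" using assms by (auto simp: bij_betw_def g'_def)
  qed auto
  moreover have "A - {x, y} \<union> {x, y} = A" "B - {i, j} \<union> {i, j} = B" using assms by auto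
  ultimately show thesis using that[of g'] assms by (auto simp: g'_def)
qed

text \<open>As a component of its own, \<open>pq\<close> can be put on the added pair regardless of
  the rest, which only has to avoid the two ends and the color.\<close>

lemma emb_isolated_edge:
  assumes F: "simple_graph F" and pq: "adj_of F p q" "\<And>z. adj_of F p z \<Longrightarrow> z = q" "\<And>z. adj_of F q z \<Longrightarrow> z = p"
    and uv: "u \<in> U" "v \<in> U" "u \<noteq> v"
    and g: "emb (verts F - {p, q}) (adj_of F) U h g"
    and av: "\<And>x. x \<in> verts F - {p, q} \<Longrightarrow> g x \<noteq> u \<and> g x \<noteq> v"
    and c: "\<And>x y. x \<in> verts F - {p, q} \<Longrightarrow> y \<in> verts F - {p, q} \<Longrightarrow> adj_of F x y \<Longrightarrow> h (g x) (g y) \<noteq> Some c"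
  shows "\<exists>f. emb (verts F) (adj_of F) U (recolor h u v c) f"
proof -
  define f where "f = g(p := u, q := v)"
  have ne: "p \<noteq> q" using adj_ofD[OF F pq(1)] by auto
  have out: "x \<in> verts F - {p, q}" if "x \<in> verts F" "x \<noteq> p" "x \<noteq> q" for x using that by auto
  have cases_e: "{x, y} = {p, q} \<and> {f x, f y} = {u, v} \<or>
      (x \<in> verts F - {p, q} \<and> y \<in> verts F - {p, q} \<and> f x = g x \<and> f y = g y \<and> {f x, f y} \<noteq> {u, v})"
    if "x \<in> verts F" "y \<in> verts F" "adj_of F x y" for x y
  proof (cases "x \<in> {p, q} \<or> y \<in> {p, q}")
    case True
    then consider "x = p" | "x = q" | "y = p" | "y = q" by blast
    then have "x = p \<and> y = q \<or> x = q \<and> y = p"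
      using pq(2,3) that(3) adj_ofD(4)[OF F that(3)] by cases blast+
    then show ?thesis using ne by (elim disjE conjE) (simp_all add: f_def insert_commute)
  next
    case False
    then have xy: "x \<in> verts F - {p, q}" "y \<in> verts F - {p, q}" using that by auto
    then have "f x = g x" "f y = g y" by (auto simp: f_def)
    then show ?thesis using xy av[OF xy(1)] by auto
  qed
  have "emb (verts F) (adj_of F) U (recolor h u v c) f"
    unfolding emb_def
  proof (intro conjI ballI impI)
    show "inj_on f (verts F)"
    proof (rule inj_onI)
      fix x y assume "x \<in> verts F" "y \<in> verts F" "f x = f y"
      moreover have "inj_on g (verts F - {p, q})" using g by (simp add: emb_def)
      moreover have fp: "f p = u" "f q = v" and fg: "w \<noteq> p \<Longrightarrow> w \<noteq> q \<Longrightarrow> f w = g w" for w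
        using ne by (auto simp: f_def)
      ultimately show "x = y" using av out uv(3)
        by (metis inj_onD)
    qed
    show "f ` verts F \<subseteq> U" using g uv unfolding f_def emb_def by auto
    fix x y assume xy: "x \<in> verts F" "y \<in> verts F" "adj_of F x y"
    show "recolor h u v c (f x) (f y) \<noteq> None"
      using cases_e[OF xy]
    proof
      assume "x \<in> verts F - {p, q} \<and> y \<in> verts F - {p, q} \<and> f x = g x \<and> f y = g y \<and> {f x, f y} \<noteq> {u, v}"
      then show ?thesis using g xy(3) unfolding emb_def recolor_def by simp
    qed (simp add: recolor_def)
    fix x' y' assume xy': "x' \<in> verts F" "y' \<in> verts F" "adj_of F x' y'"
      and eq: "recolor h u v c (f x) (f y) = recolor h u v c (f x') (f y')"
    from cases_e[OF xy] show "{x, y} = {x', y'}"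
    proof
      assume a: "{x, y} = {p, q} \<and> {f x, f y} = {u, v}"
      then have "recolor h u v c (f x') (f y') = Some c" using eq by (simp add: recolor_def)
      then have 1: "{f x', f y'} = {u, v} \<or> h (f x') (f y') = Some c" by (simp add: recolor_def split: if_splits)
      from cases_e[OF xy'] show ?thesis
      proof
        assume "x' \<in> verts F - {p, q} \<and> y' \<in> verts F - {p, q} \<and> f x' = g x' \<and> f y' = g y' \<and> {f x', f y'} \<noteq> {u, v}"
        then show ?thesis using 1 c[of x' y'] xy'(3) by metis
      qed (use a in simp)
    next
      assume a: "x \<in> verts F - {p, q} \<and> y \<in> verts F - {p, q} \<and> f x = g x \<and> f y = g y \<and> {f x, f y} \<noteq> {u, v}"
      have "recolor h u v c (f x) (f y) = h (f x) (f y)" unfolding recolor_def by (rule if_not_P) (use a in blast)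
      then have e: "h (g x) (g y) = recolor h u v c (f x') (f y')" using eq a by metis
      from cases_e[OF xy'] show ?thesis
      proof
        assume "{x', y'} = {p, q} \<and> {f x', f y'} = {u, v}"
        then show ?thesis using e c[of x y] a xy by (simp add: recolor_def)
      next
        assume b: "x' \<in> verts F - {p, q} \<and> y' \<in> verts F - {p, q} \<and> f x' = g x' \<and> f y' = g y' \<and> {f x', f y'} \<noteq> {u, v}"
        moreover have "recolor h u v c (f x') (f y') = h (f x') (f y')" unfolding recolor_def
          by (rule if_not_P) (use b in blast)
        ultimately have "h (g x) (g y) = h (g x') (g y')" using e by metis
        then show ?thesis using g a b xy xy' unfolding emb_def by blast
      qed
    qed
  qed
  then show ?thesis by blast
qed

text \<open>A rainbow clique with one vertex less than \<open>F\<close>, plus isolated vertices, has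
  no room for \<open>F\<close>. For an added edge with an end outside the clique, the rest
  \<open>W\<close> of \<open>F\<close> goes into the clique. If the clique keeps a spare vertex,
  that vertex serves to avoid the color; if \<open>v\<close> takes it, a nonadjacent pair of
  \<open>W\<close> is put on the edge with that color.\<close>

lemma isolated_edge_incomplete:
  fixes F :: "'a graph"
  assumes F: "simple_graph F" "no_isolated_vertices F"
    and pq: "adj_of F p q" "\<And>z. adj_of F p z \<Longrightarrow> z = q" "\<And>z. adj_of F q z \<Longrightarrow> z = p"
    and nc: "verts F - {p, q} = {} \<or> (\<exists>x\<in>verts F - {p, q}. \<exists>y\<in>verts F - {p, q}. x \<noteq> y \<and> \<not> adj_of F x y)"
    and n: "card (verts F) \<le> n"
  shows "rsat n F \<le> 2 ^ card (verts F)"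
proof -
  define W where "W = verts F - {p, q}"
  define m where "m = card W + 1"
  have finV: "finite (verts F)" using F by (simp add: simple_graph_def)
  have ne: "p \<noteq> q" "p \<in> verts F" "q \<in> verts F" using adj_ofD[OF F(1) pq(1)] by auto
  have cV: "card (verts F) = m + 1" using finV ne by (simp add: m_def W_def card_Diff_subset card_ge_0_finite)
     (metis One_nat_def Suc_pred' add_2_eq_Suc' card_2_iff card_mono empty_subsetI finV insert_subset le_add_diff_inverse2 ne numeral_2_eq_2)
  have fW: "finite W" using finV by (simp add: W_def)
  define h :: "nat \<Rightarrow> nat \<Rightarrow> nat set option" where
    "h i j = (if i \<noteq> j \<and> i < m \<and> j < m then Some {i, j} else None)" for i j
  have hs: "sym_host h" by (auto simp: sym_host_def h_def insert_commute)
  have nbr: "\<exists>y\<in>verts F. adj_of F x y" if x: "x \<in> verts F" for x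
  proof -
    obtain e where e: "e \<in> edges F" "x \<in> e" using F(2) x by (auto simp: no_isolated_vertices_def)
    then show ?thesis using simple_edgeE[OF F(1) e(1)] adj_ofD(4)[OF F(1)] by (metis insertE singletonD)
  qed
  have gd: "\<exists>f. emb (verts F) (adj_of F) {..<n} (recolor h u v c) f"
    if uv: "u < n" "v < n" "u \<noteq> v" "m \<le> u" for u v c
  proof -
    have "\<exists>g. inj_on g W \<and> g ` W \<subseteq> {..<m} - {v} \<and> (\<forall>x\<in>W. \<forall>y\<in>W. adj_of F x y \<longrightarrow> {g x, g y} \<noteq> c)"
    proof (cases "v < m")
      case False
      \<comment> \<open>Leaving out one end of the clique edge with color \<open>c\<close> avoids
        the color; the default 0 applies when \<open>c\<close> contains no clique vertex.\<close>
      define i0 where "i0 = (if c \<inter> {..<m} = {} then 0 else (SOME i. i \<in> c \<inter> {..<m}))"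
      have i0: "i0 < m" "i0 \<in> c \<or> c \<inter> {..<m} = {}"
        using someI_ex[of "\<lambda>i. i \<in> c \<inter> {..<m}"] by (auto simp: i0_def m_def)
      have "card ({..<m} - {i0}) = card W" using i0 by (simp add: m_def)
      then obtain g where g: "bij_betw g W ({..<m} - {i0})"
        using finite_same_card_bij[OF fW, of "{..<m} - {i0}"] by auto
      have "{g x, g y} \<noteq> c" if "x \<in> W" "y \<in> W" for x y
      proof
        assume eq: "{g x, g y} = c"
        have "g x \<in> {..<m} - {i0}" "g y \<in> {..<m} - {i0}" using g that by (auto simp: bij_betw_def)
        then show False using eq i0 by auto
      qed
      then show ?thesis using g False by (intro exI[of _ g]) (auto simp: bij_betw_def)
    next
      case True
      have cT: "card ({..<m} - {v}) = card W" using True by (simp add: m_def)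
      show ?thesis
      proof (cases "W = {}")
        case True then show ?thesis by auto
      next
        case False
        then obtain x0 y0 where xy: "x0 \<in> W" "y0 \<in> W" "x0 \<noteq> y0" "\<not> adj_of F x0 y0" using nc by (auto simp: W_def)
        show ?thesis
        proof (cases "\<exists>i\<in>{..<m} - {v}. \<exists>j\<in>{..<m} - {v}. i \<noteq> j \<and> c = {i, j}")
          case True
          then obtain i j where ij: "i \<in> {..<m} - {v}" "j \<in> {..<m} - {v}" "i \<noteq> j" "c = {i, j}" by blast
          \<comment> \<open>Nonadjacent vertices of \<open>W\<close> occupy the edge of color
            \<open>c\<close>, so the embedding does not use it.\<close>
          obtain g where g: "bij_betw g W ({..<m} - {v})" "g x0 = i" "g y0 = j"
            using bij_two[OF fW _ cT[symmetric] xy(1-3) ij(1-3)] by auto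
          have "{g x, g y} \<noteq> c" if "x \<in> W" "y \<in> W" "adj_of F x y" for x y
          proof
            assume "{g x, g y} = c"
            then have "{g x, g y} = {g x0, g y0}" using ij g by simp
            then have "{x, y} = {x0, y0}" using g(1) that xy by (auto simp: bij_betw_def inj_on_def doubleton_eq_iff)
            then show False using that(3) xy(4) adj_ofD(4)[OF F(1)] by (auto simp: doubleton_eq_iff)
          qed
          then show ?thesis using g by (intro exI[of _ g]) (auto simp: bij_betw_def)
        next
          case c: False
          obtain g where g: "bij_betw g W ({..<m} - {v})"
            using finite_same_card_bij[OF fW _ cT[symmetric]] by auto
          have "{g x, g y} \<noteq> c" if "x \<in> W" "y \<in> W" "adj_of F x y" for x y
          proof -
            have "g x \<in> {..<m} - {v}" "g y \<in> {..<m} - {v}" "g x \<noteq> g y"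
              using g that adj_ofD(1)[OF F(1) that(3)] by (auto simp: bij_betw_def inj_on_def)
            then show ?thesis using c by blast
          qed
          then show ?thesis using g by (intro exI[of _ g]) (auto simp: bij_betw_def)
        qed
      qed
    qed
    then obtain g where g: "inj_on g W" "g ` W \<subseteq> {..<m} - {v}" "\<forall>x\<in>W. \<forall>y\<in>W. adj_of F x y \<longrightarrow> {g x, g y} \<noteq> c"
      by blast
    have gm: "g x < m" "g x \<noteq> v" if "x \<in> W" for x using g(2) that by auto
    have hg: "h (g x) (g y) = Some {g x, g y}" if "x \<in> W" "y \<in> W" "adj_of F x y" for x y
      using that gm g(1) adj_ofD(1)[OF F(1) that(3)] by (auto simp: h_def inj_on_def)
    have eW: "emb W (adj_of F) {..<n} h g"
      unfolding emb_def
    proof (intro conjI ballI impI)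
      show "g ` W \<subseteq> {..<n}" using gm n cV by force
      fix x y x' y' assume a: "x \<in> W" "y \<in> W" "adj_of F x y"
      show "h (g x) (g y) \<noteq> None" using hg[OF a] by simp
      assume b: "x' \<in> W" "y' \<in> W" "adj_of F x' y'" "h (g x) (g y) = h (g x') (g y')"
      then have "{g x, g y} = {g x', g y'}" using hg[OF a] hg[OF b(1-3)] by simp
      then show "{x, y} = {x', y'}" using g(1) a b by (auto simp: doubleton_eq_iff inj_on_def)
    qed (use g in auto)
    have gmu: "g x \<noteq> u" if "x \<in> W" for x using gm(1)[OF that] uv(4) by simp
    show ?thesis
      by (rule emb_isolated_edge[OF F(1) pq, of u "{..<n}" v h g c])
        (use uv eW gm hg g(3) gmu in \<open>auto simp: W_def\<close>)
  qed
  have "rsat (card {..<n}) F \<le> card (Pow {..<m})"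
  proof (rule host_saturated[OF F(1) _ _ hs])
    show "{..<n} \<noteq> {}" using n cV by (auto simp: lessThan_empty_iff)
    show "\<not> emb (verts F) (adj_of F) {..<n} h f" for f
    proof
      assume f: "emb (verts F) (adj_of F) {..<n} h f"
      have "f x < m" if x: "x \<in> verts F" for x
      proof -
        obtain y where "y \<in> verts F" "adj_of F x y" using nbr[OF x] by blast
        then have "h (f x) (f y) \<noteq> None" using f x unfolding emb_def by blast
        then show ?thesis by (auto simp: h_def split: if_splits)
      qed
      then have "f ` verts F \<subseteq> {..<m}" by auto
      then have "card (verts F) \<le> m" using f unfolding emb_def by (metis card_inj_on_le card_lessThan finite_lessThan)
      then show False using cV by simp
    qed
    show "finite (Pow {..<m})" by simp
    show "h u v = None \<and> good (verts F) (adj_of F) {..<n} h u v"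
      if "u \<in> {..<n}" "v \<in> {..<n}" "u \<noteq> v" "{u, v} \<notin> Pow {..<m}" for u v
    proof -
      have "m \<le> u \<or> m \<le> v" using that(4) by auto
      then show ?thesis
        using gd[of u v] gd[of v u] that recolor_commute[of h u v] by (auto simp: good_def h_def)
    qed
  qed simp
  also have "\<dots> \<le> 2 ^ card (verts F)" using cV by (simp add: card_Pow)
  finally show ?thesis by simp
qed

text \<open>The host is a cocktail-party graph with parts \<open>{(i, True), (i, False)}\<close>; the color of an edge
  records the two parts and whether it switches sides. In a rainbow copy of \<open>F\<close> the clique
  \<open>F - {p, q}\<close> meets every part, and the edge \<open>pq\<close> would repeat the color of the edge between the
  antipodes of \<open>p\<close> and \<open>q\<close>.\<close>

lemma isolated_edge_complete:
  fixes F :: "'a graph"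
  assumes F: "simple_graph F" "no_isolated_vertices F"
    and pq: "adj_of F p q" "\<And>z. adj_of F p z \<Longrightarrow> z = q" "\<And>z. adj_of F q z \<Longrightarrow> z = p"
    and ne: "verts F - {p, q} \<noteq> {}"
    and co: "\<And>x y. x \<in> verts F - {p, q} \<Longrightarrow> y \<in> verts F - {p, q} \<Longrightarrow> x \<noteq> y \<Longrightarrow> adj_of F x y"
    and n: "2 * card (verts F) < n"
  shows "rsat n F \<le> 2 ^ (2 * card (verts F))"
proof -
  define W where "W = verts F - {p, q}"
  define r where "r = card W"
  have finV: "finite (verts F)" using F by (simp add: simple_graph_def)
  have pq': "p \<noteq> q" "p \<in> verts F" "q \<in> verts F" using adj_ofD[OF F(1) pq(1)] by auto
  have fW: "finite W" using finV by (simp add: W_def)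
  have rV: "r \<le> card (verts F)" unfolding r_def W_def using finV by (intro card_mono) auto
  obtain \<iota> where \<iota>: "bij_betw \<iota> W {..<r}" using ex_bij_betw_finite_nat[OF fW] by (auto simp: r_def atLeast0LessThan)
  define h :: "nat \<times> bool \<Rightarrow> nat \<times> bool \<Rightarrow> (nat set \<times> bool) option" where
    "h a b = (if fst a \<noteq> fst b \<and> fst a < r \<and> fst b < r then Some ({fst a, fst b}, snd a \<noteq> snd b) else None)" for a b
  have hs: "sym_host h" by (auto simp: sym_host_def h_def insert_commute)
  define Cr where "Cr = {..<r} \<times> (UNIV :: bool set)"
  define U where "U = Cr \<union> {r..<n - r} \<times> {True}"
  have cCr: "card Cr = 2 * r" by (simp add: Cr_def card_cartesian_product)
  have cU: "card U = n"
  proof -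
    have "card U = card Cr + card ({r..<n - r} \<times> {True})"
      unfolding U_def by (rule card_Un_disjoint) (auto simp: Cr_def)
    also have "\<dots> = 2 * r + (n - r - r)" using cCr by (simp add: card_cartesian_product)
    finally show ?thesis using n rV by simp
  qed
  have fU: "finite U" by (simp add: U_def Cr_def)
  have nbr: "\<exists>y\<in>verts F. adj_of F x y" if x: "x \<in> verts F" for x
  proof -
    obtain e where e: "e \<in> edges F" "x \<in> e" using F(2) x by (auto simp: no_isolated_vertices_def)
    then show ?thesis using simple_edgeE[OF F(1) e(1)] adj_ofD(4)[OF F(1)] by (metis insertE singletonD)
  qed
  have gd: "\<exists>f. emb (verts F) (adj_of F) U (recolor h u v c) f"
    if uv: "u \<in> U" "v \<in> U" "u \<noteq> v" "r \<le> fst u" for u v c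
  proof -
    obtain e \<epsilon> where c: "c = (e, \<epsilon>)" by fastforce
    \<comment> \<open>Side \<open>t\<close> of part \<open>a\<close> is the antipode of
      \<open>v\<close>, so a copy using side \<open>t\<close> there avoids \<open>v\<close>.\<close>
    define a t where "a = fst v" and "t = (\<not> snd v)"
    \<comment> \<open>A part of the forbidden pair on which the side may be changed without running
      into \<open>v\<close>.\<close>
    define m where "m = (SOME m. m \<in> e \<and> m \<noteq> a)"
    have m: "m \<in> e \<and> m \<noteq> a" if "i \<in> e" "i \<noteq> a" for i unfolding m_def by (rule someI[of _ i]) (use that in auto)
    \<comment> \<open>With all other parts on side \<open>t\<close>, the side of part
      \<open>m\<close> decides whether its edges switch sides; it is chosen so that they do not
      agree with \<open>\<epsilon>\<close>.\<close>
    define s where "s i = (if i = m \<and> m \<noteq> a then (if \<epsilon> then t else \<not> t) else t)" for i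
    define g where "g x = (\<iota> x, s (\<iota> x))" for x
    have il: "\<iota> x < r" if "x \<in> W" for x using \<iota> that by (auto simp: bij_betw_def)
    have ii: "\<iota> x \<noteq> \<iota> y" if "x \<in> W" "y \<in> W" "x \<noteq> y" for x y using \<iota> that by (auto simp: bij_betw_def inj_on_def)
    have hg: "h (g x) (g y) = Some ({\<iota> x, \<iota> y}, s (\<iota> x) \<noteq> s (\<iota> y))" if "x \<in> W" "y \<in> W" "adj_of F x y" for x y
      using that il ii adj_ofD(1)[OF F(1) that(3)] by (auto simp: h_def g_def)
    have eW: "emb W (adj_of F) U h g"
      unfolding emb_def
    proof (intro conjI ballI impI)
      show "inj_on g W" using ii by (auto simp: inj_on_def g_def)
      show "g ` W \<subseteq> U" using il by (auto simp: g_def U_def Cr_def)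
      fix x y x' y' assume a: "x \<in> W" "y \<in> W" "adj_of F x y"
      show "h (g x) (g y) \<noteq> None" using hg[OF a] by simp
      assume b: "x' \<in> W" "y' \<in> W" "adj_of F x' y'" "h (g x) (g y) = h (g x') (g y')"
      then have "{\<iota> x, \<iota> y} = {\<iota> x', \<iota> y'}" using hg[OF a] hg[OF b(1-3)] by simp
      then show "{x, y} = {x', y'}" using ii a b by (auto simp: doubleton_eq_iff)
    qed
    have nc: "h (g x) (g y) \<noteq> Some c" if xy: "x \<in> W" "y \<in> W" "adj_of F x y" for x y
    proof
      assume "h (g x) (g y) = Some c"
      then have e: "e = {\<iota> x, \<iota> y}" "\<epsilon> = (s (\<iota> x) \<noteq> s (\<iota> y))" using hg[OF xy] c by auto
      have ne: "\<iota> x \<noteq> \<iota> y" using ii xy adj_ofD(1)[OF F(1) xy(3)] by blast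
      have "\<exists>i\<in>e. i \<noteq> a" using ne unfolding e(1) by (metis insertCI)
      then have "m \<in> e \<and> m \<noteq> a" using m by blast
      then consider "m = \<iota> x" "m \<noteq> a" | "m = \<iota> y" "m \<noteq> a" using e(1) by auto
      then show False
      proof cases
        case 1
        then have "s (\<iota> y) = t" "s (\<iota> x) = (if \<epsilon> then t else \<not> t)" using ne by (auto simp: s_def)
        then show False using e(2) by (cases \<epsilon>) auto
      next
        case 2
        then have "s (\<iota> x) = t" "s (\<iota> y) = (if \<epsilon> then t else \<not> t)" using ne by (auto simp: s_def)
        then show False using e(2) by (cases \<epsilon>) auto
      qed
    qed
    have "g x \<noteq> u \<and> g x \<noteq> v" if "x \<in> W" for x
    proof
      show "g x \<noteq> u" using il[OF that] uv(4) by (auto simp: g_def)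
      show "g x \<noteq> v" by (cases v) (auto simp: g_def s_def a_def t_def)
    qed
    then show ?thesis
      by (intro emb_isolated_edge[OF F(1) pq, of u U v h g c]) (use uv eW nc in \<open>auto simp: W_def\<close>)
  qed
  have "rsat (card U) F \<le> card (Pow Cr)"
  proof (rule host_saturated[OF F(1) fU _ hs])
    show "U \<noteq> {}" using cU n by auto
    show "\<not> emb (verts F) (adj_of F) U h f" for f
    proof
      assume f: "emb (verts F) (adj_of F) U h f"
      have he: "h (f x) (f y) \<noteq> None" if "x \<in> verts F" "y \<in> verts F" "adj_of F x y" for x y
        using f that unfolding emb_def by blast
      have lt: "fst (f x) < r" if x: "x \<in> verts F" for x
      proof -
        obtain y where "y \<in> verts F" "adj_of F x y" using nbr[OF x] by blast
        then show ?thesis using he[of x y] x by (auto simp: h_def split: if_splits)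
      qed
      have inj: "inj_on (fst \<circ> f) W"
      proof (rule inj_onI, rule ccontr)
        fix x y assume xy: "x \<in> W" "y \<in> W" "(fst \<circ> f) x = (fst \<circ> f) y" "x \<noteq> y"
        then have "adj_of F x y" using co by (simp add: W_def)
        then show False using he[of x y] xy by (auto simp: h_def W_def split: if_splits)
      qed
      have "(fst \<circ> f) ` W = {..<r}"
      proof (rule card_subset_eq)
        show "(fst \<circ> f) ` W \<subseteq> {..<r}" using lt by (auto simp: W_def)
        show "card ((fst \<circ> f) ` W) = card {..<r}" using card_image[OF inj] by (simp add: r_def)
      qed simp
      have ex: "\<exists>x\<in>W. fst (f x) = i" if i: "i < r" for i
      proof -
        have "i \<in> (fst \<circ> f) ` W" using i \<open>(fst \<circ> f) ` W = {..<r}\<close> by simp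
        then show ?thesis by auto
      qed
      obtain xa where xa: "xa \<in> W" "fst (f xa) = fst (f p)" using ex lt pq' by blast
      obtain xb where xb: "xb \<in> W" "fst (f xb) = fst (f q)" using ex lt pq' by blast
      have neq: "f xa \<noteq> f p" "f xb \<noteq> f q"
        using inj_onD[of f "verts F"] f xa xb pq' unfolding emb_def W_def by blast+
      then have sn: "snd (f xa) = (\<not> snd (f p))" "snd (f xb) = (\<not> snd (f q))"
        using xa(2) xb(2) prod_eqI[of "f xa" "f p"] prod_eqI[of "f xb" "f q"] by blast+
      have "fst (f p) \<noteq> fst (f q)" using he[OF pq'(2,3) pq(1)] unfolding h_def by metis
      then have "xa \<noteq> xb" using xa xb by auto
      then have adj: "adj_of F xa xb" using co xa xb by (simp add: W_def)
      have "h (f xa) (f xb) = h (f p) (f q)" using xa xb sn by (simp add: h_def)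
      then have "{xa, xb} = {p, q}" using f adj pq xa xb pq' unfolding emb_def W_def by blast
      then show False using xa by (auto simp: W_def)
    qed
    show "finite (Pow Cr)" by (simp add: Cr_def)
    show "h u v = None \<and> good (verts F) (adj_of F) U h u v"
      if "u \<in> U" "v \<in> U" "u \<noteq> v" "{u, v} \<notin> Pow Cr" for u v
    proof -
      have "r \<le> fst u \<or> r \<le> fst v" using that(4) by (cases u; cases v) (auto simp: Cr_def)
      then show ?thesis
        using gd[of u v] gd[of v u] that recolor_commute[of h u v] by (auto simp: good_def h_def)
    qed
  qed
  also have "card (Pow Cr) \<le> 2 ^ (2 * card (verts F))" using rV cCr by (simp add: card_Pow Cr_def)
  finally show ?thesis using cU by simp
qed


section \<open>The asymptotic statements\<close>

lemma rsat_attained: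
  assumes "simple_graph F" "no_isolated_vertices F" "1 \<le> n"
  obtains G :: "nat graph" and C where "simple_graph G" "card (verts G) = n" "rainbow_saturated F (G, C)"
    "rsat n F = card (edges G)"
proof -
  have "rsat n F \<in> saturated_sizes n F"
    unfolding rsat_def using saturated_sizes_nonempty[OF assms] by (rule Inf_nat_def1)
  then show thesis using that unfolding saturated_sizes_def by blast
qed

theorem theorem1p1:
  fixes F :: "'a graph"
  assumes "simple_graph F" and "no_isolated_vertices F"
  shows "(has_isolated_edge F \<longrightarrow> (\<lambda>n::nat. real (rsat n F)) \<in> O(\<lambda>_. 1)) \<and>
         (\<not> has_isolated_edge F \<longrightarrow> (\<lambda>n::nat. real (rsat n F)) \<in> \<Theta>(\<lambda>n. real n))"
proof (intro conjI impI)
  assume "has_isolated_edge F"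
  then obtain p q where pq: "adj_of F p q" "\<And>z. adj_of F p z \<Longrightarrow> z = q" "\<And>z. adj_of F q z \<Longrightarrow> z = p"
    using has_isolated_edgeE[OF assms(1)] by metis
  define k where "k = card (verts F)"
  have bound: "rsat n F \<le> 2 ^ (2 * k)" if n: "2 * k < n" for n
  proof (cases "verts F - {p, q} = {} \<or> (\<exists>x\<in>verts F - {p, q}. \<exists>y\<in>verts F - {p, q}. x \<noteq> y \<and> \<not> adj_of F x y)")
    case True
    have "card (verts F) \<le> n" using n by (simp add: k_def)
    then have "rsat n F \<le> 2 ^ k" unfolding k_def using isolated_edge_incomplete[OF assms pq True] by blast
    also have "\<dots> \<le> 2 ^ (2 * k)" by (intro power_increasing) simp_all
    finally show ?thesis .
  next
    case False
    have "rsat n F \<le> 2 ^ (2 * card (verts F))"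
      by (rule isolated_edge_complete[OF assms pq]) (use False n in \<open>auto simp: k_def\<close>)
    then show ?thesis by (simp add: k_def)
  qed
  show "(\<lambda>n. real (rsat n F)) \<in> O(\<lambda>_. 1)"
  proof (rule bigoI[of _ "2 ^ (2 * k)"])
    show "\<forall>\<^sub>F n in sequentially. norm (real (rsat n F)) \<le> 2 ^ (2 * k) * norm (1::real)"
      using eventually_gt_at_top[of "2 * k"]
    proof eventually_elim
      case (elim n)
      have "real (rsat n F) \<le> real (2 ^ (2 * k))" using bound[OF elim] by (simp only: of_nat_le_iff)
      then show ?case by simp
    qed
  qed
next
  assume nh: "\<not> has_isolated_edge F"
  have nie: "\<exists>z. z \<noteq> p \<and> z \<noteq> q \<and> (adj_of F p z \<or> adj_of F q z)" if pq: "adj_of F p q" for p q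
  proof (rule ccontr)
    assume n: "\<not> ?thesis"
    have ne: "p \<noteq> q" using adj_ofD(1)[OF assms(1) pq] .
    have "has_isolated_edge F"
    proof (rule has_isolated_edgeI[OF assms(1) pq])
      show "z = q" if "adj_of F p z" for z using n that adj_ofD(1)[OF assms(1) that] by metis
      show "z = p" if "adj_of F q z" for z using n that adj_ofD(1)[OF assms(1) that] by metis
    qed
    then show False using nh by blast
  qed
  interpret rgraph F
  proof
    show "\<exists>q. adj_of F p q" if p: "p \<in> verts F" for p
    proof -
      obtain e where e: "e \<in> edges F" "p \<in> e" using assms(2) p by (auto simp: no_isolated_vertices_def)
      then show ?thesis using simple_edgeE[OF assms(1) e(1)] adj_ofD(4)[OF assms(1)] by (metis insertE singletonD)
    qed
  qed (fact assms(1) nie)+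
  obtain c n0 where up: "\<And>n. n0 \<le> n \<Longrightarrow> rsat n F \<le> c * n" using linear_upper by blast
  have low: "n \<le> 2 * rsat n F + 1" if n: "1 \<le> n" for n
  proof -
    obtain G :: "nat graph" and C where G: "simple_graph G" "card (verts G) = n" "rainbow_saturated F (G, C)"
      "rsat n F = card (edges G)" by (rule rsat_attained[OF assms n])
    have "card (verts G) \<le> 2 * card (edges G) + 1"
      by (rule no_isolated_pair_lower[OF assms _ G(1,3)]) (use nie in blast)
    then show ?thesis using G(2,4) by simp
  qed
  show "(\<lambda>n. real (rsat n F)) \<in> \<Theta>(\<lambda>n. real n)"
  proof (rule bigthetaI)
    show "(\<lambda>n. real (rsat n F)) \<in> O(\<lambda>n. real n)"
    proof (rule bigoI[of _ "real c"])
      show "\<forall>\<^sub>F n in sequentially. norm (real (rsat n F)) \<le> real c * norm (real n)"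
        using eventually_ge_at_top[of n0]
      proof eventually_elim
        case (elim n)
        have "real (rsat n F) \<le> real (c * n)" using up[OF elim] by (simp only: of_nat_le_iff)
        then show ?case by simp
      qed
    qed
    show "(\<lambda>n. real (rsat n F)) \<in> \<Omega>(\<lambda>n. real n)"
    \<comment> \<open>From \<open>n <= 2 * rsat n F + 1\<close>: \<open>(n - 1) / 2\<close> is at
      least \<open>n / 4\<close> once \<open>n >= 2\<close>.\<close>
    proof (rule landau_omega.bigI[of "1/4"])
      show "\<forall>\<^sub>F n in sequentially. 1/4 * norm (real n) \<le> norm (real (rsat n F))"
        using eventually_ge_at_top[of 2]
      proof eventually_elim
        case (elim n)
        have "real n \<le> real (2 * rsat n F + 1)" using low[of n] elim by (simp only: of_nat_le_iff)
        then show ?case using elim by simp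
      qed
    qed simp
  qed
qed

end
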